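(* Let $k$ be an algebraically closed field, and let $N, n, q$ be positive integers. Consider the variety $$\mathcal{X}_{N,n} = \mathbb{P}(\mathrm{Mat}_{N+1}) \times (\mathbb{P}^N)^n$$ equipped with the action of $\mathrm{SL}_{N+1}$ given by $A\cdot(T,v_1,\ldots,v_n) = (ATA^{-1},Av_1,\ldots,Av_n)$, the sheaf $\mathcal{L}=\mathcal{O}(q,1,\ldots,1)$, and its unique $\mathrm{SL}_{N+1}$-linearization. (a) Let $T\in\mathbb{P}(\mathrm{Mat}_{N+1})$ and let $\mathcal{H}$ be a flag in $k^{N+1}$. Then $\mathcal{H}$ belongs to at most one of the three types I, II, III relative to $T$. (b) A point $(T,v_1,\ldots,v_n)\in\mathcal{X}_{N,n}$ is GIT semistable (relative to $\mathcal{L}$) if and only if, for every $1\le\gamma\le N$ and every flag $\mathcal{H}=(H_1,\ldots,H_\gamma)$ in $k^{N+1}$ that is of Type I, II, or III relative to $T$, we have $$\sum_{j=1}^\gamma \#\{i : v_i\in H_j\} \le \frac{n}{N+1}\sum_{j=1}^\gamma \dim H_j + \begin{cases} 0 & \text{if } \mathcal{H} \text{ is Type I relative to } T,\\ q & \text{if } \mathcal{H} \text{ is Type II relative to } T,\\ -q & \text{if } \mathcal{H} \text{ is Type III relative to } T.\end{cases}$$ (c) A point $(T,v_1,\ldots,v_n)\in\mathcal{X}_{N,n}$ is GIT stable (relative to $\mathcal{L}$) if and only if, for every flag $\mathcal{H}$ of Type I, II, or III relative to $T$, the inequality in (b) is strict.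
   Context: $\mathrm{Mat}_{N+1}$ is the space of linear endomorphisms of $k^{N+1}$ and $\mathbb{P}(\mathrm{Mat}_{N+1})$ its projectivization (nonzero endomorphisms up to scale). For $T\in\mathbb{P}(\mathrm{Mat}_{N+1})$ and a subspace $H\subseteq k^{N+1}$, $TH$ denotes the image of $H$ under any linear lift of $T$. For $v\in\mathbb{P}^N$, $v\in H$ means that the line in $k^{N+1}$ represented by $v$ is contained in $H$. GIT stability: a point is semistable with respect to a linearized sheaf $\mathcal{L}$ if for some $m\geq 1$ there is an invariant global section $s$ of $\mathcal{L}^{\otimes m}$ whose nonvanishing locus $V_s$ is affine and contains the point; it is stable if moreover $V_s$ may be chosen so that the stabilizer of the point is finite and all orbits in $V_s$ are closed in $V_s$. A flag $\mathcal{H}$ in $k^{N+1}$ is a nested sequence of linear subspaces $0\subsetneq H_1\subsetneq\cdots\subsetneq H_\gamma\subsetneq k^{N+1}$; set $H_0=\{0\}$ and $H_{\gamma+1}=k^{N+1}$. The Hessenberg function of $\mathcal{H}$ relative to $T$ is $$h_{T,\mathcal{H}}:\{0,\ldots,\gamma+1\}\to\{0,\ldots,\gamma+1\},\qquad i\mapsto\min\{j : TH_i\subseteq H_j\}.$$ Types of flags relative to $T$ (a flag need not be of any type): - Type I: $\gamma=1$, and $\mathcal{H}=(H_1)$ satisfies either ($0\ne TH_1\subseteq H_1$) or ($TH_1\subseteq H_1$ and $T(k^{N+1})\not\subseteq H_1$). - Type II: $h_{T,\mathcal{H}}(t)=t+1$ for all $1\le t\le\gamma$. - Type III: $h_{T,\mathcal{H}}(t)=t-1$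 for all $1\le t\le\gamma+1$. *)

theory Defs
  imports "HOL-Analysis.Analysis" "HOL-Computational_Algebra.Polynomial"
begin

section \<open>Projective spaces\<close>

text \<open>
  The space \<open>k\<^sup>N\<^sup>+\<^sup>1\<close> is \<open>'a ^ 'n\<close> with \<open>CARD('n) = N + 1\<close>, and the \<open>n\<close> marked points are indexed
  by a finite type \<open>'m\<close>. Points of a projective space are lines through the origin.
\<close>

definition mscale :: "'a::field \<Rightarrow> 'a ^ 'n::finite ^ 'n \<Rightarrow> 'a ^ 'n ^ 'n" where
  "mscale c M = (\<chi> i j. c * M $ i $ j)"

definition PMat :: "('a::field ^ 'n::finite ^ 'n) set set" where
  "PMat = {range (\<lambda>c. mscale c M) | M. M \<noteq> 0}"

definition PN :: "('a::field ^ 'n::finite) set set" where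
  "PN = {range (\<lambda>c. c *s w) | w. w \<noteq> 0}"

type_synonym ('a, 'n, 'm) point = "('a ^ 'n ^ 'n) set \<times> ('m \<Rightarrow> ('a ^ 'n) set)"

type_synonym ('a, 'n, 'm) coords = "('a ^ 'n ^ 'n) \<times> ('m \<Rightarrow> 'a ^ 'n)"

definition XX :: "('a::field, 'n::finite, 'm) point set" where
  "XX = PMat \<times> (UNIV \<rightarrow> PN)"

definition cone :: "('a::field, 'n::finite, 'm) coords set" where
  "cone = {(M, w). M \<noteq> 0 \<and> (\<forall>i. w i \<noteq> 0)}"

text \<open>The point with the given homogeneous coordinates (an element of \<^const>\<open>XX\<close> for
  coordinates in \<^const>\<open>cone\<close>).\<close>

definition pt :: "('a::field, 'n::finite, 'm) coords \<Rightarrow> ('a, 'n, 'm) point" where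
  "pt = (\<lambda>(M, w). (range (\<lambda>c. mscale c M), \<lambda>i. range (\<lambda>c. c *s w i)))"


section \<open>Polynomials, Zariski topologies and regular functions\<close>

text \<open>Polynomial functions in a given set \<open>C\<close> of coordinate functions. Over an infinite field (in
  particular an algebraically closed one) they are the same thing as polynomials.\<close>

inductive_set poly_fun :: "('x \<Rightarrow> 'a::comm_ring_1) set \<Rightarrow> ('x \<Rightarrow> 'a) set"
  for C :: "('x \<Rightarrow> 'a) set" where
  const: "(\<lambda>x. c) \<in> poly_fun C"
| coord: "f \<in> C \<Longrightarrow> f \<in> poly_fun C"
| add: "f \<in> poly_fun C \<Longrightarrow> g \<in> poly_fun C \<Longrightarrow> (\<lambda>x. f x + g x) \<in> poly_fun C"
| mult: "f \<in> poly_fun C \<Longrightarrow> g \<in> poly_fun C \<Longrightarrow> (\<lambda>x. f x * g x) \<in> poly_fun C"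

definition coord_funs :: "(('a::field, 'n::finite, 'm) coords \<Rightarrow> 'a) set" where
  "coord_funs = {\<lambda>(M, w). M $ i $ j | i j. True} \<union> {\<lambda>(M, w). w i $ j | i j. True}"

text \<open>Multihomogeneous polynomials of multidegree \<open>(d0, (d i)\<^sub>i)\<close>. Again, over an infinite field the
  scaling identity characterises homogeneity of the underlying polynomial.\<close>

definition multihom :: "nat \<Rightarrow> ('m \<Rightarrow> nat) \<Rightarrow> (('a::field, 'n::finite, 'm::finite) coords \<Rightarrow> 'a) set" where
  "multihom d0 d = {f \<in> poly_fun coord_funs.
     \<forall>a b M w. f (mscale a M, \<lambda>i. b i *s w i) = a ^ d0 * (\<Prod>i\<in>UNIV. b i ^ d i) * f (M, w)}"

definition nonvanishing :: "(('a::field, 'n::finite, 'm) coords \<Rightarrow> 'a) \<Rightarrow> ('a, 'n, 'm) point set" where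
  "nonvanishing s = pt ` {x \<in> cone. s x \<noteq> 0}"

definition zariski_X :: "('a::field, 'n::finite, 'm::finite) point topology" where
  "zariski_X = topology_generated_by {nonvanishing f | f d0 d. f \<in> multihom d0 d}"

text \<open>
  Sections of the sheaf \<open>\<O>(d0, (d i)\<^sub>i)\<close> over an open subset \<open>U\<close> of \<^const>\<open>XX\<close>, as functions of the
  homogeneous coordinates: locally they are quotients \<open>g / h\<close> of multihomogeneous polynomials with
  multidegree difference \<open>(d0, d)\<close>. The values off the cone over \<open>U\<close> are irrelevant. The tensor
  power \<open>\<O>(d0, d)\<^sup>\<otimes>\<^sup>m\<close> is \<open>\<O>(m d0, m d)\<close>.
\<close>

definition sections ::
    "nat \<Rightarrow> ('m \<Rightarrow> nat) \<Rightarrow> ('a::field, 'n::finite, 'm::finite) point set \<Rightarrow> (('a, 'n, 'm) coords \<Rightarrow> 'a) set"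
  where
  "sections d0 d U = {s. \<forall>p\<in>U. \<exists>W e0 e g h.
     openin zariski_X W \<and> p \<in> W \<and> W \<subseteq> U \<and>
     g \<in> multihom (e0 + d0) (\<lambda>i. e i + d i) \<and> h \<in> multihom e0 e \<and>
     (\<forall>x\<in>cone. pt x \<in> W \<longrightarrow> h x \<noteq> 0 \<and> s x = g x / h x)}"

definition regular_X :: "('a::field, 'n::finite, 'm::finite) point set \<Rightarrow> (('a, 'n, 'm) point \<Rightarrow> 'a) set" where
  "regular_X U = {f. f \<circ> pt \<in> sections 0 (\<lambda>_. 0) U}"

text \<open>Affine \<open>r\<close>-space, realised as the functions on \<open>nat\<close> vanishing from \<open>r\<close> on.\<close>

definition aff_space :: "nat \<Rightarrow> (nat \<Rightarrow> 'a::field) set" where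
  "aff_space r = {x. \<forall>i\<ge>r. x i = 0}"

definition aff_polys :: "nat \<Rightarrow> ((nat \<Rightarrow> 'a::field) \<Rightarrow> 'a) set" where
  "aff_polys r = poly_fun {\<lambda>x. x i | i. i < r}"

definition zariski_aff :: "nat \<Rightarrow> (nat \<Rightarrow> 'a::field) topology" where
  "zariski_aff r = topology_generated_by {{x \<in> aff_space r. f x \<noteq> 0} | f. f \<in> aff_polys r}"

definition regular_aff ::
    "nat \<Rightarrow> (nat \<Rightarrow> 'a::field) set \<Rightarrow> (nat \<Rightarrow> 'a) set \<Rightarrow> ((nat \<Rightarrow> 'a) \<Rightarrow> 'a) set" where
  "regular_aff r Z U = {f. \<forall>p\<in>U. \<exists>W g h.
     openin (subtopology (zariski_aff r) Z) W \<and> p \<in> W \<and> W \<subseteq> U \<and>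
     g \<in> aff_polys r \<and> h \<in> aff_polys r \<and> (\<forall>x\<in>W. h x \<noteq> 0 \<and> f x = g x / h x)}"

text \<open>An open subset of \<^const>\<open>XX\<close> is affine if it is isomorphic to a Zariski closed subset \<open>Z\<close> of some
  affine space: there is a homeomorphism \<open>\<phi>\<close> that identifies the regular functions on open sets.\<close>

definition affine_open :: "('a::field, 'n::finite, 'm::finite) point set \<Rightarrow> bool" where
  "affine_open V \<longleftrightarrow> openin zariski_X V \<and>
     (\<exists>r Z \<phi>. closedin (zariski_aff r) Z \<and>
        homeomorphic_map (subtopology zariski_X V) (subtopology (zariski_aff r) Z) \<phi> \<and>
        (\<forall>U f. openin (subtopology (zariski_aff r) Z) U \<longrightarrow>
           (f \<in> regular_aff r Z U \<longleftrightarrow> f \<circ> \<phi> \<in> regular_X {p \<in> V. \<phi> p \<in> U})))"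


section \<open>GIT stability\<close>

definition SL :: "('a::field ^ 'n::finite ^ 'n) set" where
  "SL = {A. det A = 1}"

definition act :: "'a::field ^ 'n::finite ^ 'n \<Rightarrow> ('a, 'n, 'm) coords \<Rightarrow> ('a, 'n, 'm) coords" where
  "act A = (\<lambda>(M, w). (A ** M ** matrix_inv A, \<lambda>i. A *v w i))"

definition act_pt :: "'a::field ^ 'n::finite ^ 'n \<Rightarrow> ('a, 'n, 'm) point \<Rightarrow> ('a, 'n, 'm) point" where
  "act_pt A = (\<lambda>(T, v). ((\<lambda>M. A ** M ** matrix_inv A) ` T, \<lambda>i. (\<lambda>w. A *v w) ` v i))"

definition stabilizer :: "('a::field, 'n::finite, 'm) point \<Rightarrow> ('a ^ 'n::finite ^ 'n) set" where
  "stabilizer p = {A \<in> SL. act_pt A p = p}"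

definition orbit :: "('a::field, 'n::finite, 'm) point \<Rightarrow> ('a, 'n, 'm) point set" where
  "orbit p = {act_pt A p | A. A \<in> SL}"

text \<open>
  Invariant global sections of \<open>\<O>(d0, d)\<close>. Its linearization is the one induced by the linear action
  on the coordinates (unique because \<open>SL\<close> has no nontrivial characters), so a section is invariant
  iff it is an invariant function of the coordinates.
\<close>

definition invariant_sections ::
    "nat \<Rightarrow> ('m \<Rightarrow> nat) \<Rightarrow> (('a::field, 'n::finite, 'm::finite) coords \<Rightarrow> 'a) set" where
  "invariant_sections d0 d =
     {s \<in> sections d0 d XX. \<forall>A\<in>SL. \<forall>x\<in>cone. s (act A x) = s x}"

definition git_semistable ::
    "nat \<Rightarrow> ('m \<Rightarrow> nat) \<Rightarrow> ('a::field, 'n::finite, 'm::finite) point \<Rightarrow> bool" where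
  "git_semistable d0 d p \<longleftrightarrow>
     (\<exists>m\<ge>1. \<exists>s\<in>invariant_sections (m * d0) (\<lambda>i. m * d i).
        affine_open (nonvanishing s) \<and> p \<in> nonvanishing s)"

definition git_stable ::
    "nat \<Rightarrow> ('m \<Rightarrow> nat) \<Rightarrow> ('a::field, 'n::finite, 'm::finite) point \<Rightarrow> bool" where
  "git_stable d0 d p \<longleftrightarrow>
     (\<exists>m\<ge>1. \<exists>s\<in>invariant_sections (m * d0) (\<lambda>i. m * d i).
        affine_open (nonvanishing s) \<and> p \<in> nonvanishing s \<and>
        finite (stabilizer p) \<and>
        (\<forall>y\<in>nonvanishing s. closedin (subtopology zariski_X (nonvanishing s)) (orbit y)))"


section \<open>Flags and their types\<close>

text \<open>A flag of length \<open>\<gamma>\<close> is indexed so as to include \<open>H 0 = 0\<close> and \<open>H (\<gamma> + 1)\<close>, the whole space;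
  values of \<open>H\<close> beyond \<open>\<gamma> + 1\<close> are irrelevant.\<close>

definition is_flag :: "nat \<Rightarrow> (nat \<Rightarrow> ('a::field ^ 'n::finite) set) \<Rightarrow> bool" where
  "is_flag \<gamma> H \<longleftrightarrow> 1 \<le> \<gamma> \<and> H 0 = {0} \<and> H (\<gamma> + 1) = UNIV \<and>
     (\<forall>j\<le>\<gamma> + 1. vec.subspace (H j)) \<and> (\<forall>j\<le>\<gamma>. H j \<subset> H (j + 1))"

text \<open>The image of a subspace under a linear lift of \<open>T\<close>; it does not depend on the lift.\<close>

definition pimage :: "('a::field ^ 'n::finite ^ 'n) set \<Rightarrow> ('a ^ 'n) set \<Rightarrow> ('a ^ 'n) set" where
  "pimage T H = (\<lambda>x. (SOME M. M \<in> T \<and> M \<noteq> 0) *v x) ` H"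

definition hess ::
    "('a::field ^ 'n::finite ^ 'n) set \<Rightarrow> nat \<Rightarrow> (nat \<Rightarrow> ('a ^ 'n) set) \<Rightarrow> nat \<Rightarrow> nat" where
  "hess T \<gamma> H i = Min {j \<in> {0..\<gamma> + 1}. pimage T (H i) \<subseteq> H j}"

definition type_I :: "('a::field ^ 'n::finite ^ 'n) set \<Rightarrow> nat \<Rightarrow> (nat \<Rightarrow> ('a ^ 'n) set) \<Rightarrow> bool" where
  "type_I T \<gamma> H \<longleftrightarrow> \<gamma> = 1 \<and>
     (pimage T (H 1) \<noteq> {0} \<and> pimage T (H 1) \<subseteq> H 1 \<or>
      pimage T (H 1) \<subseteq> H 1 \<and> \<not> pimage T UNIV \<subseteq> H 1)"

definition type_II :: "('a::field ^ 'n::finite ^ 'n) set \<Rightarrow> nat \<Rightarrow> (nat \<Rightarrow> ('a ^ 'n) set) \<Rightarrow> bool" where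
  "type_II T \<gamma> H \<longleftrightarrow> (\<forall>t\<in>{1..\<gamma>}. hess T \<gamma> H t = t + 1)"

definition type_III :: "('a::field ^ 'n::finite ^ 'n) set \<Rightarrow> nat \<Rightarrow> (nat \<Rightarrow> ('a ^ 'n) set) \<Rightarrow> bool" where
  "type_III T \<gamma> H \<longleftrightarrow> (\<forall>t\<in>{1..\<gamma> + 1}. hess T \<gamma> H t = t - 1)"

text \<open>The correction term; only meaningful for flags of one of the three types, which exclude
  each other.\<close>

definition type_term ::
    "nat \<Rightarrow> ('a::field ^ 'n::finite ^ 'n) set \<Rightarrow> nat \<Rightarrow> (nat \<Rightarrow> ('a ^ 'n) set) \<Rightarrow> real" where
  "type_term q T \<gamma> H =
     (if type_I T \<gamma> H then 0 else if type_II T \<gamma> H then real q else - real q)"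

end

theory Submission
  imports Defs "HOL-Library.Multiset"
begin

text \<open>
  A flag of type I, II or III is moved by \<open>T\<close> by at most \<open>\<delta> = 0, 1, -1\<close> steps, and somewhere by exactly
  \<open>\<delta>\<close> steps. Hence the one-parameter subgroup with equidistant weights on the flag has a limit at the
  point, and the weight of \<open>\<L>\<close> at the limit is a multiple of the difference of the two sides of the
  inequality. An invariant section that does not vanish at the point forces the sign of this weight,
  and if the weight is zero then the limit lies in the orbit closure and has an infinite stabilizer.

  For the converse, consider the Krylov vectors \<open>T\<^sup>a v\<^sub>i\<close>. The determinants of \<open>N + 1\<close> of them and the
  coefficients of the characteristic polynomial of \<open>T\<close> are invariant forms. By Farkas' lemma, either a
  product of such forms is a section of a power of \<open>\<L>\<close> that does not vanish at the point, or there
  is a linear functional on multidegrees that is nonnegative on the forms not vanishing at the point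
  but negative on \<open>\<L>\<close>. In the second case the functional assigns weights to the Krylov vectors, a
  greedy choice of a basis shows that the filtration of \<open>k\<^sup>N\<^sup>+\<^sup>1\<close> by weight is too small, and the
  filtration decomposes into flags of types I, II and III, one of which violates its inequality. If the
  inequalities are strict, the invariant forms that do not vanish at the point have degrees on all sides
  of \<open>\<L>\<close>, so that the invariant sections of powers of \<open>\<L>\<close> determine all invariant forms up to a
  character of the torus of rescalings, and the determinants recover the point up to \<open>SL\<close>. This makes
  the orbits closed.
\<close>

text \<open>The correction term comes from the matrix factor: if \<open>T\<close> moves a flag by
  \<delta> steps, the subgroup rescales the limit of \<open>T\<close> with weight
  \<open>- (N + 1) \<delta>\<close>, and \<open>O(q)\<close> multiplies this by \<open>q\<close>. A
  separating functional may shift weights by any integer \<open>z\<close>; the levels then split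
  into |z| residue classes, each a chain moved by one step, so three values of \<delta> suffice. The
  delicate case of the converse is \<open>z < 0\<close>: \<open>T\<close> lowers weights, so the
  filtration is compatible with \<open>T\<close> only if a power of \<open>T\<close> kills the
  marked vectors. If none does, \<open>T\<close> has a nonzero eigenvalue, and a nonvanishing
  coefficient of the characteristic polynomial excludes \<open>z < 0\<close>. Strict inequalities
  put the degree of \<open>L\<close> in the interior of the cone of degrees of the invariant forms
  that do not vanish at the point. Every degree can then be completed to a multiple of that of
  \<open>L\<close>; finiteness of the stabilizer and closedness of the orbit both rest on this. As
  stability asks for closed orbits throughout a locus, the section is chosen so that strictness
  spreads over its whole locus.\<close>

section \<open>Polynomial identities over an infinite field\<close>

lemma infinite_UNIV_alg_closed: "infinite (UNIV :: 'a::alg_closed_field set)"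
proof
  assume fin: "finite (UNIV :: 'a set)"
  \<comment> \<open>Its value is 1 everywhere although its degree is positive.\<close>
  define p where "p = (1 :: 'a poly) + (\<Prod>a\<in>UNIV. [:- a, 1:])"
  have "poly p x = 1" for x
  proof -
    have "(\<Prod>a\<in>UNIV. poly [:- a, 1:] x) = 0"
      using fin by (intro prod_zero) (auto intro: exI[of _ x])
    then show ?thesis by (simp add: p_def poly_prod)
  qed
  moreover have "degree p > 0"
  proof -
    have d: "degree (\<Prod>a\<in>(UNIV::'a set). [:- a, 1:]) = card (UNIV :: 'a set)"
      by (subst degree_prod_eq_sum_degree) auto
    have "card (UNIV :: 'a set) > 0" using fin by (simp add: finite_UNIV_card_ge_0)
    then have "degree (\<Prod>a\<in>(UNIV::'a set). [:- a, 1:]) > 0" using d by simp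
    then show ?thesis unfolding p_def by (subst degree_add_eq_right) auto
  qed
  ultimately show False using alg_closed_imp_poly_has_root[of p] by auto
qed

text \<open>Identities along curves are obtained off finitely many parameters; as identities of
  polynomials they can be evaluated at the limit \<open>t = 0\<close>.\<close>

lemma poly_eq_cofinite:
  fixes p q :: "'a::alg_closed_field poly"
  assumes "finite {t. poly p t \<noteq> poly q t}"
  shows "p = q"
proof (rule ccontr)
  assume "p \<noteq> q"
  then have "finite {t. poly (p - q) t = 0}" by (intro poly_roots_finite) auto
  moreover have "{t. poly (p - q) t = 0} \<union> {t. poly p t \<noteq> poly q t} = UNIV" by auto
  ultimately show False using assms infinite_UNIV_alg_closed[where 'a='a]
    by (metis finite_UnI)
qed

section \<open>Rescaling homogeneous coordinates\<close>

text \<open>Indexing the blocks by \<open>'m option\<close> makes a multidegree a single lattice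
  vector, the form in which Farkas' lemma and characters of tori apply.\<close>

definition hscale :: "('m option \<Rightarrow> 'a::field) \<Rightarrow> ('a, 'n::finite, 'm) coords \<Rightarrow> ('a, 'n, 'm) coords" where
  "hscale b = (\<lambda>(M, w). (mscale (b None) M, \<lambda>i. b (Some i) *s w i))"

definition mhom :: "('m option \<Rightarrow> nat) \<Rightarrow> (('a::field, 'n::finite, 'm::finite) coords \<Rightarrow> 'a) set" where
  "mhom D = multihom (D None) (\<lambda>i. D (Some i))"

lemma prod_option: "(\<Prod>\<beta>\<in>UNIV. f \<beta>) = f None * (\<Prod>i\<in>UNIV. f (Some i))"
  for f :: "'m::finite option \<Rightarrow> 'a::comm_monoid_mult"
  by (simp add: UNIV_option_conv prod.reindex)

lemma sum_option: "(\<Sum>\<beta>\<in>UNIV. f \<beta>) = f None + (\<Sum>i\<in>UNIV. f (Some i))"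
  for f :: "'m::finite option \<Rightarrow> 'a::comm_monoid_add"
  by (simp add: UNIV_option_conv sum.reindex)

lemma multihom_eq_mhom: "multihom d0 d = mhom (case_option d0 d)"
  by (simp add: mhom_def)

lemma mhom_iff:
  "f \<in> mhom D \<longleftrightarrow> f \<in> poly_fun coord_funs \<and>
     (\<forall>b x. f (hscale b x) = (\<Prod>\<beta>\<in>UNIV. b \<beta> ^ D \<beta>) * f x)"
  (is "?l \<longleftrightarrow> ?r")
proof
  assume ?l
  then show ?r unfolding mhom_def multihom_def hscale_def
    by (auto simp: prod_option)
next
  assume r: ?r
  have "f (mscale a M, \<lambda>i. b i *s w i) = a ^ D None * (\<Prod>i\<in>UNIV. b i ^ D (Some i)) * f (M, w)"
    for a b M w
    using r[THEN conjunct2, rule_format, of "case_option a b" "(M, w)"]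
    by (simp add: hscale_def prod_option)
  with r show ?l unfolding mhom_def multihom_def by auto
qed

lemma mhom_poly_fun: "f \<in> mhom D \<Longrightarrow> f \<in> poly_fun coord_funs"
  by (simp add: mhom_iff)

lemma mhom_hscale: "f \<in> mhom D \<Longrightarrow> f (hscale b x) = (\<Prod>\<beta>\<in>UNIV. b \<beta> ^ D \<beta>) * f x"
  unfolding mhom_iff by blast

lemma mhom_const: "(\<lambda>_. c) \<in> mhom (\<lambda>_. 0)"
  by (simp add: mhom_iff poly_fun.const)

lemma mhom_mult:
  assumes "f \<in> mhom D" "g \<in> mhom E" shows "(\<lambda>x. f x * g x) \<in> mhom (\<lambda>\<beta>. D \<beta> + E \<beta>)"
  using assms by (auto simp: mhom_iff power_add prod.distrib intro: poly_fun.mult)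

lemma mhom_add:
  assumes "f \<in> mhom D" "g \<in> mhom D" shows "(\<lambda>x. f x + g x) \<in> mhom D"
  using assms by (auto simp: mhom_iff algebra_simps intro: poly_fun.add)

lemma mhom_cmult:
  assumes "f \<in> mhom D" shows "(\<lambda>x. c * f x) \<in> mhom D"
  using mhom_mult[OF mhom_const assms, of c] by simp

lemma mhom_diff:
  assumes "f \<in> mhom D" "g \<in> mhom D" shows "(\<lambda>x. f x - g x) \<in> mhom D"
  using mhom_add[OF assms(1) mhom_cmult[OF assms(2), of "-1"]] by simp

lemma mhom_power:
  assumes "f \<in> mhom D" shows "(\<lambda>x. f x ^ k) \<in> mhom (\<lambda>\<beta>. k * D \<beta>)"
proof (induction k)
  case 0 show ?case using mhom_const[of 1] by simp
next
  case (Suc k) show ?case using mhom_mult[OF assms Suc] by simp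
qed

lemma mhom_prod:
  assumes "finite I" "\<And>i. i \<in> I \<Longrightarrow> f i \<in> mhom (D i)"
  shows "(\<lambda>x. \<Prod>i\<in>I. f i x) \<in> mhom (\<lambda>\<beta>. \<Sum>i\<in>I. D i \<beta>)"
  using assms
proof (induction I rule: finite_induct)
  case empty show ?case using mhom_const[of 1] by simp
next
  case (insert i I) then show ?case using mhom_mult[of "f i" "D i"] by simp
qed

lemma poly_fun_sum:
  assumes "finite I" "\<And>i. i \<in> I \<Longrightarrow> f i \<in> poly_fun C"
  shows "(\<lambda>x. \<Sum>i\<in>I. f i x) \<in> poly_fun C"
  using assms
proof (induction I rule: finite_induct)
  case empty show ?case using poly_fun.const[of 0] by simp
next
  case (insert i I) then show ?case using poly_fun.add[of "f i" C] by simp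
qed

lemma poly_fun_prod:
  assumes "finite I" "\<And>i. i \<in> I \<Longrightarrow> f i \<in> poly_fun C"
  shows "(\<lambda>x. \<Prod>i\<in>I. f i x) \<in> poly_fun C"
  using assms
proof (induction I rule: finite_induct)
  case empty show ?case using poly_fun.const[of 1] by simp
next
  case (insert i I) then show ?case using poly_fun.mult[of "f i" C] by simp
qed

section \<open>Scalars and the fibres of the map from coordinates to points\<close>

lemma mscale_mscale: "mscale a (mscale b M) = mscale (a * b) M"
  by (simp add: mscale_def vec_eq_iff)

lemma mscale_one [simp]: "mscale 1 M = M"
  by (simp add: mscale_def vec_eq_iff)

lemma mscale_eq_0: "mscale a M = 0 \<longleftrightarrow> a = 0 \<or> M = 0"
  by (auto simp: mscale_def vec_eq_iff)

lemma mscale_mult_vec: "mscale a M *v x = a *s (M *v x)"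
  by (simp add: mscale_def vec_eq_iff matrix_vector_mult_def sum_distrib_left mult.assoc)

lemma mscale_matrix_mult:
  "mscale a M ** B = mscale a (M ** B)" "B ** mscale a M = mscale a (B ** M)"
  for M B :: "'a::field^'n::finite^'n"
  by (simp_all add: mscale_def vec_eq_iff matrix_matrix_mult_def sum_distrib_left mult_ac)

lemma hscale_in_cone: "x \<in> cone \<Longrightarrow> (\<And>\<beta>. b \<beta> \<noteq> 0) \<Longrightarrow> hscale b x \<in> cone"
  by (cases x) (auto simp: hscale_def cone_def mscale_eq_0)

lemma pt_hscale:
  assumes "\<And>\<beta>. b \<beta> \<noteq> 0" shows "pt (hscale b x) = pt x"
proof -
  obtain M w where x: "x = (M, w)" by (cases x)
  have 1: "range (\<lambda>c. mscale c (mscale (b None) M)) = range (\<lambda>c. mscale c M)"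
  proof (intro set_eqI iffI; elim rangeE)
    fix y c assume "y = mscale c (mscale (b None) M)"
    then show "y \<in> range (\<lambda>c. mscale c M)" by (simp add: mscale_mscale)
  next
    fix y c assume "y = mscale c M"
    then have "y = mscale (c / b None) (mscale (b None) M)" using assms by (simp add: mscale_mscale)
    then show "y \<in> range (\<lambda>c. mscale c (mscale (b None) M))" by blast
  qed
  have 2: "range (\<lambda>c. c *s (b (Some i) *s w i)) = range (\<lambda>c. c *s w i)" for i
  proof (intro set_eqI iffI; elim rangeE)
    fix y c assume "y = c *s (b (Some i) *s w i)"
    then have "y = (c * b (Some i)) *s w i" by simp
    then show "y \<in> range (\<lambda>c. c *s w i)" by blast
  next
    fix y c assume "y = c *s w i"
    then have "y = (c / b (Some i)) *s (b (Some i) *s w i)" using assms by simp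
    then show "y \<in> range (\<lambda>c. c *s (b (Some i) *s w i))" by blast
  qed
  show ?thesis unfolding x pt_def hscale_def prod.case 1 2 ..
qed

lemma pt_eqD:
  assumes "pt x = pt y" "x \<in> cone" "y \<in> cone"
  obtains b where "\<And>\<beta>. b \<beta> \<noteq> 0" "y = hscale b x"
proof -
  obtain M w M' w' where x: "x = (M, w)" and y: "y = (M', w')" by (cases x, cases y)
  have r: "range (\<lambda>c. mscale c M) = range (\<lambda>c. mscale c M')"
    using assms(1) by (simp add: x y pt_def)
  have "M' = mscale 1 M'" by simp
  then have "M' \<in> range (\<lambda>c. mscale c M')" by (rule range_eqI)
  with r obtain a where a: "M' = mscale a M" by auto
  have "\<exists>c. w' i = c *s w i" for i
  proof -
    have "range (\<lambda>c. c *s w i) = range (\<lambda>c. c *s w' i)"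
      using assms(1) by (simp add: x y pt_def fun_eq_iff)
    moreover have "w' i = 1 *s w' i" by simp
    then have "w' i \<in> range (\<lambda>c. c *s w' i)" by (rule range_eqI)
    ultimately show ?thesis by auto
  qed
  then obtain c where c: "\<And>i. w' i = c i *s w i" by metis
  have nz: "M' \<noteq> 0" "w' i \<noteq> 0" for i using assms by (auto simp: y cone_def)
  show thesis
  proof (rule that[of "case_option a c"])
    show "case_option a c \<beta> \<noteq> 0" for \<beta>
      using nz a c by (cases \<beta>) (auto simp: mscale_eq_0)
    show "y = hscale (case_option a c) x"
      using a c by (simp add: x y hscale_def fun_eq_iff)
  qed
qed

lemma XX_eq: "XX = pt ` cone"
proof (intro set_eqI iffI)
  fix p :: "('a, 'b, 'c) point" assume "p \<in> XX"
  then obtain T v where p: "p = (T, v)" "T \<in> PMat" "\<And>i. v i \<in> PN" by (auto simp: XX_def)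
  obtain M where M: "M \<noteq> 0" "T = range (\<lambda>c. mscale c M)" using p by (auto simp: PMat_def)
  have "\<exists>w. w \<noteq> 0 \<and> v i = range (\<lambda>c. c *s w)" for i using p(3)[of i] by (auto simp: PN_def)
  then obtain w where w: "\<And>i. w i \<noteq> 0" "\<And>i. v i = range (\<lambda>c. c *s w i)" by metis
  have "p = pt (M, w)" using p M w by (auto simp: pt_def)
  moreover have "(M, w) \<in> cone" using M w by (auto simp: cone_def)
  ultimately show "p \<in> pt ` cone" by blast
next
  fix p :: "('a, 'b, 'c) point" assume "p \<in> pt ` cone"
  then show "p \<in> XX" by (auto simp: XX_def cone_def pt_def PMat_def PN_def)
qed

lemma pt_in_nonvanishing_iff:
  assumes "f \<in> mhom D" "x \<in> cone"
  shows "pt x \<in> nonvanishing f \<longleftrightarrow> f x \<noteq> 0"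
proof
  assume "pt x \<in> nonvanishing f"
  then obtain y where y: "y \<in> cone" "f y \<noteq> 0" "pt x = pt y" by (auto simp: nonvanishing_def)
  obtain b where "\<And>\<beta>. b \<beta> \<noteq> 0" "y = hscale b x" using pt_eqD[OF y(3) assms(2) y(1)] by blast
  then show "f x \<noteq> 0" using y(2) mhom_hscale[OF assms(1)] by auto
qed (use assms in \<open>auto simp: nonvanishing_def\<close>)

lemma nonvanishing_subset_XX: "nonvanishing f \<subseteq> XX"
  by (auto simp: nonvanishing_def XX_eq)

lemma nonvanishing_mult:
  assumes "f \<in> mhom D" "g \<in> mhom E"
  shows "nonvanishing (\<lambda>x. f x * g x) = nonvanishing f \<inter> nonvanishing g"
proof -
  have "p \<in> nonvanishing (\<lambda>x. f x * g x) \<longleftrightarrow> p \<in> nonvanishing f \<inter> nonvanishing g" if "p \<in> XX" for p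
  proof -
    obtain x where "p = pt x" "x \<in> cone" using \<open>p \<in> XX\<close> by (auto simp: XX_eq)
    then show ?thesis using pt_in_nonvanishing_iff[OF mhom_mult[OF assms]] 
      pt_in_nonvanishing_iff[OF assms(1)] pt_in_nonvanishing_iff[OF assms(2)] by auto
  qed
  then show ?thesis using nonvanishing_subset_XX by blast
qed

section \<open>The Zariski topology on the product of projective spaces\<close>

lemma openin_nonvanishing: "f \<in> mhom D \<Longrightarrow> openin zariski_X (nonvanishing f)"
  unfolding zariski_X_def openin_topology_generated_by_iff
  by (rule generate_topology_on.Basis) (auto simp: mhom_def)

lemma nonvanishing_one: "nonvanishing (\<lambda>_. 1) = XX"
  by (auto simp: nonvanishing_def XX_eq)

lemma topspace_zariski_X: "topspace zariski_X = XX"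
proof
  show "topspace zariski_X \<subseteq> (XX :: ('a, 'b, 'c) point set)"
    using nonvanishing_subset_XX by (fastforce simp: zariski_X_def)
  show "XX \<subseteq> topspace (zariski_X :: ('a, 'b, 'c) point topology)"
    using openin_nonvanishing[OF mhom_const[of 1]] openin_subset
    by (force simp: nonvanishing_one)
qed

text \<open>The generating sets already form a basis: intersections come from products of forms,
  whatever their degrees.\<close>

lemma zariski_X_basis:
  assumes "openin zariski_X W" "p \<in> W"
  obtains D f where "f \<in> mhom D" "p \<in> nonvanishing f" "nonvanishing f \<subseteq> W"
proof -
  have "generate_topology_on {nonvanishing f | f d0 d. f \<in> multihom d0 d} W"
    using assms(1) by (simp add: zariski_X_def openin_topology_generated_by_iff)
  then have "p \<in> W \<longrightarrow> (\<exists>D. \<exists>f\<in>mhom D. p \<in> nonvanishing f \<and> nonvanishing f \<subseteq> W)"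
  proof induction
    case Empty then show ?case by simp
  next
    case (Int a b)
    show ?case
    proof
      assume "p \<in> a \<inter> b"
      then obtain D f E g where fg: "f \<in> mhom D" "g \<in> mhom E" "p \<in> nonvanishing f"
        "p \<in> nonvanishing g" "nonvanishing f \<subseteq> a" "nonvanishing g \<subseteq> b"
        using Int by blast
      show "\<exists>D. \<exists>f\<in>mhom D. p \<in> nonvanishing f \<and> nonvanishing f \<subseteq> a \<inter> b"
        using fg(3-6) nonvanishing_mult[OF fg(1,2)] mhom_mult[OF fg(1,2)] by blast
    qed
  next
    case (UN K) then show ?case by blast
  next
    case (Basis s)
    then obtain f d0 d where "s = nonvanishing f" "f \<in> multihom d0 d" by blast
    then show ?case using multihom_eq_mhom by blast
  qed
  with assms(2) that show thesis by blast
qed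

section \<open>Polynomial curves\<close>

definition poly_curve :: "('a::field \<Rightarrow> ('a, 'n::finite, 'm) coords) \<Rightarrow> bool" where
  "poly_curve c \<longleftrightarrow> (\<forall>f\<in>coord_funs. \<exists>p. \<forall>t. f (c t) = poly p t)"

lemma poly_curve_poly_fun:
  assumes "poly_curve c" "f \<in> poly_fun coord_funs"
  shows "\<exists>p. \<forall>t. f (c t) = poly p t"
  using assms(2)
proof induction
  case (const a) show ?case by (rule exI[of _ "[:a:]"]) simp
next
  case (coord f) then show ?case using assms(1) by (simp add: poly_curve_def)
next
  case (add f g) then show ?case by (metis poly_add)
next
  case (mult f g) then show ?case by (metis poly_mult)
qed

text \<open>A form that does not vanish at \<open>c 0\<close> restricts to a nonzero polynomial in
  \<open>t\<close>. This is how limits under one-parameter subgroups are seen in the Zariski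
  topology.\<close>

lemma poly_curve_open:
  fixes c :: "'a::alg_closed_field \<Rightarrow> ('a, 'n::finite, 'm::finite) coords"
  assumes "poly_curve c" "\<And>t. c t \<in> cone" "openin zariski_X W" "pt (c 0) \<in> W"
  shows "finite {t. pt (c t) \<notin> W}"
proof -
  obtain D f where f: "f \<in> mhom D" "pt (c 0) \<in> nonvanishing f" "nonvanishing f \<subseteq> W"
    using zariski_X_basis[OF assms(3,4)] by blast
  obtain p where p: "\<And>t. f (c t) = poly p t"
    using poly_curve_poly_fun[OF assms(1) mhom_poly_fun[OF f(1)]] by auto
  have "poly p 0 \<noteq> 0" using f pt_in_nonvanishing_iff[OF f(1) assms(2)] p by auto
  then have "finite {t. poly p t = 0}" by (intro poly_roots_finite) auto
  moreover have "{t. pt (c t) \<notin> W} \<subseteq> {t. poly p t = 0}"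
    using f(3) pt_in_nonvanishing_iff[OF f(1) assms(2)] p by auto
  ultimately show ?thesis by (rule finite_subset[rotated])
qed

section \<open>Sections\<close>

lemma sections_local:
  assumes "s \<in> sections d0 d XX" "x \<in> cone"
  obtains W E g h where "openin zariski_X W" "pt x \<in> W"
    "g \<in> mhom (\<lambda>\<beta>. E \<beta> + case_option d0 d \<beta>)" "h \<in> mhom E"
    "\<And>y. y \<in> cone \<Longrightarrow> pt y \<in> W \<Longrightarrow> h y \<noteq> 0 \<and> s y = g y / h y"
proof -
  have "pt x \<in> XX" using assms(2) by (simp add: XX_eq)
  then obtain W e0 e g h where W: "openin zariski_X W" "pt x \<in> W"
    "g \<in> multihom (e0 + d0) (\<lambda>i. e i + d i)" "h \<in> multihom e0 e"
    "\<forall>y\<in>cone. pt y \<in> W \<longrightarrow> h y \<noteq> 0 \<and> s y = g y / h y"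
    using assms(1) unfolding sections_def by blast
  show thesis
    by (rule that[of W g "case_option e0 e" h]) (use W in \<open>auto simp: mhom_def\<close>)
qed

lemma sections_hscale:
  assumes "s \<in> sections d0 d XX" "x \<in> cone" "\<And>\<beta>. b \<beta> \<noteq> 0"
  shows "s (hscale b x) = (\<Prod>\<beta>\<in>UNIV. b \<beta> ^ case_option d0 d \<beta>) * s x"
proof -
  obtain W E g h where W: "openin zariski_X W" "pt x \<in> W"
    "g \<in> mhom (\<lambda>\<beta>. E \<beta> + case_option d0 d \<beta>)" "h \<in> mhom E"
    "\<And>y. y \<in> cone \<Longrightarrow> pt y \<in> W \<Longrightarrow> h y \<noteq> 0 \<and> s y = g y / h y"
    by (rule sections_local[OF assms(1,2)], rule that, assumption+)
  have "s (hscale b x) = g (hscale b x) / h (hscale b x)"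
    using W(5)[OF hscale_in_cone[OF assms(2), of b]] pt_hscale[of b x] assms(3) W(2) by simp
  also have "\<dots> = (\<Prod>\<beta>\<in>UNIV. b \<beta> ^ case_option d0 d \<beta>) * (g x / h x)"
    using assms(3) by (simp add: mhom_hscale[OF W(3)] mhom_hscale[OF W(4)] power_add prod.distrib)
  finally show ?thesis using W(5)[OF assms(2) W(2)] by simp
qed

lemma pt_in_nonvanishing_section_iff:
  assumes "s \<in> sections d0 d XX" "x \<in> cone"
  shows "pt x \<in> nonvanishing s \<longleftrightarrow> s x \<noteq> 0"
proof
  assume "pt x \<in> nonvanishing s"
  then obtain y where y: "y \<in> cone" "s y \<noteq> 0" "pt x = pt y" by (auto simp: nonvanishing_def)
  obtain b where "\<And>\<beta>. b \<beta> \<noteq> 0" "y = hscale b x" using pt_eqD[OF y(3) assms(2) y(1)] by blast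
  then show "s x \<noteq> 0" using y(2) sections_hscale[OF assms] by auto
qed (use assms in \<open>auto simp: nonvanishing_def\<close>)

lemma mhom_imp_section:
  assumes "s \<in> mhom D" shows "s \<in> sections (D None) (\<lambda>i. D (Some i)) XX"
  unfolding sections_def
proof (intro CollectI ballI)
  fix p :: "('a, 'b, 'c) point" assume "p \<in> XX"
  then show "\<exists>W e0 e g h. openin zariski_X W \<and> p \<in> W \<and> W \<subseteq> XX \<and>
       g \<in> multihom (e0 + D None) (\<lambda>i. e i + D (Some i)) \<and> h \<in> multihom e0 e \<and>
       (\<forall>x\<in>cone. pt x \<in> W \<longrightarrow> h x \<noteq> 0 \<and> s x = g x / h x)"
    using assms mhom_const[of 1] openin_topspace[of zariski_X]
    by (intro exI[of _ XX] exI[of _ 0] exI[of _ "\<lambda>_. 0"] exI[of _ s] exI[of _ "\<lambda>_. 1"])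
      (auto simp: mhom_def topspace_zariski_X)
qed

text \<open>Along a curve that is defined at \<open>0\<close>, a section of pure weight \<open>-E\<close> cannot have a pole.\<close>

lemma section_weight_along_curve:
  fixes c :: "'a::alg_closed_field \<Rightarrow> ('a, 'n::finite, 'm::finite) coords"
  assumes s: "s \<in> sections d0 d XX" and c: "poly_curve c" "\<And>t. c t \<in> cone"
    and weight: "\<And>t. t \<noteq> 0 \<Longrightarrow> s0 = t powi E * s (c t)" and nz: "s0 \<noteq> 0"
  shows "E \<le> 0" "E = 0 \<Longrightarrow> s (c 0) = s0"
proof -
  obtain W D g h where W: "openin zariski_X W" "pt (c 0) \<in> W"
    "g \<in> mhom (\<lambda>\<beta>. D \<beta> + case_option d0 d \<beta>)" "h \<in> mhom D"
    "\<And>y. y \<in> cone \<Longrightarrow> pt y \<in> W \<Longrightarrow> h y \<noteq> 0 \<and> s y = g y / h y"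
    by (rule sections_local[OF s c(2)[of 0]], rule that, assumption+)
  obtain p where p: "\<And>t. g (c t) = poly p t"
    using poly_curve_poly_fun[OF c(1) mhom_poly_fun[OF W(3)]] by auto
  obtain q where q: "\<And>t. h (c t) = poly q t"
    using poly_curve_poly_fun[OF c(1) mhom_poly_fun[OF W(4)]] by auto
  have fin: "finite (insert 0 {t. pt (c t) \<notin> W})"
    using poly_curve_open[OF c W(1,2)] by simp
  have key: "s0 * poly q t = t powi E * poly p t" if "t \<notin> insert 0 {t. pt (c t) \<notin> W}" for t
    using weight[of t] W(5)[OF c(2), of t] p q that by (auto simp: field_simps)
  have q0: "poly q 0 \<noteq> 0" "s (c 0) = poly p 0 / poly q 0" using W(5)[OF c(2) W(2)] p q by auto
  \<comment> \<open>The denominator is cleared. For \<open>E > 0\<close> the right side vanishes at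
    0 while the left side does not.\<close>
  have eq: "smult s0 q = monom 1 (nat E) * p" if "E \<ge> 0"
  proof (rule poly_eq_cofinite, rule finite_subset[OF _ fin], rule subsetI, rule ccontr)
    fix t assume t: "t \<in> {t. poly (smult s0 q) t \<noteq> poly (monom 1 (nat E) * p) t}"
      "t \<notin> insert 0 {t. pt (c t) \<notin> W}"
    show False using key[OF t(2)] t(1) that by (simp add: poly_monom power_int_def)
  qed
  show "E \<le> 0"
  proof (rule ccontr)
    assume "\<not> E \<le> 0"
    then have "poly (smult s0 q) 0 = 0" using eq by (simp add: poly_monom)
    then show False using q0 nz by simp
  qed
  show "s (c 0) = s0" if "E = 0"
  proof -
    have "poly (smult s0 q) 0 = poly p 0" using eq that by (simp add: poly_monom)
    then have "s0 = poly p 0 / poly q 0" using q0(1) by (simp add: eq_divide_eq)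
    then show ?thesis using q0(2) by simp
  qed
qed

section \<open>Monomials\<close>

text \<open>A letter \<open>(\<beta>, l)\<close> names a coordinate in the block \<open>\<beta>\<close>: the matrix for \<^const>\<open>None\<close>, the vector
  \<open>w i\<close> for \<open>Some i\<close>. Using the same letters \<open>l\<close> in all blocks names every vector coordinate several
  times.\<close>

fun crd :: "'m option \<times> 'n \<times> 'n \<Rightarrow> ('a::field, 'n::finite, 'm) coords \<Rightarrow> 'a" where
  "crd (None, a, b) (M, w) = M $ a $ b"
| "crd (Some i, a, b) (M, w) = w i $ a"

definition mon :: "('m option \<times> 'n \<times> 'n) multiset \<Rightarrow> ('a::field, 'n::finite, 'm) coords \<Rightarrow> 'a" where
  "mon e x = (\<Prod>y\<in>#e. crd y x)"

lemma mon_simps [simp]: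
  "mon {#} x = 1" "mon (add_mset y e) x = crd y x * mon e x" "mon (e + e') x = mon e x * mon e' x"
  by (simp_all add: mon_def)

lemma mon_eq_0_iff: "mon e x = 0 \<longleftrightarrow> (\<exists>y\<in>#e. crd y x = 0)"
  by (induction e) auto

lemma crd_hscale: "crd y (hscale b x) = b (fst y) * crd y x"
  by (cases "(y, x)" rule: crd.cases) (simp_all add: hscale_def mscale_def)

lemma coord_funs_eq: "coord_funs = range crd"
proof (intro set_eqI iffI)
  fix f :: "('a, 'b, 'c) coords \<Rightarrow> 'a" assume "f \<in> coord_funs"
  then consider i j where "f = (\<lambda>(M, w). M $ i $ j)" | i j where "f = (\<lambda>(M, w). w i $ j)"
    by (auto simp: coord_funs_def)
  then show "f \<in> range crd"
  proof cases
    case (1 i j) then have "f = crd (None, i, j)" by (auto simp: fun_eq_iff)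
    then show ?thesis by blast
  next
    case (2 i j) then have "f = crd (Some i, j, j)" by (auto simp: fun_eq_iff)
    then show ?thesis by blast
  qed
next
  fix f :: "('a, 'b, 'c) coords \<Rightarrow> 'a" assume "f \<in> range crd"
  then obtain y where y: "f = crd y" by auto
  obtain \<beta> a b where "y = (\<beta>, a, b)" by (cases y)
  with y have "f = (\<lambda>(M, w). M $ a $ b) \<or> (\<exists>i. f = (\<lambda>(M, w). w i $ a))"
    by (cases \<beta>) (auto simp: fun_eq_iff)
  then show "f \<in> coord_funs" by (auto simp: coord_funs_def)
qed

lemma prod_delta_power:
  "(\<Prod>\<beta>\<in>UNIV. b \<beta> ^ (if \<beta> = \<alpha> then 1 else 0)) = b \<alpha>" for b :: "'i::finite \<Rightarrow> 'a::comm_monoid_mult"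
proof -
  have "b \<beta> ^ (if \<beta> = \<alpha> then 1 else 0) = (if \<alpha> = \<beta> then b \<beta> else 1)" for \<beta> by auto
  then show ?thesis by (simp add: prod.delta)
qed

lemma mon_hscale: "mon e (hscale b x) = (\<Prod>\<beta>\<in>UNIV. b \<beta> ^ count (image_mset fst e) \<beta>) * mon e x"
  for b :: "'m::finite option \<Rightarrow> 'a::field"
proof (induction e)
  case (add y e)
  have "(\<Prod>\<beta>\<in>UNIV. b \<beta> ^ count (image_mset fst (add_mset y e)) \<beta>) =
      (\<Prod>\<beta>\<in>UNIV. b \<beta> ^ (if \<beta> = fst y then 1 else 0) * b \<beta> ^ count (image_mset fst e) \<beta>)"
    by (intro prod.cong) auto
  also have "\<dots> = b (fst y) * (\<Prod>\<beta>\<in>UNIV. b \<beta> ^ count (image_mset fst e) \<beta>)"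
    by (simp only: prod.distrib prod_delta_power)
  finally show ?case using add by (simp add: crd_hscale)
qed simp

lemma mon_poly_fun: "mon e \<in> poly_fun coord_funs"
proof (induction e)
  case empty show ?case using poly_fun.const[of 1] by (simp add: mon_def[abs_def])
next
  case (add y e)
  have "crd y \<in> poly_fun coord_funs" by (rule poly_fun.coord) (simp add: coord_funs_eq)
  from poly_fun.mult[OF this add] show ?case by (simp add: mon_def[abs_def])
qed

lemma mon_mhom: "mon e \<in> mhom (count (image_mset fst e))"
  using mon_poly_fun mon_hscale unfolding mhom_iff by blast

definition mon_comb :: "('a \<times> ('m option \<times> 'n \<times> 'n) multiset) list \<Rightarrow> ('a::field, 'n::finite, 'm) coords \<Rightarrow> 'a" where
  "mon_comb L x = (\<Sum>(c, e)\<leftarrow>L. c * mon e x)"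

lemma mon_comb_simps [simp]:
  "mon_comb [] x = 0" "mon_comb ((c, e) # L) x = c * mon e x + mon_comb L x"
  "mon_comb (L @ L') x = mon_comb L x + mon_comb L' x"
  by (simp_all add: mon_comb_def)

lemma poly_fun_mon_comb:
  assumes "f \<in> poly_fun coord_funs" shows "\<exists>L. f = mon_comb L"
  using assms
proof induction
  case (const c) show ?case by (rule exI[of _ "[(c, {#})]"]) (simp add: fun_eq_iff)
next
  case (coord f)
  then obtain y where "f = crd y" by (auto simp: coord_funs_eq)
  then show ?case by (intro exI[of _ "[(1, {#y#})]"]) (simp add: fun_eq_iff)
next
  case (add f g)
  then obtain L L' where "f = mon_comb L" "g = mon_comb L'" by blast
  then show ?case by (intro exI[of _ "L @ L'"]) (simp add: fun_eq_iff)
next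
  case (mult f g)
  then obtain L L' where L: "f = mon_comb L" "g = mon_comb L'" by blast
  have 1: "mon_comb (map (\<lambda>(c', e'). (c * c', e + e')) L') x = c * mon e x * mon_comb L' x" for c e x
    by (induction L') (auto simp: algebra_simps)
  have "\<exists>L''. \<forall>x. mon_comb L'' x = mon_comb L x * mon_comb L' x"
  proof (induction L)
    case Nil show ?case by (rule exI[of _ "[]"]) simp
  next
    case (Cons a L)
    then obtain L'' where "\<And>x. mon_comb L'' x = mon_comb L x * mon_comb L' x" by blast
    then show ?case using 1[of "fst a" "snd a"]
      by (cases a, intro exI[of _ "map (\<lambda>(c', e'). (fst a * c', snd a + e')) L' @ L''"]) (auto simp: algebra_simps)
  qed
  then obtain L'' where "\<forall>x. mon_comb L'' x = mon_comb L x * mon_comb L' x" by blast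
  then show ?case using L by (intro exI[of _ L'']) (simp add: fun_eq_iff)
qed

text \<open>Homogeneity of \<open>f\<close> in one block at a time removes all the monomials of the wrong degree in it.\<close>

lemma mhom_mon_comb:
  fixes f :: "('a::alg_closed_field, 'n::finite, 'm::finite) coords \<Rightarrow> 'a"
  assumes "f \<in> mhom D"
  obtains L where "f = mon_comb L" "\<And>c e. (c, e) \<in> set L \<Longrightarrow> count (image_mset fst e) = D"
proof -
  have "\<exists>L. f = mon_comb L \<and> (\<forall>(c, e)\<in>set L. \<forall>\<beta>\<in>S. count (image_mset fst e) \<beta> = D \<beta>)" for S :: "'m option set"
    using finite[of S]
  proof (induction S rule: finite_induct)
    case empty then show ?case using poly_fun_mon_comb[OF mhom_poly_fun[OF assms]] by auto
  next
    case (insert \<alpha> S)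
    then obtain L where L: "f = mon_comb L" "\<forall>(c, e)\<in>set L. \<forall>\<beta>\<in>S. count (image_mset fst e) \<beta> = D \<beta>" by blast
    define L' where "L' = filter (\<lambda>(c, e). count (image_mset fst e) \<alpha> = D \<alpha>) L"
    have "f x = mon_comb L' x" for x
    proof -
      \<comment> \<open>The value of \<open>f\<close> after scaling block \<alpha> by
        \<open>t\<close>, as a polynomial in \<open>t\<close>; its coefficient at
        \<open>D \<alpha>\<close> is the filtered combination \<open>L'\<close>.\<close>
      define p where "p = (\<Sum>(c, e)\<leftarrow>L. monom (c * mon e x) (count (image_mset fst e) \<alpha>))"
      define b where "b t = (\<lambda>\<beta>. if \<beta> = \<alpha> then t else 1)" for t :: 'a
      have pr: "(\<Prod>\<beta>\<in>UNIV. b t \<beta> ^ E \<beta>) = t ^ E \<alpha>" for t E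
      proof -
        have "b t \<beta> ^ E \<beta> = (if \<beta> = \<alpha> then t ^ E \<alpha> else 1)" for \<beta> by (auto simp: b_def)
        then show ?thesis by (simp add: prod.delta)
      qed
      have "poly p t = poly (monom (f x) (D \<alpha>)) t" for t
      proof -
        have "poly p t = mon_comb L (hscale (b t) x)"
          unfolding p_def by (induction L) (auto simp: poly_monom mon_hscale pr algebra_simps)
        also have "\<dots> = t ^ D \<alpha> * f x" using mhom_hscale[OF assms, of "b t"] L(1) pr by simp
        finally show ?thesis by (simp add: poly_monom)
      qed
      then have "p = monom (f x) (D \<alpha>)" by (intro poly_eq_cofinite) simp
      then have "coeff p (D \<alpha>) = f x" by simp
      moreover have "coeff p (D \<alpha>) = mon_comb L' x"
        unfolding p_def L'_def by (induction L) auto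
      ultimately show ?thesis by simp
    qed
    then show ?case using L(2) by (intro exI[of _ L']) (auto simp: L'_def)
  qed
  from this[of UNIV] obtain L where L: "f = mon_comb L" "\<forall>(c, e)\<in>set L. \<forall>\<beta>\<in>UNIV. count (image_mset fst e) \<beta> = D \<beta>"
    by blast
  have "count (image_mset fst e) = D" if "(c, e) \<in> set L" for c e
    using L(2) that by (auto simp: fun_eq_iff)
  with that[OF L(1)] show thesis by blast
qed

section \<open>Nonvanishing loci are affine\<close>

lemma topspace_zariski_aff: "topspace (zariski_aff r) = aff_space r"
proof -
  have "(\<lambda>_. 1 :: 'a) \<in> aff_polys r" unfolding aff_polys_def by (rule poly_fun.const)
  moreover have "aff_space r = {x \<in> aff_space r. (\<lambda>_. 1 :: 'a) x \<noteq> 0}" by simp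
  ultimately have "aff_space r \<in> {{x \<in> aff_space r. f x \<noteq> (0::'a)} | f. f \<in> aff_polys r}"
    by (intro CollectI exI[of _ "\<lambda>_. 1"] conjI)
  then show ?thesis unfolding zariski_aff_def topology_generated_by_topspace by blast
qed

lemma openin_aff_nonzero:
  "F \<in> aff_polys r \<Longrightarrow> openin (zariski_aff r) {z \<in> aff_space r. F z \<noteq> 0}"
  unfolding zariski_aff_def openin_topology_generated_by_iff
  by (rule generate_topology_on.Basis) blast

lemma finite_monomials_of_degree:
  fixes D :: "'m::finite option \<Rightarrow> nat"
  shows "finite {e :: ('m option \<times> 'n::finite \<times> 'n) multiset. count (image_mset fst e) = D}"
proof (rule finite_subset)
  show "{e :: ('m option \<times> 'n \<times> 'n) multiset. count (image_mset fst e) = D}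
      \<subseteq> multisets_of_size UNIV (size (Abs_multiset D))"
  proof
    fix e :: "('m option \<times> 'n \<times> 'n) multiset"
    assume "e \<in> {e. count (image_mset fst e) = D}"
    then have "image_mset fst e = Abs_multiset D" by (simp add: multiset_eq_iff)
    then have "size (image_mset fst e) = size (Abs_multiset D)" by simp
    then show "e \<in> multisets_of_size UNIV (size (Abs_multiset D))" by (simp add: multisets_of_size_def)
  qed
qed (rule finite_multisets_of_size, simp)

text \<open>The chart is a Segre-Veronese embedding with the hyperplane \<open>s = 0\<close>
  removed: a point goes to the values of all monomials of degree \<open>D\<close>, divided by
  \<open>s\<close>. Since all \<open>D \<beta> \<ge> 1\<close>, every block occurs in every
  monomial. \<open>ix\<close> numbers the monomials because affine space is indexed by natural
  numbers.\<close>

locale affine_chart =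
  fixes s :: "('a::alg_closed_field, 'n::finite, 'm::finite) coords \<Rightarrow> 'a" and D :: "'m option \<Rightarrow> nat"
    and W :: "('m option \<times> 'n \<times> 'n) multiset set" and ix and r :: nat
  assumes s: "s \<in> mhom D" and D: "\<And>\<beta>. D \<beta> \<ge> 1"
    and W_def: "W = {e. count (image_mset fst e) = D}"
    and bij_ix: "bij_betw ix W {0..<r}"
begin

definition deg :: "'m option multiset" where "deg = Abs_multiset D"

lemma count_deg: "count deg = D"
  by (simp add: deg_def)

lemma in_W: "e \<in> W \<longleftrightarrow> image_mset fst e = deg"
  by (simp add: W_def multiset_eq_iff count_deg fun_eq_iff)

lemma size_W: "e \<in> W \<Longrightarrow> size e = size deg"
  by (metis in_W size_image_mset)

text \<open>The choice of coordinates does not matter on \<open>V\<close>, as numerator and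
  denominator have the same degree.\<close>

definition \<phi> :: "('a, 'n, 'm) point \<Rightarrow> nat \<Rightarrow> 'a" where
  "\<phi> p k = (let x = (SOME x. x \<in> cone \<and> pt x = p) in
     if k < r then mon (inv_into W ix k) x / s x else 0)"

definition V :: "('a, 'n, 'm) point set" where "V = nonvanishing s"

lemma in_V: "x \<in> cone \<Longrightarrow> pt x \<in> V \<longleftrightarrow> s x \<noteq> 0"
  unfolding V_def by (rule pt_in_nonvanishing_iff[OF s])

lemma V_E: assumes "p \<in> V" obtains x where "x \<in> cone" "s x \<noteq> 0" "p = pt x"
  using assms by (auto simp: V_def nonvanishing_def)

lemma \<phi>_pt:
  assumes x: "x \<in> cone" and e: "e \<in> W"
  shows "\<phi> (pt x) (ix e) = mon e x / s x"
proof -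
  define x' where "x' = (SOME y. y \<in> cone \<and> pt y = pt x)"
  have "x' \<in> cone \<and> pt x' = pt x" unfolding x'_def using x by (intro someI) auto
  then have x': "x' \<in> cone" "pt x' = pt x" by auto
  have k: "ix e < r" "inv_into W ix (ix e) = e"
    using bij_ix e by (auto simp: bij_betw_def)
  then have "\<phi> (pt x) (ix e) = mon e x' / s x'"
    unfolding \<phi>_def x'_def[symmetric] by simp
  moreover obtain b where b: "\<And>\<beta>. b \<beta> \<noteq> 0" "x = hscale b x'"
    using pt_eqD[OF x'(2) x'(1) x] by blast
  ultimately show ?thesis
    using e by (simp add: mon_hscale mhom_hscale[OF s] W_def)
qed

lemma \<phi>_aff: "\<phi> p \<in> aff_space r"
  by (simp add: aff_space_def \<phi>_def)

text \<open>The Zariski closure of the image. It is closed by construction; the work lies in showing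
  that it contains no further points.\<close>

definition Z :: "(nat \<Rightarrow> 'a) set" where
  "Z = {z \<in> aff_space r. \<forall>F\<in>aff_polys r. (\<forall>p\<in>V. F (\<phi> p) = 0) \<longrightarrow> F z = 0}"

lemma Z_I: "p \<in> V \<Longrightarrow> \<phi> p \<in> Z"
  by (auto simp: Z_def \<phi>_aff)

lemma Z_D:
  assumes "z \<in> Z" "F \<in> aff_polys r" "G \<in> aff_polys r"
    "\<And>x. x \<in> cone \<Longrightarrow> s x \<noteq> 0 \<Longrightarrow> F (\<phi> (pt x)) = G (\<phi> (pt x))"
  shows "F z = G z"
proof -
  have "(\<lambda>x. F x + (- 1) * G x) \<in> aff_polys r"
    using assms(2,3) unfolding aff_polys_def by (intro poly_fun.add poly_fun.mult poly_fun.const)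
  moreover have "\<forall>p\<in>V. F (\<phi> p) + (- 1) * G (\<phi> p) = 0" using assms(4) by (auto elim!: V_E)
  ultimately show ?thesis using assms(1) unfolding Z_def by fastforce
qed

lemma closed_Z: "closedin (zariski_aff r) Z"
proof -
  define \<F> where "\<F> = {F \<in> aff_polys r. \<forall>p\<in>V. F (\<phi> p) = 0}"
  have "openin (zariski_aff r) (\<Union>F\<in>\<F>. {z \<in> aff_space r. F z \<noteq> 0})"
    by (intro openin_Union) (auto simp: \<F>_def intro: openin_aff_nonzero)
  moreover have "topspace (zariski_aff r) - Z = (\<Union>F\<in>\<F>. {z \<in> aff_space r. F z \<noteq> 0})"
    by (auto simp: topspace_zariski_aff Z_def \<F>_def)
  ultimately show ?thesis unfolding closedin_def by (auto simp: topspace_zariski_aff Z_def)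
qed

lemma topspace_Z: "topspace (subtopology (zariski_aff r) Z) = Z"
  unfolding topspace_subtopology topspace_zariski_aff by (auto simp: Z_def)

lemma aff_polys_ix: "e \<in> W \<Longrightarrow> (\<lambda>z :: nat \<Rightarrow> 'a. z (ix e)) \<in> aff_polys r"
proof -
  assume "e \<in> W"
  then have "ix e < r" using bij_ix by (auto simp: bij_betw_def)
  then show ?thesis unfolding aff_polys_def by (intro poly_fun.coord) blast
qed

lemma aff_polys_prod_ix: "set_mset E \<subseteq> W \<Longrightarrow> (\<lambda>z :: nat \<Rightarrow> 'a. \<Prod>e\<in>#E. z (ix e)) \<in> aff_polys r"
proof (induction E)
  case empty show ?case by (simp add: aff_polys_def poly_fun.const)
next
  case (add e E)
  then have "(\<lambda>z :: nat \<Rightarrow> 'a. z (ix e)) \<in> aff_polys r"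
    "(\<lambda>z :: nat \<Rightarrow> 'a. \<Prod>e\<in>#E. z (ix e)) \<in> aff_polys r"
    by (auto intro: aff_polys_ix)
  from poly_fun.mult[OF this[unfolded aff_polys_def]] show ?case by (simp add: aff_polys_def)
qed

lemma prod_\<phi>: "x \<in> cone \<Longrightarrow> set_mset E \<subseteq> W \<Longrightarrow> (\<Prod>e\<in>#E. \<phi> (pt x) (ix e)) = mon (\<Sum>\<^sub># E) x / s x ^ size E"
  by (induction E) (auto simp: \<phi>_pt)

text \<open>The binomial equations of the Segre-Veronese variety: both products are the same
  monomial divided by the same power of \<open>s\<close>.\<close>

lemma relation:
  assumes "z \<in> Z" "set_mset E \<subseteq> W" "set_mset E' \<subseteq> W" "\<Sum>\<^sub># E = \<Sum>\<^sub># E'" "size E = size E'"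
  shows "(\<Prod>e\<in>#E. z (ix e)) = (\<Prod>e\<in>#E'. z (ix e))"
  by (rule Z_D[OF assms(1) aff_polys_prod_ix[OF assms(2)] aff_polys_prod_ix[OF assms(3)]])
    (simp add: prod_\<phi> assms(2-5))

lemma s_comb:
  obtains L where "s = mon_comb L" "\<And>c e. (c, e) \<in> set L \<Longrightarrow> e \<in> W"
  by (rule mhom_mon_comb[OF s], rule that, assumption) (simp add: W_def)

lemma s_comb_eq_1:
  assumes "z \<in> Z" "s = mon_comb L" "\<And>c e. (c, e) \<in> set L \<Longrightarrow> e \<in> W"
  shows "(\<Sum>(c, e)\<leftarrow>L. c * z (ix e)) = 1"
proof (rule Z_D[OF assms(1)])
  have "(\<lambda>z :: nat \<Rightarrow> 'a. \<Sum>(c, e)\<leftarrow>L'. c * z (ix e)) \<in> aff_polys r" if "set L' \<subseteq> set L" for L'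
    using that
  proof (induction L')
    case Nil show ?case by (simp add: aff_polys_def poly_fun.const)
  next
    case (Cons a L')
    obtain c e where a: "a = (c, e)" by (cases a)
    then have "(\<lambda>z :: nat \<Rightarrow> 'a. z (ix e)) \<in> aff_polys r" using assms(3) Cons.prems by (intro aff_polys_ix) auto
    then show ?case using Cons a unfolding aff_polys_def
      by (auto intro!: poly_fun.add poly_fun.mult poly_fun.const)
  qed
  then show "(\<lambda>z. \<Sum>(c, e)\<leftarrow>L. c * z (ix e)) \<in> aff_polys r" by blast
  show "(\<lambda>_. 1) \<in> aff_polys r" by (simp add: aff_polys_def poly_fun.const)
  fix x :: "('a, 'n, 'm) coords" assume x: "x \<in> cone" "s x \<noteq> 0"
  have "(\<Sum>(c, e)\<leftarrow>L'. c * \<phi> (pt x) (ix e)) = mon_comb L' x / s x" if "set L' \<subseteq> set L" for L'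
    using that
  proof (induction L')
    case (Cons a L')
    obtain c e where a: "a = (c, e)" by (cases a)
    then have "e \<in> W" using assms(3) Cons.prems by auto
    then show ?case using Cons a by (simp add: \<phi>_pt[OF x(1)] add_divide_distrib)
  qed simp
  then show "(\<Sum>(c, e)\<leftarrow>L. c * \<phi> (pt x) (ix e)) = 1" using x assms(2) by simp
qed

lemma letter_ex: "e \<in> W \<Longrightarrow> \<exists>l. (\<beta>, l) \<in># e"
proof -
  assume "e \<in> W"
  then have "count (image_mset fst e) \<beta> > 0" using D[of \<beta>] by (auto simp: W_def)
  then have "\<beta> \<in># image_mset fst e" by (simp only: count_greater_zero_iff)
  then obtain y where "y \<in># e" "fst y = \<beta>" by auto
  then show ?thesis by (intro exI[of _ "snd y"]) auto
qed

lemma replace_in_W: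
  assumes "e \<in> W" "y \<in># e" "fst y' = fst y" shows "add_mset y' (e - {#y#}) \<in> W"
proof -
  have "image_mset fst (add_mset y' (e - {#y#})) = image_mset fst (add_mset y (e - {#y#}))"
    using assms(3) by simp
  also have "\<dots> = image_mset fst e" using assms(2) by simp
  finally show ?thesis using assms(1) by (simp only: in_W)
qed

lemma sum_add_mset:
  "\<Sum>\<^sub># (image_mset (\<lambda>y. add_mset y (R (fst y))) A) = A + \<Sum>\<^sub># (image_mset R (image_mset fst A))"
  by (induction A) auto

text \<open>Coordinates of a preimage are read off from \<open>z\<close>: near a monomial
  \<open>e0\<close> with nonzero value, exchanging a single letter of \<open>e0\<close> isolates the
  ratio of two coordinates of one block. The binomial equations show that these ratios account for
  all of \<open>z\<close>.\<close>

lemma Z_subset: assumes z: "z \<in> Z" shows "z \<in> \<phi> ` V"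
proof -
  obtain L where L: "s = mon_comb L" "\<And>c e. (c, e) \<in> set L \<Longrightarrow> e \<in> W"
    using s_comb by blast
  have one: "(\<Sum>(c, e)\<leftarrow>L. c * z (ix e)) = 1" by (rule s_comb_eq_1[OF z L])
  have "\<exists>(c, e)\<in>set L. z (ix e) \<noteq> 0"
  proof (rule ccontr)
    assume "\<not> ?thesis"
    then have "\<And>a. a \<in> set L \<Longrightarrow> (case a of (c, e) \<Rightarrow> c * z (ix e)) = 0" by auto
    then have m: "map (\<lambda>(c, e). c * z (ix e)) L = map (\<lambda>_. 0) L" by (rule map_cong[OF refl])
    have "(\<Sum>(c, e)\<leftarrow>L. c * z (ix e)) = 0" unfolding m by simp
    then show False using one by simp
  qed
  then obtain e0 where e0: "e0 \<in> W" "z (ix e0) \<noteq> 0" using L(2) by blast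
  obtain \<alpha> where \<alpha>: "\<And>\<beta>. (\<beta>, \<alpha> \<beta>) \<in># e0" using letter_ex[OF e0(1)] by metis
  define R where "R \<beta> = e0 - {#(\<beta>, \<alpha> \<beta>)#}" for \<beta>
  \<comment> \<open>The coordinate \<open>y\<close>, normalised so that the chosen letter of its
    block gets the value 1.\<close>
  define X where "X y = z (ix (add_mset y (R (fst y)))) / z (ix e0)" for y
  have RW: "add_mset y (R (fst y)) \<in> W" for y
    unfolding R_def using e0(1) \<alpha> by (intro replace_in_W) auto
  define x where "x = ((\<chi> a b. X (None, a, b)) :: 'a^'n^'n, (\<lambda>i. \<chi> a. X (Some i, a, a)) :: 'm \<Rightarrow> 'a^'n)"
  \<comment> \<open>All letters \<open>(Some i, a, b)\<close> name the same coordinate, so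
    \<open>b\<close> must not influence the value.\<close>
  have X_irr: "X (Some i, a, b) = X (Some i, a, a)" for i a b
  proof -
    have "z (ix (add_mset (Some i, a, b) (R (Some i)))) = z (ix (add_mset (Some i, a, a) (R (Some i))))"
    proof (rule Z_D[OF z aff_polys_ix aff_polys_ix])
      show W: "add_mset (Some i, a, b) (R (Some i)) \<in> W" "add_mset (Some i, a, a) (R (Some i)) \<in> W"
        using RW[of "(Some i, a, b)"] RW[of "(Some i, a, a)"] by auto
      fix x :: "('a, 'n, 'm) coords" assume x: "x \<in> cone" "s x \<noteq> 0"
      show "\<phi> (pt x) (ix (add_mset (Some i, a, b) (R (Some i)))) = \<phi> (pt x) (ix (add_mset (Some i, a, a) (R (Some i))))"
        using x by (cases x) (simp add: \<phi>_pt W)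
    qed
    then show ?thesis by (simp add: X_def)
  qed
  have crd_x: "crd y x = X y" for y
  proof -
    obtain \<beta> a b where y: "y = (\<beta>, a, b)" by (cases y)
    show ?thesis using X_irr[of _ a b] by (cases \<beta>) (simp_all add: y x_def)
  qed
  have prod_X: "(\<Prod>y\<in>#A. z (ix (add_mset y (R (fst y))))) = z (ix e0) ^ size A * mon A x" for A
  proof (induction A)
    case (add y A)
    have "z (ix (add_mset y (R (fst y)))) = z (ix e0) * crd y x" using e0 by (simp add: crd_x X_def)
    then show ?case using add by simp
  qed simp
  \<comment> \<open>The monomials are exchanged against each other: \<open>e\<close> together with
    the one-letter exchanges for \<open>e0\<close>, and \<open>e0\<close> together with those for
    \<open>e\<close>, have the same total.\<close>
  have rel: "z (ix e) * mon e0 x = z (ix e0) * mon e x" if e: "e \<in> W" for e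
  proof -
    define E where "E = add_mset e (image_mset (\<lambda>y. add_mset y (R (fst y))) e0)"
    define E' where "E' = add_mset e0 (image_mset (\<lambda>y. add_mset y (R (fst y))) e)"
    have deg: "image_mset fst e = image_mset fst e0" using e e0(1) by (simp add: in_W)
    have "(\<Prod>e\<in>#E. z (ix e)) = (\<Prod>e\<in>#E'. z (ix e))"
    proof (rule relation[OF z])
      show "set_mset E \<subseteq> W" "set_mset E' \<subseteq> W" using e e0 RW by (auto simp: E_def E'_def)
      show "size E = size E'" using size_W e e0 by (simp add: E_def E'_def)
      show "\<Sum>\<^sub># E = \<Sum>\<^sub># E'" by (simp add: E_def E'_def sum_add_mset deg)
    qed
    then have "z (ix e) * (z (ix e0) ^ size e0 * mon e0 x) = z (ix e0) * (z (ix e0) ^ size e * mon e x)"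
      unfolding E_def E'_def by (simp add: prod_X multiset.map_comp o_def)
    then show ?thesis using size_W[OF e] size_W[OF e0(1)] e0(2) by (simp add: algebra_simps)
  qed
  \<comment> \<open>The inverse exchange \<open>e1\<close> multiplies with the exchange for
    \<open>y\<close> to the square of \<open>e0\<close>.\<close>
  have "X y \<noteq> 0" if y: "y \<in># e0" for y
  proof -
    define e1 where "e1 = add_mset (fst y, \<alpha> (fst y)) (e0 - {#y#})"
    have e1: "e1 \<in> W" unfolding e1_def using e0 y by (intro replace_in_W) auto
    have sum: "add_mset y (R (fst y)) + e1 = e0 + e0"
    proof -
      have "add_mset y (R (fst y)) + e1 = add_mset (fst y, \<alpha> (fst y)) (R (fst y)) + add_mset y (e0 - {#y#})"
        by (simp add: e1_def)
      also have "\<dots> = e0 + e0" using y \<alpha>[of "fst y"] by (simp only: R_def insert_DiffM)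
      finally show ?thesis .
    qed
    have "(\<Prod>e\<in>#{#add_mset y (R (fst y)), e1#}. z (ix e)) = (\<Prod>e\<in>#{#e0, e0#}. z (ix e))"
      by (rule relation[OF z]) (use e1 e0 RW sum in auto)
    then show ?thesis using e0(2) by (auto simp: X_def)
  qed
  then have m0: "mon e0 x \<noteq> 0" by (simp add: mon_eq_0_iff crd_x)
  have sx: "mon e0 x = z (ix e0) * s x"
  proof -
    have "(\<Sum>(c, e)\<leftarrow>L'. c * z (ix e)) * mon e0 x = z (ix e0) * mon_comb L' x" if "set L' \<subseteq> set L" for L'
      using that
    proof (induction L')
      case (Cons a L')
      obtain c e where a: "a = (c, e)" by (cases a)
      then have "z (ix e) * mon e0 x = z (ix e0) * mon e x" using L(2) Cons.prems by (intro rel) auto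
      then have "c * z (ix e) * mon e0 x = z (ix e0) * (c * mon e x)" by (simp add: mult_ac)
      then show ?case using Cons a by (simp add: algebra_simps)
    qed simp
    from this[OF order_refl] show ?thesis using one L(1) by simp
  qed
  have nz: "s x \<noteq> 0" using sx m0 by auto
  have "crd (\<beta>, \<alpha> \<beta>) x \<noteq> 0" for \<beta> using m0 \<alpha> by (auto simp: mon_eq_0_iff)
  note c = this[of None] this[of "Some i" for i]
  have xc: "x \<in> cone"
  proof -
    have "fst x \<noteq> 0" using c(1) by (cases x; cases "\<alpha> None") auto
    moreover have "snd x i \<noteq> 0" for i using c(2)[of i] by (cases x; cases "\<alpha> (Some i)") auto
    ultimately show ?thesis by (cases x) (auto simp: cone_def)
  qed
  have "\<phi> (pt x) = z"
  proof
    fix k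
    show "\<phi> (pt x) k = z k"
    proof (cases "k < r")
      case True
      have "k \<in> ix ` W" using bij_ix True by (simp add: bij_betw_def)
      then obtain e where e: "e \<in> W" "k = ix e" by blast
      have "mon e x / s x = z (ix e)" using rel[OF e(1)] sx nz e0(2) by (simp add: field_simps)
      then show ?thesis using e by (simp add: \<phi>_pt xc)
    next
      case False then show ?thesis using z by (simp add: Z_def aff_space_def \<phi>_def)
    qed
  qed
  moreover have "pt x \<in> V" using in_V[OF xc] nz by simp
  ultimately show ?thesis by blast
qed

lemma \<phi>_image: "\<phi> ` V = Z"
  using Z_subset Z_I by blast

text \<open>Equal images mean that all monomials of degree \<open>D\<close> at the two points agree
  up to the factor \<open>s y / s x\<close>. Exchanging one letter of a nonvanishing monomial then
  yields the scalar of each block.\<close>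

lemma \<phi>_inj: "inj_on \<phi> V"
proof (rule inj_onI)
  fix p q assume "p \<in> V" "q \<in> V" and eq: "\<phi> p = \<phi> q"
  then obtain x y where x: "x \<in> cone" "s x \<noteq> 0" "p = pt x" and y: "y \<in> cone" "s y \<noteq> 0" "q = pt y"
    by (auto elim!: V_E)
  obtain L where L: "s = mon_comb L" "\<And>c e. (c, e) \<in> set L \<Longrightarrow> e \<in> W"
    using s_comb by blast
  have meq: "mon e y = (s y / s x) * mon e x" if "e \<in> W" for e
  proof -
    have "mon e x / s x = mon e y / s y" using \<phi>_pt[OF x(1) that] \<phi>_pt[OF y(1) that] eq x(3) y(3) by simp
    then show ?thesis using x(2) y(2) by (simp add: field_simps)
  qed
  have "\<exists>(c, e)\<in>set L. mon e x \<noteq> 0"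
  proof (rule ccontr)
    assume "\<not> ?thesis"
    then have "\<And>a. a \<in> set L \<Longrightarrow> (case a of (c, e) \<Rightarrow> c * mon e x) = 0" by auto
    then have m: "map (\<lambda>(c, e). c * mon e x) L = map (\<lambda>_. 0) L" by (rule map_cong[OF refl])
    have "mon_comb L x = 0" unfolding mon_comb_def m by simp
    then show False using L(1) x(2) by simp
  qed
  then obtain e0 where e0: "e0 \<in> W" "mon e0 x \<noteq> 0" using L(2) by blast
  obtain \<alpha> where \<alpha>: "\<And>\<beta>. (\<beta>, \<alpha> \<beta>) \<in># e0" using letter_ex[OF e0(1)] by metis
  have ex: "mon e0 u = crd (\<beta>, \<alpha> \<beta>) u * mon (e0 - {#(\<beta>, \<alpha> \<beta>)#}) u" for u \<beta>
    using mon_simps(2)[of "(\<beta>, \<alpha> \<beta>)" "e0 - {#(\<beta>, \<alpha> \<beta>)#}" u] \<alpha>[of \<beta>] by (simp del: mon_simps)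
  define b where "b \<beta> = crd (\<beta>, \<alpha> \<beta>) y / crd (\<beta>, \<alpha> \<beta>) x" for \<beta>
  have nzx: "crd (\<beta>, \<alpha> \<beta>) x \<noteq> 0" for \<beta> using e0(2) \<alpha> by (auto simp: mon_eq_0_iff)
  have "mon e0 y \<noteq> 0" using meq[OF e0(1)] e0(2) x y by auto
  then have nzy: "crd (\<beta>, \<alpha> \<beta>) y \<noteq> 0" for \<beta> using \<alpha> by (auto simp: mon_eq_0_iff)
  have bnz: "b \<beta> \<noteq> 0" for \<beta> using nzx nzy by (simp add: b_def)
  have crd_y: "crd (\<beta>, l) y = b \<beta> * crd (\<beta>, l) x" for \<beta> l
  proof -
    let ?R = "e0 - {#(\<beta>, \<alpha> \<beta>)#}"
    have "add_mset (\<beta>, l) ?R \<in> W" by (rule replace_in_W[OF e0(1) \<alpha>]) simp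
    then have 1: "crd (\<beta>, l) y * mon ?R y = (s y / s x) * (crd (\<beta>, l) x * mon ?R x)"
      using meq by fastforce
    have 2: "crd (\<beta>, \<alpha> \<beta>) y * mon ?R y = (s y / s x) * (crd (\<beta>, \<alpha> \<beta>) x * mon ?R x)"
      using meq[OF e0(1)] ex[of y \<beta>] ex[of x \<beta>] by simp
    have 3: "mon ?R y \<noteq> 0" using \<open>mon e0 y \<noteq> 0\<close> ex[of y \<beta>] by auto
    have "crd (\<beta>, l) y * mon ?R y * crd (\<beta>, \<alpha> \<beta>) x = (s y / s x) * (crd (\<beta>, \<alpha> \<beta>) x * mon ?R x) * crd (\<beta>, l) x"
      unfolding 1 by (simp only: mult_ac)
    also have "\<dots> = crd (\<beta>, \<alpha> \<beta>) y * crd (\<beta>, l) x * mon ?R y" unfolding 2[symmetric] by (simp only: mult_ac)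
    finally have "crd (\<beta>, l) y * crd (\<beta>, \<alpha> \<beta>) x = crd (\<beta>, \<alpha> \<beta>) y * crd (\<beta>, l) x"
      using 3 by (simp add: mult_ac)
    then show ?thesis using nzx[of \<beta>] by (simp add: b_def field_simps)
  qed
  have "y = hscale b x"
  proof -
    obtain M w M' w' where xy: "x = (M, w)" "y = (M', w')" by (cases x, cases y)
    have "M' $ i $ j = b None * M $ i $ j" for i j using crd_y[of None "(i, j)"] by (simp add: xy)
    moreover have "w' k $ i = b (Some k) * w k $ i" for k i using crd_y[of "Some k" "(i, i)"] by (simp add: xy)
    ultimately show ?thesis by (simp add: xy hscale_def mscale_def vec_eq_iff fun_eq_iff)
  qed
  then show "p = q" using x y pt_hscale[of b x] bnz by simp
qed

section \<open>Translation between forms of degree a multiple of \<open>D\<close> and polynomials on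
  the chart\<close>

text \<open>The multiset of blocks is \<open>k\<close> copies of \<open>deg\<close>, and a multiset
  of letters can be split along any splitting of its image.\<close>

lemma mon_descend:
  assumes "count (image_mset fst e) = (\<lambda>\<beta>. k * D \<beta>)"
  shows "\<exists>F\<in>aff_polys r. \<forall>x\<in>cone. s x \<noteq> 0 \<longrightarrow> F (\<phi> (pt x)) = mon e x / s x ^ k"
  using assms
proof (induction k arbitrary: e)
  case 0
  then have "image_mset fst e = {#}" by (simp only: multiset_eq_iff count_empty) simp
  then have "e = {#}" by simp
  then show ?case using poly_fun.const[of 1] by (auto simp: aff_polys_def intro!: bexI[of _ "\<lambda>_. 1"])
next
  case (Suc k)
  have "image_mset fst e = deg + repeat_mset k deg"
    using Suc.prems by (simp add: multiset_eq_iff fun_eq_iff count_deg)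
  then obtain e1 e2 where e: "e = e1 + e2" "image_mset fst e1 = deg" "image_mset fst e2 = repeat_mset k deg"
    using image_mset_eq_plusD by metis
  then have e1: "e1 \<in> W" by (simp add: in_W)
  have "count (image_mset fst e2) = (\<lambda>\<beta>. k * D \<beta>)" using e(3) by (simp add: fun_eq_iff count_deg)
  from Suc.IH[OF this] obtain F where F: "F \<in> aff_polys r" "\<forall>x\<in>cone. s x \<noteq> 0 \<longrightarrow> F (\<phi> (pt x)) = mon e2 x / s x ^ k" by blast
  show ?case
  proof (intro bexI[of _ "\<lambda>z. z (ix e1) * F z"] ballI impI)
    show "(\<lambda>z. z (ix e1) * F z) \<in> aff_polys r" using F(1) aff_polys_ix[OF e1]
      unfolding aff_polys_def by (rule poly_fun.mult[rotated])
  qed (use F e in \<open>simp add: \<phi>_pt e1\<close>)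
qed

lemma mhom_descend:
  assumes "f \<in> mhom (\<lambda>\<beta>. k * D \<beta>)"
  shows "\<exists>F\<in>aff_polys r. \<forall>x\<in>cone. s x \<noteq> 0 \<longrightarrow> F (\<phi> (pt x)) = f x / s x ^ k"
proof -
  obtain L where L: "f = mon_comb L" "\<And>c e. (c, e) \<in> set L \<Longrightarrow> count (image_mset fst e) = (\<lambda>\<beta>. k * D \<beta>)"
    using mhom_mon_comb[OF assms] by blast
  have "\<exists>F\<in>aff_polys r. \<forall>x\<in>cone. s x \<noteq> 0 \<longrightarrow> F (\<phi> (pt x)) = mon_comb L' x / s x ^ k" if "set L' \<subseteq> set L" for L'
    using that
  proof (induction L')
    case Nil show ?case by (auto simp: aff_polys_def intro!: bexI[OF _ poly_fun.const[of 0]])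
  next
    case (Cons a L')
    obtain c e where a: "a = (c, e)" by (cases a)
    obtain F where F: "F \<in> aff_polys r" "\<forall>x\<in>cone. s x \<noteq> 0 \<longrightarrow> F (\<phi> (pt x)) = mon_comb L' x / s x ^ k"
      using Cons by auto
    obtain G where G: "G \<in> aff_polys r" "\<forall>x\<in>cone. s x \<noteq> 0 \<longrightarrow> G (\<phi> (pt x)) = mon e x / s x ^ k"
      using mon_descend[OF L(2)[of c e]] Cons.prems a by auto
    show ?case
    proof (intro bexI[of _ "\<lambda>z. c * G z + F z"] ballI impI)
      show "(\<lambda>z. c * G z + F z) \<in> aff_polys r" using F(1) G(1) unfolding aff_polys_def
        by (intro poly_fun.add poly_fun.mult poly_fun.const)
    qed (use F G a in \<open>simp add: add_divide_distrib\<close>)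
  qed
  then show ?thesis using L(1) by simp
qed

lemma aff_poly_lift:
  assumes "F \<in> aff_polys r"
  shows "\<exists>k. \<exists>f\<in>mhom (\<lambda>\<beta>. k * D \<beta>). \<forall>x\<in>cone. s x \<noteq> 0 \<longrightarrow> F (\<phi> (pt x)) = f x / s x ^ k"
  using assms unfolding aff_polys_def
proof induction
  case (const c) show ?case by (rule exI[of _ 0], rule bexI[of _ "\<lambda>_. c"]) (simp_all add: mhom_const)
next
  case (coord F)
  then obtain i where i: "F = (\<lambda>z. z i)" "i < r" by auto
  have "i \<in> ix ` W" using bij_ix i(2) by (simp add: bij_betw_def)
  then obtain e where e: "e \<in> W" "i = ix e" by blast
  have "mon e \<in> mhom (\<lambda>\<beta>. 1 * D \<beta>)" using mon_mhom[of e] e by (simp add: W_def)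
  then show ?case unfolding i(1) e(2) using \<phi>_pt[OF _ e(1)] by (intro exI[of _ 1] bexI[of _ "mon e"]) auto
next
  case (add F G)
  obtain k f where f: "f \<in> mhom (\<lambda>\<beta>. k * D \<beta>)" "\<forall>x\<in>cone. s x \<noteq> 0 \<longrightarrow> F (\<phi> (pt x)) = f x / s x ^ k"
    using add.IH(1) by blast
  obtain l g where g: "g \<in> mhom (\<lambda>\<beta>. l * D \<beta>)" "\<forall>x\<in>cone. s x \<noteq> 0 \<longrightarrow> G (\<phi> (pt x)) = g x / s x ^ l"
    using add.IH(2) by blast
  show ?case
  proof (rule exI[of _ "k + l"], rule bexI[of _ "\<lambda>x. f x * s x ^ l + g x * s x ^ k"])
    show "(\<lambda>x. f x * s x ^ l + g x * s x ^ k) \<in> mhom (\<lambda>\<beta>. (k + l) * D \<beta>)"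
      using mhom_add[OF mhom_mult[OF f(1) mhom_power[OF s, of l]], of "\<lambda>x. g x * s x ^ k"]
       mhom_mult[OF g(1) mhom_power[OF s, of k]] by (simp add: algebra_simps)
    show "\<forall>x\<in>cone. s x \<noteq> 0 \<longrightarrow> F (\<phi> (pt x)) + G (\<phi> (pt x)) = (f x * s x ^ l + g x * s x ^ k) / s x ^ (k + l)"
    proof (intro ballI impI)
      fix x :: "('a, 'n, 'm) coords" assume x: "x \<in> cone" "s x \<noteq> 0"
      show "F (\<phi> (pt x)) + G (\<phi> (pt x)) = (f x * s x ^ l + g x * s x ^ k) / s x ^ (k + l)"
        unfolding f(2)[rule_format, OF x] g(2)[rule_format, OF x]
        using add_frac_eq[of "s x ^ k" "s x ^ l" "f x" "g x"] x(2) by (simp add: power_add)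
    qed
  qed
next
  case (mult F G)
  obtain k f where f: "f \<in> mhom (\<lambda>\<beta>. k * D \<beta>)" "\<forall>x\<in>cone. s x \<noteq> 0 \<longrightarrow> F (\<phi> (pt x)) = f x / s x ^ k"
    using mult.IH(1) by blast
  obtain l g where g: "g \<in> mhom (\<lambda>\<beta>. l * D \<beta>)" "\<forall>x\<in>cone. s x \<noteq> 0 \<longrightarrow> G (\<phi> (pt x)) = g x / s x ^ l"
    using mult.IH(2) by blast
  show ?case
  proof (rule exI[of _ "k + l"], rule bexI[of _ "\<lambda>x. f x * g x"])
    show "(\<lambda>x. f x * g x) \<in> mhom (\<lambda>\<beta>. (k + l) * D \<beta>)"
      using mhom_mult[OF f(1) g(1)] by (simp add: algebra_simps)
    show "\<forall>x\<in>cone. s x \<noteq> 0 \<longrightarrow> F (\<phi> (pt x)) * G (\<phi> (pt x)) = f x * g x / s x ^ (k + l)"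
      using f(2) g(2) by (simp add: power_add)
  qed
qed

text \<open>A monomial that does not vanish at \<open>x\<close> brings any degree up to a multiple
  of \<open>D\<close>, so nothing is lost near \<open>x\<close>. The same monomial serves all forms
  of degree \<open>E\<close>, in particular the numerator and the denominator of a regular
  function.\<close>

lemma degree_fill:
  assumes "x \<in> cone"
  shows "\<exists>k e. mon e x \<noteq> 0 \<and> (\<forall>f\<in>mhom E. (\<lambda>y :: ('a, 'n, 'm) coords. f y * mon e y) \<in> mhom (\<lambda>\<beta>. k * D \<beta>))"
proof -
  have "\<exists>l. crd (\<beta>, l) x \<noteq> 0" for \<beta>
  proof (cases \<beta>)
    case None
    obtain M w where x: "x = (M, w)" "M \<noteq> 0" using assms by (auto simp: cone_def)
    then obtain i j where "M $ i $ j \<noteq> 0" by (auto simp: vec_eq_iff)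
    then show ?thesis using None x by (intro exI[of _ "(i, j)"]) simp
  next
    case (Some i)
    obtain M w where x: "x = (M, w)" "w i \<noteq> 0" using assms by (auto simp: cone_def)
    then obtain j where "w i $ j \<noteq> 0" by (auto simp: vec_eq_iff)
    then show ?thesis using Some x by (intro exI[of _ "(j, j)"]) simp
  qed
  then obtain \<alpha> where \<alpha>: "\<And>\<beta>. crd (\<beta>, \<alpha> \<beta>) x \<noteq> 0" by metis
  \<comment> \<open>Large enough for every block at once, because
    \<open>D \<beta> \<ge> 1\<close>.\<close>
  define k where "k = (\<Sum>\<beta>\<in>UNIV. E \<beta>)"
  define A where "A = Abs_multiset (\<lambda>\<beta>. k * D \<beta> - E \<beta>)"
  have A: "count A = (\<lambda>\<beta>. k * D \<beta> - E \<beta>)" by (simp add: A_def)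
  define e where "e = image_mset (\<lambda>\<beta>. (\<beta>, \<alpha> \<beta>)) A"
  have le: "E \<beta> \<le> k * D \<beta>" for \<beta>
  proof -
    have "E \<beta> \<le> k" unfolding k_def by (rule member_le_sum) auto
    also have "\<dots> \<le> k * D \<beta>" using D[of \<beta>] by simp
    finally show ?thesis .
  qed
  have cnt: "count (image_mset fst e) = (\<lambda>\<beta>. k * D \<beta> - E \<beta>)"
    by (simp add: e_def image_mset.compositionality o_def A)
  have "mon e x \<noteq> 0" using \<alpha> by (auto simp: mon_eq_0_iff e_def)
  moreover have "(\<lambda>y :: ('a, 'n, 'm) coords. f y * mon e y) \<in> mhom (\<lambda>\<beta>. k * D \<beta>)" if "f \<in> mhom E" for f
    using mhom_mult[OF that mon_mhom[of e]] le by (simp add: cnt)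
  ultimately show ?thesis by blast
qed

section \<open>The chart is a homeomorphism that identifies regular functions\<close>

lemma openin_V: "openin zariski_X V"
  unfolding V_def by (rule openin_nonvanishing[OF s])

lemma openin_preimage_basic:
  assumes "F \<in> aff_polys r"
  shows "openin zariski_X {p \<in> V. F (\<phi> p) \<noteq> 0}"
proof -
  obtain k f where f: "f \<in> mhom (\<lambda>\<beta>. k * D \<beta>)" "\<forall>x\<in>cone. s x \<noteq> 0 \<longrightarrow> F (\<phi> (pt x)) = f x / s x ^ k"
    using aff_poly_lift[OF assms] by blast
  \<comment> \<open>The factor \<open>s\<close> confines the locus to \<open>V\<close>.\<close>
  have "{p \<in> V. F (\<phi> p) \<noteq> 0} = nonvanishing (\<lambda>x. f x * s x)"
    using f(2) by (auto simp: V_def nonvanishing_def)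
  then show ?thesis using openin_nonvanishing[OF mhom_mult[OF f(1) s]] by simp
qed

lemma topspace_V: "topspace (subtopology zariski_X V) = V"
proof -
  have "V \<subseteq> XX" unfolding V_def by (rule nonvanishing_subset_XX)
  then show ?thesis unfolding topspace_subtopology topspace_zariski_X by (rule Int_absorb1)
qed

lemma continuous_\<phi>: "continuous_map (subtopology zariski_X V) (subtopology (zariski_aff r) Z) \<phi>"
proof (rule continuous_map_into_subtopology)
  show "\<phi> \<in> topspace (subtopology zariski_X V) \<rightarrow> Z" using Z_I by (auto simp: topspace_V)
  show "continuous_map (subtopology zariski_X V) (zariski_aff r) \<phi>"
    unfolding zariski_aff_def
  proof (rule continuous_on_generated_topo)
    fix U :: "(nat \<Rightarrow> 'a) set" assume "U \<in> {{x \<in> aff_space r. f x \<noteq> 0} |f. f \<in> aff_polys r}"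
    then obtain F where F: "F \<in> aff_polys r" "U = {x \<in> aff_space r. F x \<noteq> 0}" by auto
    have eq: "\<phi> -` U \<inter> topspace (subtopology zariski_X V) = {p \<in> V. F (\<phi> p) \<noteq> 0}"
      unfolding topspace_V F(2) using \<phi>_aff by blast
    then show "openin (subtopology zariski_X V) (\<phi> -` U \<inter> topspace (subtopology zariski_X V))"
      unfolding eq openin_open_subtopology[OF openin_V] by (simp add: openin_preimage_basic[OF F(1)])
  next
    show "\<phi> ` topspace (subtopology zariski_X V) \<subseteq> \<Union> {{x \<in> aff_space r. f x \<noteq> 0} |f. f \<in> aff_polys r}"
      using \<phi>_aff topspace_zariski_aff[of r, where 'a='a]
      unfolding zariski_aff_def topology_generated_by_topspace by blast
  qed
qed

lemma open_image:
  assumes "openin zariski_X U" "U \<subseteq> V"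
  shows "openin (subtopology (zariski_aff r) Z) (\<phi> ` U)"
proof (subst openin_subopen, rule ballI)
  fix z assume "z \<in> \<phi> ` U"
  then obtain p where p: "p \<in> U" "z = \<phi> p" by auto
  then obtain x where x: "x \<in> cone" "s x \<noteq> 0" "p = pt x" using assms(2) by (auto elim!: V_E)
  obtain E f where f: "f \<in> mhom E" "p \<in> nonvanishing f" "nonvanishing f \<subseteq> U"
    by (rule zariski_X_basis[OF assms(1) p(1)], rule that, assumption+)
  obtain k e where e: "mon e x \<noteq> 0" "(\<lambda>y. f y * mon e y) \<in> mhom (\<lambda>\<beta>. k * D \<beta>)"
    using degree_fill[OF x(1), of E] f(1) by (elim exE conjE) (rule that, assumption, erule (1) bspec)
  obtain F where F: "F \<in> aff_polys r" "\<forall>x\<in>cone. s x \<noteq> 0 \<longrightarrow> F (\<phi> (pt x)) = f x * mon e x / s x ^ k"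
    using mhom_descend[OF e(2)] by (elim bexE) (rule that, assumption+)
  have fx: "f x \<noteq> 0" using f(2) x pt_in_nonvanishing_iff[OF f(1) x(1)] by simp
  let ?O = "{z \<in> aff_space r. F z \<noteq> 0} \<inter> Z"
  have "openin (subtopology (zariski_aff r) Z) ?O"
    using openin_aff_nonzero[OF F(1)] by (rule openin_subtopology_Int)
  moreover have "z \<in> ?O"
  proof -
    have "F (\<phi> (pt x)) \<noteq> 0" using F(2)[rule_format, OF x(1,2)] x(2) e(1) fx by simp
    moreover have "p \<in> V" using assms(2) p(1) by blast
    ultimately show ?thesis using \<phi>_aff[of p] Z_I[of p] unfolding p(2) x(3) by simp
  qed
  moreover have "?O \<subseteq> \<phi> ` U"
  proof
    fix z' assume z': "z' \<in> ?O"
    then have "z' \<in> \<phi> ` V" using \<phi>_image by blast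
    then obtain p' where p': "p' \<in> V" "z' = \<phi> p'" by blast
    obtain x' where x': "x' \<in> cone" "s x' \<noteq> 0" "p' = pt x'" using p'(1) by (rule V_E)
    have "F (\<phi> (pt x')) \<noteq> 0" using z' p'(2) x'(3) by blast
    then have "f x' \<noteq> 0" using F(2)[rule_format, OF x'(1,2)] by auto
    then have "p' \<in> U" using f(3) pt_in_nonvanishing_iff[OF f(1) x'(1)] x'(3) by auto
    then show "z' \<in> \<phi> ` U" using p' by blast
  qed
  ultimately show "\<exists>T. openin (subtopology (zariski_aff r) Z) T \<and> z \<in> T \<and> T \<subseteq> \<phi> ` U" by blast
qed

lemma homeo_\<phi>: "homeomorphic_map (subtopology zariski_X V) (subtopology (zariski_aff r) Z) \<phi>"
proof (rule bijective_open_imp_homeomorphic_map)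
  show "continuous_map (subtopology zariski_X V) (subtopology (zariski_aff r) Z) \<phi>" by (rule continuous_\<phi>)
  show "open_map (subtopology zariski_X V) (subtopology (zariski_aff r) Z) \<phi>"
    unfolding open_map_def openin_open_subtopology[OF openin_V] by (intro allI impI open_image) simp_all
  show "\<phi> ` topspace (subtopology zariski_X V) = topspace (subtopology (zariski_aff r) Z)"
    unfolding topspace_V topspace_Z by (rule \<phi>_image)
  show "inj_on \<phi> (topspace (subtopology zariski_X V))" unfolding topspace_V by (rule \<phi>_inj)
qed

lemma openin_preimage:
  assumes "openin (subtopology (zariski_aff r) Z) U"
  shows "openin zariski_X {p \<in> V. \<phi> p \<in> U}"
proof -
  have "openin (subtopology zariski_X V) {p \<in> V. \<phi> p \<in> U}"
    using openin_continuous_map_preimage[OF continuous_\<phi> assms] unfolding topspace_V .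
  then show ?thesis unfolding openin_open_subtopology[OF openin_V] by simp
qed

lemma regular_pullback:
  assumes U: "openin (subtopology (zariski_aff r) Z) U" and f: "f \<in> regular_aff r Z U"
  shows "f \<circ> \<phi> \<in> regular_X {p \<in> V. \<phi> p \<in> U}"
  unfolding regular_X_def sections_def
proof (intro CollectI ballI)
  fix p assume p: "p \<in> {p \<in> V. \<phi> p \<in> U}"
  then have "\<phi> p \<in> U" by simp
  then obtain O' G H where W: "openin (subtopology (zariski_aff r) Z) O'" "\<phi> p \<in> O'" "O' \<subseteq> U"
    "G \<in> aff_polys r" "H \<in> aff_polys r" "\<forall>x\<in>O'. H x \<noteq> 0 \<and> f x = G x / H x"
    using f[unfolded regular_aff_def, THEN CollectD, rule_format, OF \<open>\<phi> p \<in> U\<close>]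
    by (elim exE conjE) (rule that, assumption+)
  obtain k g where g: "g \<in> mhom (\<lambda>\<beta>. k * D \<beta>)" "\<forall>x\<in>cone. s x \<noteq> 0 \<longrightarrow> G (\<phi> (pt x)) = g x / s x ^ k"
    using aff_poly_lift[OF W(4)] by blast
  obtain l h where h: "h \<in> mhom (\<lambda>\<beta>. l * D \<beta>)" "\<forall>x\<in>cone. s x \<noteq> 0 \<longrightarrow> H (\<phi> (pt x)) = h x / s x ^ l"
    using aff_poly_lift[OF W(5)] by blast
  \<comment> \<open>Multiplying crosswise by powers of \<open>s\<close> gives numerator and
    denominator the same degree.\<close>
  let ?E = "\<lambda>\<beta>. (k + l) * D \<beta>"
  have gm: "(\<lambda>x. g x * s x ^ l) \<in> mhom ?E"
    using mhom_mult[OF g(1) mhom_power[OF s, of l]] by (simp add: algebra_simps)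
  have hm: "(\<lambda>x. h x * s x ^ k) \<in> mhom ?E"
    using mhom_mult[OF h(1) mhom_power[OF s, of k]] by (simp add: algebra_simps)
  show "\<exists>W e0 e g h. openin zariski_X W \<and> p \<in> W \<and> W \<subseteq> {p \<in> V. \<phi> p \<in> U} \<and>
     g \<in> multihom (e0 + 0) (\<lambda>i. e i + 0) \<and> h \<in> multihom e0 e \<and>
     (\<forall>x\<in>cone. pt x \<in> W \<longrightarrow> h x \<noteq> 0 \<and> (f \<circ> \<phi> \<circ> pt) x = g x / h x)"
  proof (intro exI conjI ballI impI)
    show "openin zariski_X {p \<in> V. \<phi> p \<in> O'}" by (rule openin_preimage[OF W(1)])
    show "(\<lambda>x. g x * s x ^ l) \<in> multihom (?E None + 0) (\<lambda>i. ?E (Some i) + 0)"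
      using gm by (simp add: mhom_def)
    show "(\<lambda>x. h x * s x ^ k) \<in> multihom (?E None) (\<lambda>i. ?E (Some i))"
      using hm by (simp add: mhom_def)
    show "p \<in> {p \<in> V. \<phi> p \<in> O'}" using p W by auto
    show "{p \<in> V. \<phi> p \<in> O'} \<subseteq> {p \<in> V. \<phi> p \<in> U}" using W by auto
    fix x :: "('a, 'n, 'm) coords" assume x: "x \<in> cone" "pt x \<in> {p \<in> V. \<phi> p \<in> O'}"
    then have sx: "s x \<noteq> 0" using in_V by auto
    have "H (\<phi> (pt x)) \<noteq> 0" "f (\<phi> (pt x)) = G (\<phi> (pt x)) / H (\<phi> (pt x))" using W(6) x by auto
    then show "h x * s x ^ k \<noteq> 0" "(f \<circ> \<phi> \<circ> pt) x = g x * s x ^ l / (h x * s x ^ k)"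
      using g(2) h(2) x sx by (auto simp: divide_divide_times_eq mult.commute)
  qed
qed

lemma regular_pushforward:
  assumes U: "openin (subtopology (zariski_aff r) Z) U" and f: "f \<circ> \<phi> \<in> regular_X {p \<in> V. \<phi> p \<in> U}"
  shows "f \<in> regular_aff r Z U"
  unfolding regular_aff_def
proof (intro CollectI ballI)
  fix z assume z: "z \<in> U"
  then have "z \<in> Z" using openin_subset[OF U] by auto
  then have "z \<in> \<phi> ` V" using \<phi>_image by blast
  then obtain p where p: "p \<in> V" "z = \<phi> p" by blast
  then obtain x where x: "x \<in> cone" "s x \<noteq> 0" "p = pt x" by (auto elim: V_E)
  have pU: "p \<in> {p \<in> V. \<phi> p \<in> U}" using p z by simp
  obtain W e0 e g h where W: "openin zariski_X W" "p \<in> W" "W \<subseteq> {p \<in> V. \<phi> p \<in> U}"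
     "g \<in> multihom (e0 + 0) (\<lambda>i. e i + 0)" "h \<in> multihom e0 e"
     "\<forall>x\<in>cone. pt x \<in> W \<longrightarrow> h x \<noteq> 0 \<and> (f \<circ> \<phi> \<circ> pt) x = g x / h x"
    using f[unfolded regular_X_def sections_def, THEN CollectD, THEN CollectD, rule_format, OF pU]
    by (elim exE conjE) (rule that, assumption+)
  define E where "E = case_option e0 e"
  have gh: "g \<in> mhom E" "h \<in> mhom E" using W by (simp_all add: E_def multihom_eq_mhom)
  obtain k m where m: "mon m x \<noteq> 0" "\<forall>f\<in>mhom E. (\<lambda>y :: ('a, 'n, 'm) coords. f y * mon m y) \<in> mhom (\<lambda>\<beta>. k * D \<beta>)"
    using degree_fill[OF x(1), of E] by (elim exE conjE) (rule that, assumption+)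
  obtain G where G: "G \<in> aff_polys r" "\<forall>x\<in>cone. s x \<noteq> 0 \<longrightarrow> G (\<phi> (pt x)) = g x * mon m x / s x ^ k"
    using mhom_descend[OF m(2)[rule_format, OF gh(1)]] by (elim bexE) (rule that, assumption+)
  obtain H where H: "H \<in> aff_polys r" "\<forall>x\<in>cone. s x \<noteq> 0 \<longrightarrow> H (\<phi> (pt x)) = h x * mon m x / s x ^ k"
    using mhom_descend[OF m(2)[rule_format, OF gh(2)]] by (elim bexE) (rule that, assumption+)
  \<comment> \<open>On the locus of the auxiliary monomial the new denominator stays
    nonzero.\<close>
  let ?W = "W \<inter> nonvanishing (mon m)"
  have oW: "openin zariski_X ?W" using W(1) openin_nonvanishing[OF mon_mhom[of m]] by (rule openin_Int)
  show "\<exists>W g h. openin (subtopology (zariski_aff r) Z) W \<and> z \<in> W \<and> W \<subseteq> U \<and>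
     g \<in> aff_polys r \<and> h \<in> aff_polys r \<and> (\<forall>x\<in>W. h x \<noteq> 0 \<and> f x = g x / h x)"
  proof (rule exI[of _ "\<phi> ` ?W"], rule exI[of _ G], rule exI[of _ H], intro conjI ballI G(1) H(1))
    show "openin (subtopology (zariski_aff r) Z) (\<phi> ` ?W)" by (rule open_image[OF oW]) (use W in auto)
    show "z \<in> \<phi> ` ?W" using p W(2) m(1) x pt_in_nonvanishing_iff[OF mon_mhom x(1)] by auto
    show "\<phi> ` ?W \<subseteq> U" using W(3) by auto
    fix z' assume "z' \<in> \<phi> ` ?W"
    then obtain p' where p': "p' \<in> W" "p' \<in> nonvanishing (mon m)" "z' = \<phi> p'" by auto
    then have "p' \<in> V" using W(3) by auto
    then obtain x' where x': "x' \<in> cone" "s x' \<noteq> 0" "p' = pt x'" by (rule V_E)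
    have "mon m x' \<noteq> 0" using p' x' pt_in_nonvanishing_iff[OF mon_mhom x'(1)] by auto
    moreover have "h x' \<noteq> 0" "f (\<phi> (pt x')) = g x' / h x'" using W(6) x' p' by auto
    ultimately show "H z' \<noteq> 0" "f z' = G z' / H z'"
      using G(2) H(2) x' p' by auto
  qed
qed

lemma affine_open_V: "affine_open (nonvanishing s)"
  unfolding affine_open_def V_def[symmetric]
proof (rule conjI[OF openin_V], rule exI[of _ r], rule exI[of _ Z], rule exI[of _ \<phi>],
    rule conjI[OF closed_Z], rule conjI[OF homeo_\<phi>], intro allI impI)
  fix U f assume U: "openin (subtopology (zariski_aff r) Z) U"
  show "f \<in> regular_aff r Z U \<longleftrightarrow> f \<circ> \<phi> \<in> regular_X {p \<in> V. \<phi> p \<in> U}"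
    using regular_pullback[OF U] regular_pushforward[OF U] by (rule iffI)
qed

end

theorem affine_open_nonvanishing:
  fixes s :: "('a::alg_closed_field, 'n::finite, 'm::finite) coords \<Rightarrow> 'a"
  assumes "s \<in> mhom D" "\<And>\<beta>. D \<beta> \<ge> 1"
  shows "affine_open (nonvanishing s)"
proof -
  obtain h where "bij_betw h {e :: ('m option \<times> 'n \<times> 'n) multiset. count (image_mset fst e) = D}
      {0..<card {e :: ('m option \<times> 'n \<times> 'n) multiset. count (image_mset fst e) = D}}"
    using ex_bij_betw_finite_nat[OF finite_monomials_of_degree] by blast
  then interpret affine_chart s D "{e. count (image_mset fst e) = D}" h
    "card {e :: ('m option \<times> 'n \<times> 'n) multiset. count (image_mset fst e) = D}"
    using assms by unfold_locales auto
  show ?thesis by (rule affine_open_V)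
qed

section \<open>Bases given by tuples of vectors\<close>

lemma matrix_inv_det:
  fixes A :: "'a::field^'n::finite^'n"
  assumes "det A \<noteq> 0"
  shows "A ** matrix_inv A = mat 1" "matrix_inv A ** A = mat 1"
proof -
  have "invertible A" using assms by (simp add: invertible_det_nz)
  then have "A ** matrix_inv A = mat 1 \<and> matrix_inv A ** A = mat 1"
    unfolding invertible_def matrix_inv_def by (rule someI_ex)
  then show "A ** matrix_inv A = mat 1" "matrix_inv A ** A = mat 1" by auto
qed

lemma matrix_inv_unique:
  fixes A :: "'a::field^'n::finite^'n"
  assumes "A ** B = mat 1" shows "matrix_inv A = B"
proof -
  have "det A * det B = 1" using assms by (metis det_I det_mul)
  then have "det A \<noteq> 0" by auto
  then have "matrix_inv A ** (A ** B) = B" by (simp add: matrix_mul_assoc matrix_inv_det)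
  then show ?thesis by (simp add: assms)
qed

abbreviation tdet :: "('n::finite \<Rightarrow> 'a::comm_ring_1^'n) \<Rightarrow> 'a" where
  "tdet b \<equiv> det (\<chi> j. b j)"

lemma tuple_sum:
  fixes b :: "'n::finite \<Rightarrow> 'a::comm_semiring_1^'n"
  shows "(\<Sum>j\<in>UNIV. c $ j *s b j) = transpose (\<chi> j. b j) *v c"
  by (simp add: vec_eq_iff matrix_vector_mult_def transpose_def) (intro allI sum.cong refl mult.commute)

lemma tdet_upd:
  fixes b :: "'n::finite \<Rightarrow> 'a::field^'n"
  assumes "u = (\<Sum>i\<in>UNIV. c i *s b i)"
  shows "tdet (b(j := u)) = c j * tdet b"
proof -
  have "tdet (b(j := u)) = det (\<chi> i. if i = j then (\<Sum>i\<in>UNIV. (\<chi> i. c i) $ i *s row i (\<chi> j. b j)) else row i (\<chi> j. b j))"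
    by (rule arg_cong[of _ _ det]) (simp add: vec_eq_iff assms row_def)
  also have "\<dots> = (\<chi> i. c i) $ j * tdet b" by (rule cramer_lemma_transpose)
  finally show ?thesis by simp
qed

text \<open>Cramer's rule. For Krylov vectors the coefficients are quotients of determinantal forms,
  so the invariants determine them.\<close>

lemma tuple_expansion:
  fixes b :: "'n::finite \<Rightarrow> 'a::field^'n"
  assumes "tdet b \<noteq> 0"
  shows "u = (\<Sum>j\<in>UNIV. (tdet (b(j := u)) / tdet b) *s b j)"
proof -
  let ?P = "transpose (\<chi> j. b j)"
  have d: "det ?P \<noteq> 0" using assms by (simp add: det_transpose)
  define c where "c = matrix_inv ?P *v u"
  have "?P *v c = u" unfolding c_def by (simp add: matrix_vector_mul_assoc matrix_inv_det[OF d])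
  then have u: "u = (\<Sum>j\<in>UNIV. c $ j *s b j)" by (simp add: tuple_sum)
  have "tdet (b(j := u)) / tdet b = c $ j" for j
    using tdet_upd[OF u] assms by simp
  then show ?thesis using u by simp
qed

lemma tuple_inj:
  fixes b :: "'n::finite \<Rightarrow> 'a::field^'n"
  assumes "tdet b \<noteq> 0" shows "inj b"
proof (rule injI, rule ccontr)
  fix i j assume "b i = b j" "i \<noteq> j"
  then have "tdet b = 0" by (intro det_identical_rows[of i j]) (simp_all add: row_def)
  then show False using assms by simp
qed

lemma tuple_independent:
  fixes b :: "'n::finite \<Rightarrow> 'a::field^'n"
  assumes "tdet b \<noteq> 0" shows "vec.independent (b ` J)"
proof -
  have "rows (\<chi> j. b j) = range b" by (auto simp: rows_def row_def)
  then have "vec.independent (range b)" using assms det_dependent_rows by metis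
  then show ?thesis by (rule vec.independent_mono) auto
qed

lemma dim_span_tuple:
  fixes b :: "'n::finite \<Rightarrow> 'a::field^'n"
  assumes "tdet b \<noteq> 0" shows "vec.dim (vec.span (b ` J)) = card J"
proof -
  have "vec.dim (vec.span (b ` J)) = card (b ` J)"
    by (rule vec.dim_span_eq_card_independent[OF tuple_independent[OF assms]])
  also have "\<dots> = card J" by (rule card_image) (rule inj_on_subset[OF tuple_inj[OF assms]], simp)
  finally show ?thesis .
qed

lemma basis_tuple:
  fixes S :: "('a::field^'n::finite) set"
  assumes "vec.span S = UNIV"
  obtains b where "\<And>j. b j \<in> S" "tdet b \<noteq> 0"
proof -
  obtain B where B: "B \<subseteq> S" "vec.independent B" "vec.span B = vec.span S"
    using vec.maximal_independent_subset[of S] vec.span_mono vec.span_span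
    by (metis subset_antisym vec.span_minimal vec.subspace_span)
  have "card B = CARD('n)"
    using vec.dim_span_eq_card_independent[OF B(2)] B(3) assms vec_dim_card[where 'a='a and 'n='n] by simp
  moreover have "finite B" using B(2) by (rule vec.finiteI_independent)
  ultimately obtain b :: "'n \<Rightarrow> 'a^'n" where b: "bij_betw b UNIV B"
    using finite_same_card_bij[of "UNIV :: 'n set" B] by auto
  have "\<exists>c. (\<chi> j. b j) ** c = mat 1"
  proof -
    have ind: "(\<forall>i. c i = 0)" if c: "(\<Sum>i\<in>UNIV. c i *s b i) = 0" for c
    proof -
      have inj: "inj b" and ran: "range b = B" using b by (auto simp: bij_betw_def)
      have "(\<Sum>v\<in>B. c (inv b v) *s v) = (\<Sum>i\<in>UNIV. c (inv b (b i)) *s b i)"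
        unfolding ran[symmetric] by (rule sum.reindex_cong[OF inj]) auto
      also have "\<dots> = 0" using c inj by simp
      finally have "\<forall>v\<in>B. c (inv b v) = 0"
        using B(2) \<open>finite B\<close> by (auto simp: vec.independent_explicit)
      then show ?thesis using inj ran by (metis inv_f_f rangeI)
    qed
    then show ?thesis
      unfolding matrix_right_invertible_independent_rows by (simp add: row_def)
  qed
  then have "invertible (\<chi> j. b j)" by (metis invertible_def matrix_left_right_inverse)
  then have "tdet b \<noteq> 0" by (simp add: invertible_det_nz)
  moreover have "b j \<in> S" for j using b B(1) by (auto simp: bij_betw_def)
  ultimately show thesis using that by blast
qed

text \<open>A basis of least total weight is adapted to the filtration by weight: otherwise an exchange
  would decrease the weight.\<close>

lemma greedy_basis:
  fixes X :: "'i \<Rightarrow> 'a::field^'n::finite" and w :: "'i \<Rightarrow> nat"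
  assumes "\<And>j. B0 j \<in> I" "tdet (\<lambda>j. X (B0 j)) \<noteq> 0"
  obtains B where "\<And>j. B j \<in> I" "tdet (\<lambda>j. X (B j)) \<noteq> 0"
    "\<And>e. e \<in> I \<Longrightarrow> X e \<in> vec.span ((\<lambda>j. X (B j)) ` {j. w (B j) \<le> w e})"
proof -
  let ?P = "\<lambda>B. (\<forall>j. B j \<in> I) \<and> tdet (\<lambda>j. X (B j)) \<noteq> 0"
  obtain B where B: "?P B" "\<And>B'. ?P B' \<Longrightarrow> (\<Sum>j\<in>UNIV. w (B j)) \<le> (\<Sum>j\<in>UNIV. w (B' j))"
    using ex_has_least_nat[of ?P B0 "\<lambda>B. \<Sum>j\<in>UNIV. w (B j)"] assms by blast
  let ?b = "\<lambda>j. X (B j)"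
  have "X e \<in> vec.span (?b ` {j. w (B j) \<le> w e})" if e: "e \<in> I" for e
  proof -
    define c where "c j = tdet (?b(j := X e)) / tdet ?b" for j
    have Xe: "X e = (\<Sum>j\<in>UNIV. c j *s ?b j)"
      unfolding c_def using B(1) by (intro tuple_expansion) auto
    have "c j *s ?b j \<in> vec.span (?b ` {j. w (B j) \<le> w e})" for j
    proof (cases "c j = 0")
      case True then show ?thesis by (simp add: vec.span_zero)
    next
      case False
      \<comment> \<open>By Cramer's rule a nonzero coefficient \<open>c j\<close> permits exchanging
        \<open>B j\<close> for \<open>e\<close>; minimality then bounds the weight of
        \<open>B j\<close> by that of \<open>e\<close>.\<close>
      have eq: "(\<lambda>i. X ((B(j := e)) i)) = ?b(j := X e)" by auto
      have "?P (B(j := e))" unfolding eq using False B(1) e unfolding c_def by simp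
      from B(2)[OF this] have "(\<Sum>i\<in>UNIV. w (B i)) \<le> (\<Sum>i\<in>UNIV. w ((B(j := e)) i))" .
      then have "w (B j) + (\<Sum>i\<in>UNIV - {j}. w (B i)) \<le> w e + (\<Sum>i\<in>UNIV - {j}. w ((B(j := e)) i))"
        by (subst (asm) (1 2) sum.remove[of _ j]) auto
      moreover have "(\<Sum>i\<in>UNIV - {j}. w ((B(j := e)) i)) = (\<Sum>i\<in>UNIV - {j}. w (B i))"
        by (intro sum.cong) auto
      ultimately have "w (B j) \<le> w e" by simp
      then show ?thesis by (intro vec.span_scale vec.span_base) auto
    qed
    then show ?thesis by (subst Xe) (intro vec.span_sum)
  qed
  then show thesis using that B(1) by blast
qed

section \<open>Flags\<close>

lemma is_flag_mono:
  assumes "is_flag \<gamma> H" "i \<le> j" "j \<le> \<gamma> + 1" shows "H i \<subseteq> H j"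
  using assms(2,3)
proof (induction j rule: dec_induct)
  case (step k) then show ?case using assms(1) unfolding is_flag_def by (metis Suc_eq_plus1 Suc_le_mono psubset_imp_subset subset_trans Suc_leD)
qed simp

lemma is_flag_subspace: "is_flag \<gamma> H \<Longrightarrow> j \<le> \<gamma> + 1 \<Longrightarrow> vec.subspace (H j)"
  by (simp add: is_flag_def)

lemma is_flag_dim_ge:
  fixes H :: "nat \<Rightarrow> ('a::field^'n::finite) set"
  assumes "is_flag \<gamma> H" "j \<le> \<gamma> + 1" shows "j \<le> vec.dim (H j)"
  using assms(2)
proof (induction j)
  case (Suc j)
  have "H j \<subset> H (Suc j)" using assms(1) Suc.prems by (simp add: is_flag_def)
  moreover have sp: "vec.span (H j) = H j" "vec.span (H (Suc j)) = H (Suc j)"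
    using is_flag_subspace[OF assms(1)] Suc.prems vec.span_eq_iff by auto
  ultimately have "vec.dim (H j) < vec.dim (H (Suc j))" by (intro vec.dim_psubset) (simp only: sp)
  then show ?case using Suc by simp
qed simp

lemma is_flag_le:
  assumes "is_flag \<gamma> (H :: nat \<Rightarrow> ('a::field^'n::finite) set)" shows "\<gamma> + 1 \<le> CARD('n)"
  using is_flag_dim_ge[OF assms, of "\<gamma> + 1"] assms vec_dim_card[where 'a='a and 'n='n]
  by (simp add: is_flag_def)

text \<open>For a flag \<open>H\<close>, \<open>L j\<close> is the first step of the flag that contains the basis vector \<open>b j\<close>.\<close>

lemma flag_adapted_basis:
  fixes H :: "nat \<Rightarrow> ('a::field^'n::finite) set"
  assumes H: "is_flag \<gamma> H"
  obtains b L where "tdet b \<noteq> 0" "\<And>j. 1 \<le> L j \<and> L j \<le> \<gamma> + 1"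
    "\<And>t. t \<le> \<gamma> + 1 \<Longrightarrow> H t = vec.span (b ` {j. L j \<le> t})"
proof -
  define lev where "lev v = (LEAST t. v \<in> H t)" for v
  have top: "H (\<gamma> + 1) = UNIV" and bot: "H 0 = {0}" using H by (auto simp: is_flag_def)
  have lev_in: "v \<in> H (lev v)" and lev_le: "v \<in> H t \<Longrightarrow> lev v \<le> t" for v t
    unfolding lev_def using top by (auto intro: LeastI[of _ "\<gamma> + 1"] Least_le)
  have lev_max: "lev v \<le> \<gamma> + 1" for v using lev_le[of v "\<gamma> + 1"] top by simp
  have lev_iff: "v \<in> H t \<longleftrightarrow> lev v \<le> t" if "t \<le> \<gamma> + 1" for v t
  proof
    assume "lev v \<le> t"
    from is_flag_mono[OF H this that] show "v \<in> H t" using lev_in[of v] by (rule subsetD)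
  qed (rule lev_le)
  have d: "tdet (\<lambda>j. (axis j 1 :: 'a^'n)) \<noteq> 0"
  proof -
    have "(\<chi> j. (axis j 1 :: 'a^'n)) = mat 1" by (simp add: vec_eq_iff axis_def mat_def)
    then show ?thesis by simp
  qed
  \<comment> \<open>The greedy basis with all vectors as candidates, weighted by their level in the
    flag.\<close>
  obtain B :: "'n \<Rightarrow> 'a^'n" where "\<And>j. B j \<in> UNIV" and B: "tdet B \<noteq> 0"
    "\<And>e. e \<in> UNIV \<Longrightarrow> e \<in> vec.span (B ` {j. lev (B j) \<le> lev e})"
    by (rule greedy_basis[where ?B0.0 = "\<lambda>j. (axis j 1 :: 'a^'n)" and I = UNIV and X = "\<lambda>v. v" and w = lev, OF UNIV_I d], rule that, assumption+)
  show thesis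
  proof (rule that[of B "\<lambda>j. lev (B j)"])
    show "tdet B \<noteq> 0" by fact
    show "1 \<le> lev (B j) \<and> lev (B j) \<le> \<gamma> + 1" for j
    proof -
      have "B j \<noteq> 0"
      proof
        assume "B j = 0"
        then have "0 \<in> B ` {j}" by simp
        from vec.dependent_zero[OF this] show False using tuple_independent[OF B(1), of "{j}"] by contradiction
      qed
      then have "B j \<notin> H 0" unfolding bot by simp
      then have "lev (B j) \<noteq> 0" using lev_in[of "B j"] by metis
      then show ?thesis using lev_max[of "B j"] by simp
    qed
    fix t assume t: "t \<le> \<gamma> + 1"
    show "H t = vec.span (B ` {j. lev (B j) \<le> t})"
    proof
      show "vec.span (B ` {j. lev (B j) \<le> t}) \<subseteq> H t"
        by (intro vec.span_minimal is_flag_subspace[OF H t] image_subsetI) (simp only: lev_iff[OF t] mem_Collect_eq)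
      show "H t \<subseteq> vec.span (B ` {j. lev (B j) \<le> t})"
      proof
        fix v assume "v \<in> H t"
        then have "lev v \<le> t" by (rule lev_le)
        then have "vec.span (B ` {j. lev (B j) \<le> lev v}) \<subseteq> vec.span (B ` {j. lev (B j) \<le> t})"
          by (intro vec.span_mono) auto
        then show "v \<in> vec.span (B ` {j. lev (B j) \<le> t})" using B(2)[OF UNIV_I, of v] by (rule subsetD)
      qed
    qed
  qed
qed

lemma tuple_span_iff:
  fixes b :: "'n::finite \<Rightarrow> 'a::field^'n"
  assumes "tdet b \<noteq> 0"
  shows "v \<in> vec.span (b ` J) \<longleftrightarrow> (\<forall>j. j \<notin> J \<longrightarrow> (matrix_inv (transpose (\<chi> j. b j)) *v v) $ j = 0)"
proof -
  let ?P = "transpose (\<chi> j. b j)"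
  have d: "det ?P \<noteq> 0" using assms by (simp add: det_transpose)
  define c where "c = matrix_inv ?P *v v"
  have "?P *v c = v" unfolding c_def by (simp add: matrix_vector_mul_assoc matrix_inv_det[OF d])
  then have v: "v = (\<Sum>j\<in>UNIV. c $ j *s b j)" by (simp add: tuple_sum)
  have "v \<in> vec.span (b ` J)" if z: "\<forall>j. j \<notin> J \<longrightarrow> c $ j = 0"
  proof -
    have "c $ j *s b j \<in> vec.span (b ` J)" for j
      using z by (cases "j \<in> J") (auto intro: vec.span_scale vec.span_base simp: vec.span_zero)
    then show ?thesis by (subst v) (intro vec.span_sum)
  qed
  moreover have "c $ j = 0" if vs: "v \<in> vec.span (b ` J)" and j: "j \<notin> J" for j
  proof -
    have "vec.subspace {x. (matrix_inv ?P *v x) $ j = 0}"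
      by (rule vec.subspaceI) (simp_all add: matrix_vector_right_distrib vector_scalar_commute)
    moreover have "(matrix_inv ?P *v b i) $ j = 0" if "i \<in> J" for i
    proof -
      have "axis i 1 $ j *s b j = (if j = i then b j else 0)" for j by (auto simp: axis_def)
      then have "?P *v axis i 1 = b i" unfolding tuple_sum[symmetric] by (simp add: sum.delta)
      then have "matrix_inv ?P *v b i = axis i 1"
        by (metis matrix_inv_det(2)[OF d] matrix_vector_mul_assoc matrix_vector_mul_lid)
      then show ?thesis using that j by (auto simp: axis_def)
    qed
    ultimately have "vec.span (b ` J) \<subseteq> {x. (matrix_inv ?P *v x) $ j = 0}"
      by (intro vec.span_minimal) auto
    then show ?thesis using vs by (auto simp: c_def)
  qed
  ultimately show ?thesis unfolding c_def by blast
qed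

section \<open>The determinantal invariants\<close>

definition kry :: "'a::field^'n::finite^'n \<Rightarrow> 'a^'n \<Rightarrow> nat \<Rightarrow> 'a^'n" where
  "kry M v a = ((*v) M ^^ a) v"

lemma kry_simps [simp]: "kry M v 0 = v" "kry M v (Suc a) = M *v kry M v a"
  by (simp_all add: kry_def)

text \<open>The multidegree of \<open>dform B\<close>: a vector \<open>M^a w_i\<close> has degree
  \<open>a\<close> in the matrix and degree 1 in \<open>w_i\<close>.\<close>

definition tdegree :: "('n::finite \<Rightarrow> 'm \<times> nat) \<Rightarrow> 'm option \<Rightarrow> nat" where
  "tdegree B = case_option (\<Sum>j\<in>UNIV. snd (B j)) (\<lambda>i. card {j. fst (B j) = i})"

definition dform :: "('n::finite \<Rightarrow> 'm \<times> nat) \<Rightarrow> ('a::field, 'n, 'm) coords \<Rightarrow> 'a" where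
  "dform B = (\<lambda>(M, w). tdet (\<lambda>j. kry M (w (fst (B j))) (snd (B j))))"

lemma kry_hscale: "kry (mscale a M) (b *s v) k = (a ^ k * b) *s kry M v k"
  by (induction k) (simp_all add: mscale_mult_vec vec.scale mult_ac)

lemma tdet_scale:
  "tdet (\<lambda>j. c j *s b j) = (\<Prod>j\<in>UNIV. c j) * tdet b"
  by (rule det_rows_mul)

lemma dform_hscale:
  fixes B :: "'n::finite \<Rightarrow> 'm::finite \<times> nat"
  shows "dform B (hscale b x) = (\<Prod>\<beta>\<in>UNIV. b \<beta> ^ tdegree B \<beta>) * dform B x"
proof -
  obtain M w where x: "x = (M, w)" by (cases x)
  have "(\<Prod>j\<in>UNIV. b None ^ snd (B j) * b (Some (fst (B j)))) =
      b None ^ (\<Sum>j\<in>UNIV. snd (B j)) * (\<Prod>j\<in>UNIV. b (Some (fst (B j))))"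
    by (simp add: prod.distrib power_sum)
  also have "(\<Prod>j\<in>UNIV. b (Some (fst (B j)))) = (\<Prod>i\<in>UNIV. \<Prod>j\<in>{j. fst (B j) = i}. b (Some (fst (B j))))"
    using prod.group[of UNIV UNIV "\<lambda>j. fst (B j)" "\<lambda>j. b (Some (fst (B j)))"] by simp
  also have "\<dots> = (\<Prod>i\<in>UNIV. b (Some i) ^ card {j. fst (B j) = i})" by simp
  finally have "(\<Prod>j\<in>UNIV. b None ^ snd (B j) * b (Some (fst (B j)))) = (\<Prod>\<beta>\<in>UNIV. b \<beta> ^ tdegree B \<beta>)"
    by (simp add: prod_option tdegree_def)
  then show ?thesis
    by (simp add: x dform_def hscale_def kry_hscale tdet_scale)
qed

lemma kry_poly_fun: "(\<lambda>x. kry (fst x) (snd x i) a $ k) \<in> poly_fun coord_funs"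
  for i :: "'m::finite"
proof (induction a arbitrary: k)
  case 0
  have "(\<lambda>x. kry (fst x) (snd x i) 0 $ k) = (\<lambda>(M, w). w i $ k)" by (auto simp: fun_eq_iff)
  then show ?case by (intro poly_fun.coord) (auto simp: coord_funs_def)
next
  case (Suc a)
  have "(\<lambda>x. fst x $ k $ l) = (\<lambda>(M, w). M $ k $ l)" for l by (auto simp: fun_eq_iff)
  then have "(\<lambda>x. fst x $ k $ l) \<in> poly_fun coord_funs" for l
    by (intro poly_fun.coord) (auto simp: coord_funs_def)
  then show ?case using Suc
    by (simp add: matrix_vector_mult_def) (intro poly_fun_sum poly_fun.mult, auto)
qed

lemma dform_mhom:
  fixes B :: "'n::finite \<Rightarrow> 'm::finite \<times> nat"
  shows "dform B \<in> mhom (tdegree B)"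
proof -
  have "dform B = (\<lambda>x. \<Sum>p | p permutes UNIV. of_int (sign p) *
      (\<Prod>j\<in>UNIV. kry (fst x) (snd x (fst (B j))) (snd (B j)) $ p j))"
    by (auto simp: dform_def det_def fun_eq_iff)
  also have "\<dots> \<in> poly_fun coord_funs"
    by (intro poly_fun_sum poly_fun.mult poly_fun_prod poly_fun.const kry_poly_fun) auto
  finally show ?thesis using dform_hscale unfolding mhom_iff by blast
qed

lemma kry_conj:
  assumes "det A \<noteq> 0"
  shows "kry (A ** M ** matrix_inv A) (A *v v) a = A *v kry M v a"
proof (induction a)
  case (Suc a)
  have "(A ** M ** matrix_inv A) *v (A *v kry M v a) = (A ** M ** (matrix_inv A ** A)) *v kry M v a"
    by (simp add: matrix_vector_mul_assoc matrix_mul_assoc)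
  also have "\<dots> = A *v (M *v kry M v a)"
    by (simp add: matrix_inv_det[OF assms] matrix_vector_mul_assoc)
  finally show ?case using Suc by simp
qed simp

lemma tdet_map: "tdet (\<lambda>j. A *v b j) = det A * tdet b"
  for A :: "'a::field^'n::finite^'n"
proof -
  have "(\<chi> j. A *v b j) = (\<chi> j. b j) ** transpose A"
    by (simp add: vec_eq_iff matrix_vector_mult_def matrix_matrix_mult_def transpose_def mult.commute)
  then show ?thesis by (simp add: det_mul det_transpose)
qed

lemma dform_act: "A \<in> SL \<Longrightarrow> dform B (act A x) = dform B x"
  by (cases x) (simp add: SL_def dform_def act_def kry_conj tdet_map)

section \<open>One-parameter subgroups attached to flags\<close>

lemma powi_root_finite:
  fixes c :: "'a::field" and k :: int
  assumes "k \<noteq> 0" shows "finite {t. t \<noteq> 0 \<and> t powi k = c}"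
proof -
  have pos: "finite {t. t \<noteq> 0 \<and> t ^ m = d}" if "m > 0" for m and d :: 'a
  proof -
    have "coeff (monom 1 m - [:d:]) m = 1" using that by (cases m) simp_all
    then have "monom 1 m - [:d:] \<noteq> 0" by (metis coeff_0 zero_neq_one)
    then have "finite {t. poly (monom 1 m - [:d:]) t = 0}" by (rule poly_roots_finite)
    moreover have "{t. t \<noteq> 0 \<and> t ^ m = d} \<subseteq> {t. poly (monom 1 m - [:d:]) t = 0}"
      by (auto simp: poly_monom)
    ultimately show ?thesis by (rule finite_subset[rotated])
  qed
  show ?thesis
  proof (cases "k > 0")
    case True
    then have "{t. t \<noteq> 0 \<and> t powi k = c} = {t. t \<noteq> 0 \<and> t ^ nat k = c}" by (simp add: power_int_def)
    then show ?thesis using pos[of "nat k" c] True by simp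
  next
    case False
    then have "{t. t \<noteq> 0 \<and> t powi k = c} \<subseteq> {t. t \<noteq> 0 \<and> t ^ nat (- k) = inverse c}"
      using assms by (auto simp: power_int_def power_inverse)
    then show ?thesis using pos[of "nat (- k)" "inverse c"] False assms finite_subset by auto
  qed
qed

lemma prod_powi: "finite I \<Longrightarrow> t \<noteq> 0 \<Longrightarrow> (\<Prod>i\<in>I. t powi f i) = t powi (\<Sum>i\<in>I. f i)"
  for t :: "'a::field"
  by (induction I rule: finite_induct) (simp_all add: power_int_add)

text \<open>Counts the pairs with \<open>l i \<le> t \<le> \<gamma>\<close> in two ways: the index
  \<open>i\<close> contributes \<open>\<gamma> + 1 - l i\<close>. This converts sums of weights into
  sums over the steps of a flag.\<close>

lemma sum_card_levels:
  fixes l :: "'i::finite \<Rightarrow> nat"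
  assumes "\<And>i. 1 \<le> l i \<and> l i \<le> \<gamma> + 1"
  shows "(\<Sum>t=1..\<gamma>. card {i. l i \<le> t}) + (\<Sum>i\<in>UNIV. l i) = CARD('i) * (\<gamma> + 1)"
proof -
  have "(\<Sum>t=1..\<gamma>. card {i. l i \<le> t}) = (\<Sum>t=1..\<gamma>. \<Sum>i\<in>UNIV. if l i \<le> t then 1 else 0)"
    by (intro sum.cong) (simp_all add: sum.If_cases)
  also have "\<dots> = (\<Sum>i\<in>UNIV. \<Sum>t=1..\<gamma>. if l i \<le> t then 1 else 0)" by (rule sum.swap)
  also have "\<dots> = (\<Sum>i\<in>UNIV. \<gamma> + 1 - l i)"
  proof (intro sum.cong refl)
    fix i
    have "(\<Sum>t=1..\<gamma>. if l i \<le> t then 1 else 0) = card ({1..\<gamma>} \<inter> {t. l i \<le> t})"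
      by (simp add: sum.If_cases)
    also have "{1..\<gamma>} \<inter> {t. l i \<le> t} = {l i..\<gamma>}" using assms[of i] by auto
    finally show "(\<Sum>t=1..\<gamma>. if l i \<le> t then 1 else 0) = \<gamma> + 1 - l i" by simp
  qed
  finally have "(\<Sum>t=1..\<gamma>. card {i. l i \<le> t}) + (\<Sum>i\<in>UNIV. l i) = (\<Sum>i\<in>UNIV. \<gamma> + 1 - l i + l i)"
    by (simp add: sum.distrib)
  also have "\<dots> = (\<Sum>i\<in>(UNIV :: 'i set). \<gamma> + 1)" using assms by (intro sum.cong) auto
  finally show ?thesis by simp
qed

text \<open>The flag \<open>H\<close> is moved up by at most \<open>\<delta>\<close> steps by \<open>M\<close>, and somewhere by exactly \<open>\<delta>\<close> steps.
  Types I, II and III have \<open>\<delta> = 0, 1, -1\<close>. The one-parameter subgroup \<open>lam\<close> acts on the \<open>j\<close>-th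
  vector of an adapted basis with weight \<open>S - K * L j\<close>.\<close>

locale flag_degeneration =
  fixes \<gamma> :: nat and H :: "nat \<Rightarrow> ('a::alg_closed_field^'n::finite) set" and \<delta> :: int
    and M :: "'a^'n^'n" and w :: "'m::finite \<Rightarrow> 'a^'n" and b :: "'n \<Rightarrow> 'a^'n" and L :: "'n \<Rightarrow> nat"
    and l :: "'m \<Rightarrow> nat" and K :: int
  assumes K_def: "K = int CARD('n)" and flag: "is_flag \<gamma> H"
    and up: "\<And>t v. t \<le> \<gamma> + 1 \<Longrightarrow> v \<in> H t \<Longrightarrow> M *v v \<in> H (min (\<gamma> + 1) (nat (int t + \<delta>)))"
    and down: "\<exists>t v. t \<le> \<gamma> + 1 \<and> 1 \<le> int t + \<delta> \<and> int t + \<delta> \<le> int (\<gamma> + 1) \<and> v \<in> H t \<and> M *v v \<notin> H (nat (int t + \<delta> - 1))"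
    and w0: "\<And>i. w i \<noteq> 0"
    and b: "tdet b \<noteq> 0" and L: "\<And>j. 1 \<le> L j \<and> L j \<le> \<gamma> + 1"
    and H_span: "\<And>t. t \<le> \<gamma> + 1 \<Longrightarrow> H t = vec.span (b ` {j. L j \<le> t})"
    and l_def: "\<And>i. l i = (LEAST t. w i \<in> H t)"
begin

definition P :: "'a^'n^'n" where "P = transpose (\<chi> j. b j)"
definition Q :: "'a^'n^'n" where "Q = matrix_inv P"
text \<open>The shift for which the weights \<open>S - K * L j\<close> add up to zero, so that the
  one-parameter subgroup lies in \<open>SL\<close>.\<close>

definition S :: int where "S = (\<Sum>j\<in>UNIV. int (L j))"

lemma PQ: "P ** Q = mat 1" "Q ** P = mat 1"
  using b unfolding Q_def P_def by (intro matrix_inv_det; simp add: det_transpose)+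

lemma PQ_vec: "P *v (Q *v v) = v" "Q *v (P *v v) = v"
  by (simp_all add: matrix_vector_mul_assoc PQ)

lemma in_H: "t \<le> \<gamma> + 1 \<Longrightarrow> v \<in> H t \<longleftrightarrow> (\<forall>j. (Q *v v) $ j \<noteq> 0 \<longrightarrow> L j \<le> t)"
  using tuple_span_iff[OF b, of v "{j. L j \<le> t}"] H_span[of t] unfolding Q_def P_def by auto

definition M' :: "'a^'n^'n" where "M' = Q ** M ** P"
definition c :: "'m \<Rightarrow> 'a^'n" where "c i = Q *v w i"

lemma M_eq: "M = P ** M' ** Q"
proof -
  have "P ** M' ** Q = (P ** Q) ** M ** (P ** Q)" by (simp add: M'_def matrix_mul_assoc)
  then show ?thesis by (simp add: PQ)
qed

lemma w_eq: "w i = P *v c i"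
  by (simp add: c_def PQ_vec)

lemma top: "H (\<gamma> + 1) = UNIV" using flag by (simp add: is_flag_def)

lemma l_in: "w i \<in> H (l i)" and l_le: "w i \<in> H t \<Longrightarrow> l i \<le> t"
  unfolding l_def using top by (auto intro: LeastI[of _ "\<gamma> + 1"] Least_le)

lemma l_bounds: "1 \<le> l i \<and> l i \<le> \<gamma> + 1"
proof -
  have "l i \<noteq> 0"
  proof
    assume "l i = 0"
    then have "w i \<in> H 0" using l_in[of i] by simp
    then show False using flag w0[of i] by (simp add: is_flag_def)
  qed
  moreover have "l i \<le> \<gamma> + 1" using l_le[of i "\<gamma> + 1"] top by simp
  ultimately show ?thesis by simp
qed

lemma in_H_iff_l: "t \<le> \<gamma> + 1 \<Longrightarrow> w i \<in> H t \<longleftrightarrow> l i \<le> t"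
  using l_le l_in[of i] is_flag_mono[OF flag, of "l i" t] by blast

lemma c_nz: "c i $ j \<noteq> 0 \<Longrightarrow> L j \<le> l i"
  using l_in[of i] in_H[of "l i" "w i"] l_bounds[of i] by (auto simp: c_def)

text \<open>If all coordinates at the level \<open>l i\<close> were zero, \<open>w i\<close> would
  lie in an earlier step. Such a coordinate keeps the limit of \<open>w i\<close> nonzero.\<close>

lemma c_top: "\<exists>j. c i $ j \<noteq> 0 \<and> L j = l i"
proof (rule ccontr)
  assume "\<not> ?thesis"
  then have "\<forall>j. (Q *v w i) $ j \<noteq> 0 \<longrightarrow> L j \<le> l i - 1"
    using c_nz[of i] by (fastforce simp: c_def)
  moreover have "l i - 1 \<le> \<gamma> + 1" using l_bounds[of i] by linarith
  ultimately have "w i \<in> H (l i - 1)" using in_H by blast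
  from l_le[OF this] l_bounds[of i] show False by linarith
qed

lemma M'_col: "(M' *v axis k 1) $ j = M' $ j $ k"
proof -
  have "M' $ j $ x * axis k 1 $ x = (if x = k then M' $ j $ k else 0)" for x by (auto simp: axis_def)
  then show ?thesis by (simp add: matrix_vector_mult_def sum.delta)
qed

lemma M'_nz: assumes "M' $ j $ k \<noteq> 0" shows "int (L j) \<le> int (L k) + \<delta>"
proof -
  have "P *v axis k 1 \<in> H (L k)"
  proof (rule iffD2[OF in_H])
    show "\<forall>j. (Q *v (P *v axis k 1)) $ j \<noteq> 0 \<longrightarrow> L j \<le> L k" by (auto simp: PQ_vec axis_def)
  qed (use L[of k] in simp)
  then have "M *v (P *v axis k 1) \<in> H (min (\<gamma> + 1) (nat (int (L k) + \<delta>)))"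
    using up[of "L k"] L[of k] by blast
  then have "\<forall>j. (Q *v (M *v (P *v axis k 1))) $ j \<noteq> 0 \<longrightarrow> L j \<le> min (\<gamma> + 1) (nat (int (L k) + \<delta>))"
    by (rule iffD1[OF in_H, rotated]) simp
  moreover have "Q *v (M *v (P *v axis k 1)) = M' *v axis k 1"
    by (simp only: M'_def matrix_vector_mul_assoc matrix_mul_assoc)
  then have "(Q *v (M *v (P *v axis k 1))) $ j \<noteq> 0" using assms by (simp only: M'_col not_False_eq_True)
  ultimately have "L j \<le> min (\<gamma> + 1) (nat (int (L k) + \<delta>))"
    by blast
  then show ?thesis using L[of j] by linarith
qed

lemma mult_vec_nth: "(A *v x) $ j = (\<Sum>k\<in>UNIV. A $ j $ k * x $ k)"
  by (simp add: matrix_vector_mult_def)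

text \<open>The hypothesis \<open>down\<close> in coordinates. An entry that shifts the level by
  exactly \<delta> survives in the limit and keeps the limit matrix nonzero.\<close>

lemma M'_top: "\<exists>j k. M' $ j $ k \<noteq> 0 \<and> int (L j) = int (L k) + \<delta>"
proof (rule ccontr)
  assume no: "\<not> ?thesis"
  obtain t v where t: "t \<le> \<gamma> + 1" "1 \<le> int t + \<delta>" "int t + \<delta> \<le> int (\<gamma> + 1)" "v \<in> H t"
    "M *v v \<notin> H (nat (int t + \<delta> - 1))" using down by blast
  have eq: "Q *v (M *v v) = M' *v (Q *v v)"
    by (simp only: M'_def matrix_vector_mul_assoc[symmetric] PQ_vec)
  have "\<forall>j. (Q *v (M *v v)) $ j \<noteq> 0 \<longrightarrow> L j \<le> nat (int t + \<delta> - 1)"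
  proof (intro allI impI)
    fix j assume "(Q *v (M *v v)) $ j \<noteq> 0"
    then have "(\<Sum>k\<in>UNIV. M' $ j $ k * (Q *v v) $ k) \<noteq> 0" unfolding eq mult_vec_nth[of M' "Q *v v" j] .
    then obtain k where k: "M' $ j $ k * (Q *v v) $ k \<noteq> 0"
      by (rule sum.not_neutral_contains_not_neutral)
    then have nz: "M' $ j $ k \<noteq> 0" "(Q *v v) $ k \<noteq> 0" by auto
    have "L k \<le> t" using iffD1[OF in_H[OF t(1)] t(4)] nz(2) by blast
    moreover have "int (L j) \<noteq> int (L k) + \<delta>" using no nz(1) by blast
    moreover have "int (L j) \<le> int (L k) + \<delta>" using nz(1) by (rule M'_nz)
    ultimately show "L j \<le> nat (int t + \<delta> - 1)" by linarith
  qed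
  then have "M *v v \<in> H (nat (int t + \<delta> - 1))" by (rule iffD2[OF in_H, rotated]) (use t(3) in linarith)
  then show False using t by blast
qed

text \<open>The conjugate of \<open>M'\<close> by the diagonal matrix \<open>dg u\<close>, with its
  leading power of \<open>u\<close> removed. Where \<open>M'\<close> is nonzero the exponent is
  nonnegative, so \<open>nat\<close> truncates nothing; at \<open>u = 0\<close> exactly the entries
  that shift the level by \<delta> remain.\<close>

definition Mt :: "'a \<Rightarrow> 'a^'n^'n" where
  "Mt u = (\<chi> j k. M' $ j $ k * u ^ nat (K * (int (L k) + \<delta> - int (L j))))"

definition ct :: "'m \<Rightarrow> 'a \<Rightarrow> 'a^'n" where
  "ct i u = (\<chi> j. c i $ j * u ^ nat (K * (int (l i) - int (L j))))"

definition X :: "'a \<Rightarrow> ('a, 'n, 'm) coords" where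
  "X u = (P ** Mt u ** Q, \<lambda>i. P *v ct i u)"

definition dg :: "'a \<Rightarrow> 'a^'n^'n" where
  "dg t = (\<chi> i j. if i = j then t powi (S - K * int (L i)) else 0)"

definition lam :: "'a \<Rightarrow> 'a^'n^'n" where "lam t = P ** dg t ** Q"

text \<open>The leading weights, which are pulled out so that the curve \<open>X\<close> extends to
  0.\<close>

definition bt :: "'a \<Rightarrow> 'm option \<Rightarrow> 'a" where
  "bt t = case_option (t powi (- K * \<delta>)) (\<lambda>i. t powi (S - K * int (l i)))"

lemma K_pos: "K > 0" by (simp add: K_def)

lemma X_1: "X 1 = (M, w)"
proof -
  have "Mt 1 = M'" "ct i 1 = c i" for i by (simp_all add: Mt_def ct_def vec_eq_iff)
  then show ?thesis by (simp add: X_def M_eq[symmetric] w_eq[symmetric])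
qed

lemma X_cone: "X u \<in> cone"
proof -
  have "Mt u \<noteq> 0 \<and> (\<forall>i. ct i u \<noteq> 0)"
  proof (intro conjI allI)
    obtain j k where "M' $ j $ k \<noteq> 0" "int (L j) = int (L k) + \<delta>" using M'_top by blast
    then have "Mt u $ j $ k \<noteq> 0" by (simp add: Mt_def)
    then show "Mt u \<noteq> 0" by auto
    fix i
    obtain j where "c i $ j \<noteq> 0" "L j = l i" using c_top by blast
    then have "ct i u $ j \<noteq> 0" by (simp add: ct_def)
    then show "ct i u \<noteq> 0" by auto
  qed
  moreover have "P ** A ** Q = 0 \<Longrightarrow> A = 0" for A
  proof -
    assume "P ** A ** Q = 0"
    then have "Q ** (P ** A ** Q) ** P = 0" by simp
    then have "(Q ** P) ** A ** (Q ** P) = 0" by (simp add: matrix_mul_assoc)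
    then show "A = 0" by (simp add: PQ)
  qed
  moreover have "P *v v = 0 \<Longrightarrow> v = 0" for v using PQ_vec(2)[of v] by auto
  ultimately show ?thesis unfolding X_def cone_def by auto
qed

lemma X_poly_curve: "poly_curve X"
  unfolding poly_curve_def
proof
  fix f :: "('a, 'n, 'm) coords \<Rightarrow> 'a" assume "f \<in> coord_funs"
  then consider i j where "f = (\<lambda>(M, w). M $ i $ j)" | i j where "f = (\<lambda>(M, w). w i $ j)"
    by (auto simp: coord_funs_def)
  then show "\<exists>p. \<forall>u. f (X u) = poly p u"
  proof cases
    case (1 i j)
    have "f (X u) = poly (\<Sum>k\<in>UNIV. (\<Sum>k'\<in>UNIV. smult (P $ i $ k')
        (monom (M' $ k' $ k) (nat (K * (int (L k) + \<delta> - int (L k')))))) * [:Q $ k $ j:]) u" for u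
      by (simp add: 1 X_def matrix_matrix_mult_def poly_sum poly_monom Mt_def)
        (intro sum.cong refl mult.commute)
    then show ?thesis by blast
  next
    case (2 i j)
    have "f (X u) = poly (\<Sum>k\<in>UNIV. smult (P $ j $ k)
        (monom (c i $ k) (nat (K * (int (l i) - int (L k)))))) u" for u
      by (simp add: 2 X_def matrix_vector_mult_def poly_sum poly_monom ct_def)
    then show ?thesis by blast
  qed
qed

lemma dg_mult: "t \<noteq> 0 \<Longrightarrow> dg t ** (\<chi> i j. if i = j then t powi (- (S - K * int (L i))) else 0) = mat 1"
proof -
  assume t: "t \<noteq> 0"
  have "(\<Sum>k\<in>UNIV. (if i = k then t powi (S - K * int (L i)) else 0) * (if k = j then t powi (- (S - K * int (L k))) else 0))
     = (if i = j then 1 else 0)" for i j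
  proof -
    have "(if i = k then t powi (S - K * int (L i)) else 0) * (if k = j then t powi (- (S - K * int (L k))) else 0)
      = (if k = i then (if i = j then 1 else 0) else 0)" for k
    proof -
      have "t powi x * t powi (- x) = 1" for x using t by (simp add: power_int_minus)
      from this[of "S - K * int (L i)"] show ?thesis by auto
    qed
    then show ?thesis by (simp add: sum.delta)
  qed
  then show ?thesis by (simp add: vec_eq_iff matrix_matrix_mult_def dg_def mat_def)
qed

definition dgi :: "'a \<Rightarrow> 'a^'n^'n" where
  "dgi t = (\<chi> i j. if i = j then t powi (- (S - K * int (L i))) else 0)"

lemma lam_inv: assumes "t \<noteq> 0" shows "matrix_inv (lam t) = P ** dgi t ** Q"
proof (rule matrix_inv_unique)
  have "lam t ** (P ** dgi t ** Q) = P ** (dg t ** ((Q ** P) ** dgi t)) ** Q"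
    unfolding lam_def by (simp only: matrix_mul_assoc)
  then show "lam t ** (P ** dgi t ** Q) = mat 1" using dg_mult[OF assms] by (simp add: PQ dgi_def)
qed

lemma lam_SL: assumes "t \<noteq> 0" shows "lam t \<in> SL"
proof -
  have "det (dg t) = (\<Prod>i\<in>UNIV. t powi (S - K * int (L i)))"
    by (subst det_diagonal) (simp_all add: dg_def)
  also have "\<dots> = t powi (\<Sum>i\<in>(UNIV :: 'n set). S - K * int (L i))" using assms by (simp add: prod_powi)
  also have "(\<Sum>i\<in>(UNIV :: 'n set). S - K * int (L i)) = 0"
    by (simp add: sum_subtractf sum_distrib_left[symmetric] S_def K_def)
  finally have "det (dg t) = 1" by simp
  moreover have "det P * det Q = 1" by (metis PQ(1) det_I det_mul)
  ultimately show ?thesis by (simp add: SL_def lam_def det_mul)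
qed

lemma dg_left: "(dg t ** A) $ i $ j = t powi (S - K * int (L i)) * A $ i $ j"
proof -
  have "(if i = k then t powi (S - K * int (L i)) else 0) * A $ k $ j = (if k = i then t powi (S - K * int (L i)) * A $ i $ j else 0)" for k
    by auto
  then show ?thesis by (simp add: matrix_matrix_mult_def dg_def sum.delta)
qed

lemma dgi_right: "(A ** dgi t) $ i $ j = A $ i $ j * t powi (- (S - K * int (L j)))"
proof -
  have "A $ i $ k * (if k = j then t powi (- (S - K * int (L k))) else 0) = (if k = j then A $ i $ j * t powi (- (S - K * int (L j))) else 0)" for k
    by auto
  then show ?thesis by (simp add: matrix_matrix_mult_def dgi_def sum.delta)
qed

lemma dg_vec: "(dg t *v v) $ i = t powi (S - K * int (L i)) * v $ i"
proof -
  have "(if i = k then t powi (S - K * int (L i)) else 0) * v $ k = (if k = i then t powi (S - K * int (L i)) * v $ i else 0)" for k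
    by auto
  then show ?thesis by (simp add: matrix_vector_mult_def dg_def sum.delta)
qed

lemma powi_split:
  fixes t :: 'a
  assumes "t \<noteq> 0" "(e :: int) \<ge> 0" "x = y + e" shows "t powi x = t powi y * t ^ nat e"
proof -
  have "t powi e = t ^ nat e" using assms(2) by (simp add: power_int_def)
  then show ?thesis using power_int_add[of t y e] assms by simp
qed

text \<open>Up to scalars, \<open>lam t\<close> acts on the curve by multiplying the parameter. With
  \<open>u = 1\<close> this places the curve in the orbit of the given point, with
  \<open>u = 0\<close> it shows that the limit is fixed.\<close>

lemma act_lam: assumes t: "t \<noteq> 0" shows "act (lam t) (X u) = hscale (bt t) (X (t * u))"
proof -
  have "dg t ** Mt u ** dgi t = mscale (t powi (- K * \<delta>)) (Mt (t * u))"
  proof -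
    have "t powi (S - K * int (L j)) * Mt u $ j $ k * t powi (- (S - K * int (L k))) =
        t powi (- K * \<delta>) * Mt (t * u) $ j $ k" for j k
    proof (cases "M' $ j $ k = 0")
      case False
      let ?e = "K * (int (L k) + \<delta> - int (L j))"
      have e: "?e \<ge> 0" using M'_nz[OF False] K_pos by simp
      have "t powi (S - K * int (L j)) * t powi (- (S - K * int (L k))) = t powi (- K * \<delta> + ?e)"
        using t by (simp add: power_int_add[symmetric] algebra_simps)
      also have "\<dots> = t powi (- K * \<delta>) * t ^ nat ?e" by (rule powi_split[OF t e refl])
      finally show ?thesis by (simp add: Mt_def power_mult_distrib mult_ac)
    qed (simp add: Mt_def)
    then show ?thesis by (simp add: vec_eq_iff dgi_right dg_left mscale_def)
  qed
  moreover have "lam t ** (P ** Mt u ** Q) ** matrix_inv (lam t) = P ** (dg t ** Mt u ** dgi t) ** Q"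
  proof -
    have "lam t ** (P ** Mt u ** Q) ** (P ** dgi t ** Q) = P ** dg t ** (Q ** P) ** Mt u ** (Q ** P) ** dgi t ** Q"
      unfolding lam_def by (simp only: matrix_mul_assoc)
    then show ?thesis by (simp add: lam_inv[OF t] PQ matrix_mul_assoc)
  qed
  moreover have "lam t *v (P *v ct i u) = t powi (S - K * int (l i)) *s (P *v ct i (t * u))" for i
  proof -
    have "lam t *v (P *v ct i u) = P *v (dg t *v ct i u)"
    proof -
      have "lam t *v (P *v ct i u) = P *v (dg t *v ((Q ** P) *v ct i u))"
        unfolding lam_def by (simp only: matrix_vector_mul_assoc matrix_mul_assoc)
      then show ?thesis by (simp add: PQ)
    qed
    also have "dg t *v ct i u = t powi (S - K * int (l i)) *s ct i (t * u)"
    proof -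
      have "t powi (S - K * int (L j)) * ct i u $ j = t powi (S - K * int (l i)) * ct i (t * u) $ j" for j
      proof (cases "c i $ j = 0")
        case False
        let ?e = "K * (int (l i) - int (L j))"
        have e: "?e \<ge> 0" using c_nz[OF False] K_pos by simp
        have "t powi (S - K * int (L j)) = t powi (S - K * int (l i)) * t ^ nat ?e"
          by (rule powi_split[OF t e]) (simp add: algebra_simps)
        then show ?thesis by (simp add: ct_def power_mult_distrib mult_ac)
      qed (simp add: ct_def)
      then show ?thesis by (simp add: vec_eq_iff dg_vec)
    qed
    finally show ?thesis by (simp add: vector_scalar_commute)
  qed
  ultimately show ?thesis
    by (simp add: act_def X_def hscale_def bt_def mscale_matrix_mult)
qed

lemma bt_nz: "t \<noteq> 0 \<Longrightarrow> bt t \<beta> \<noteq> 0"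
  by (cases \<beta>) (simp_all add: bt_def)

text \<open>The exponent of \<open>t\<close> by which \<open>bt t\<close> scales a section of the
  \<open>m\<close>-th power of the sheaf.\<close>

definition wt :: "nat \<Rightarrow> nat \<Rightarrow> int" where
  "wt m q = int m * (- K * \<delta> * int q + (\<Sum>i\<in>UNIV. S - K * int (l i)))"

lemma powi_nat_power: "t \<noteq> 0 \<Longrightarrow> (t powi a) ^ k = t powi (a * int k)" for t :: 'a
  by (induction k) (simp_all add: power_int_add algebra_simps)

lemma bt_weight:
  assumes "t \<noteq> 0"
  shows "(\<Prod>\<beta>\<in>UNIV. bt t \<beta> ^ case_option (m * q) (\<lambda>_. m) \<beta>) = t powi (wt m q)"
proof -
  have "(\<Prod>\<beta>\<in>UNIV. bt t \<beta> ^ case_option (m * q) (\<lambda>_. m) \<beta>) =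
      t powi (- K * \<delta> * int (m * q)) * (\<Prod>i\<in>UNIV. t powi ((S - K * int (l i)) * int m))"
    by (simp add: prod_option bt_def powi_nat_power[OF assms])
  also have "\<dots> = t powi (- K * \<delta> * int (m * q) + (\<Sum>i\<in>UNIV. (S - K * int (l i)) * int m))"
    unfolding prod_powi[OF finite assms] by (rule power_int_add[symmetric]) (simp add: assms)
  also have "- K * \<delta> * int (m * q) + (\<Sum>i\<in>UNIV. (S - K * int (l i)) * int m) = wt m q"
  proof -
    have "- K * \<delta> * int (m * q) + a * int m = int m * (- K * \<delta> * int q + a)" for a
      by (simp add: algebra_simps)
    then show ?thesis unfolding wt_def sum_distrib_right[symmetric] .
  qed
  finally show ?thesis .
qed

text \<open>Summation over levels exhibits the weight as \<open>m * K\<close> times the left side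
  minus the right side of the flag inequality.\<close>

lemma wt_eq:
  "wt m q = int m * (K * (\<Sum>t=1..\<gamma>. int (card {i. w i \<in> H t}))
     - int CARD('m) * (\<Sum>t=1..\<gamma>. int (vec.dim (H t))) - K * \<delta> * int q)"
proof -
  have "(\<Sum>t=1..\<gamma>. int (card {i. w i \<in> H t})) = (\<Sum>t=1..\<gamma>. int (card {i. l i \<le> t}))"
    by (intro sum.cong refl) (simp add: in_H_iff_l)
  moreover have "(\<Sum>t=1..\<gamma>. int (card {i. l i \<le> t})) = int CARD('m) * int (\<gamma> + 1) - (\<Sum>i\<in>UNIV. int (l i))"
  proof -
    have "int ((\<Sum>t=1..\<gamma>. card {i. l i \<le> t}) + (\<Sum>i\<in>UNIV. l i)) = int (CARD('m) * (\<gamma> + 1))"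
      by (rule arg_cong[OF sum_card_levels]) (rule l_bounds)
    then show ?thesis by (simp only: of_nat_add of_nat_sum of_nat_mult; linarith)
  qed
  moreover have "(\<Sum>t=1..\<gamma>. int (vec.dim (H t))) = (\<Sum>t=1..\<gamma>. int (card {j. L j \<le> t}))"
    by (intro sum.cong refl) (simp add: H_span dim_span_tuple[OF b] del: vec.dim_span)
  moreover have "(\<Sum>t=1..\<gamma>. int (card {j. L j \<le> t})) = K * int (\<gamma> + 1) - S"
  proof -
    have "int ((\<Sum>t=1..\<gamma>. card {j. L j \<le> t}) + (\<Sum>j\<in>UNIV. L j)) = int (CARD('n) * (\<gamma> + 1))"
      by (rule arg_cong[OF sum_card_levels]) (rule L)
    then show ?thesis unfolding K_def S_def by (simp only: of_nat_add of_nat_sum of_nat_mult; linarith)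
  qed
  moreover have "(\<Sum>i\<in>(UNIV :: 'm set). S - K * int (l i)) = int CARD('m) * S - K * (\<Sum>i\<in>UNIV. int (l i))"
    by (simp add: sum_subtractf sum_distrib_left)
  ultimately show ?thesis unfolding wt_def by (simp only:) (simp add: algebra_simps)
qed

lemma section_along_X:
  assumes s: "s \<in> invariant_sections (m * q) (\<lambda>_. m)" and t: "t \<noteq> 0"
  shows "s (M, w) = t powi (wt m q) * s (X t)"
proof -
  have "s (M, w) = s (act (lam t) (X 1))"
    using s lam_SL[OF t] X_cone[of 1] by (simp add: invariant_sections_def X_1)
  also have "\<dots> = s (hscale (bt t) (X t))" using act_lam[OF t, of 1] by simp
  also have "\<dots> = (\<Prod>\<beta>\<in>UNIV. bt t \<beta> ^ case_option (m * q) (\<lambda>_. m) \<beta>) * s (X t)"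
    using s bt_nz[OF t] by (intro sections_hscale X_cone) (auto simp: invariant_sections_def)
  finally show ?thesis by (simp add: bt_weight[OF t])
qed

lemma section_nonzero:
  assumes s: "s \<in> invariant_sections (m * q) (\<lambda>_. m)" and nz: "s (M, w) \<noteq> 0"
  shows "wt m q \<le> 0" "wt m q = 0 \<Longrightarrow> s (X 0) \<noteq> 0"
proof -
  have sec: "s \<in> sections (m * q) (\<lambda>_. m) XX" using s by (simp add: invariant_sections_def)
  show "wt m q \<le> 0"
    by (rule section_weight_along_curve(1)[OF sec X_poly_curve X_cone section_along_X[OF s] nz])
  show "s (X 0) \<noteq> 0" if "wt m q = 0"
    using section_weight_along_curve(2)[OF sec X_poly_curve X_cone section_along_X[OF s] nz that] nz by simp
qed

lemma lam_stabilizes: "t \<noteq> 0 \<Longrightarrow> pt (act (lam t) (X 0)) = pt (X 0)"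
  using act_lam[of t 0] pt_hscale[of "bt t" "X 0", OF bt_nz] by simp

lemma pt_X: "t \<noteq> 0 \<Longrightarrow> pt (X t) = pt (act (lam t) (M, w))"
  using act_lam[of t 1] pt_hscale[of "bt t" "X t", OF bt_nz] X_1 by simp

text \<open>Some weight is nonzero: otherwise all levels agree and \<open>H 1\<close> is zero or the
  whole space. A nonzero power of \<open>t\<close> takes each value only finitely often, so
  infinitely many matrices occur.\<close>

lemma infinite_lam: "infinite (lam ` {t. t \<noteq> 0})"
proof
  assume fin: "finite (lam ` {t. t \<noteq> 0})"
  have "\<exists>j. S - K * int (L j) \<noteq> 0"
  proof (rule ccontr)
    assume "\<not> ?thesis"
    then have KS: "K * int (L j) = S" for j by simp
    obtain a where const: "\<And>j. L j = a"
    proof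
      fix j
      have "K * int (L j) = K * int (L undefined)" using KS[of j] KS[of undefined] by (rule trans[OF _ sym])
      then have "int (L j) = int (L undefined)" using K_pos by (simp only: mult_cancel_left) simp
      then show "L j = L undefined" by simp
    qed
    have st: "1 \<le> \<gamma>" "H 0 = {0}" "\<And>j. j \<le> \<gamma> \<Longrightarrow> H j \<subset> H (j + 1)" using flag by (simp_all add: is_flag_def)
    have "H 1 \<noteq> {0}" using st(3)[of 0] unfolding st(2) by simp
    moreover have "H 1 \<noteq> UNIV" using st(3)[OF st(1)] by blast
    moreover have "H 1 = vec.span (b ` {j. L j \<le> 1})" by (rule H_span) simp
    moreover have "{j. L j \<le> 1} = {} \<or> {j. L j \<le> 1} = UNIV" by (simp add: const)
    moreover have "UNIV = vec.span (range b)"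
    proof -
      have "{j. L j \<le> \<gamma> + 1} = UNIV" using L by auto
      then show ?thesis using H_span[of "\<gamma> + 1"] unfolding top by simp
    qed
    ultimately show False by auto
  qed
  then obtain j where j: "S - K * int (L j) \<noteq> 0" by blast
  have dg_eq: "dg t = Q ** lam t ** P" for t
  proof -
    have "Q ** lam t ** P = (Q ** P) ** dg t ** (Q ** P)" unfolding lam_def by (simp only: matrix_mul_assoc)
    then show ?thesis by (simp add: PQ)
  qed
  have "t powi (S - K * int (L j)) = (Q ** lam t ** P) $ j $ j" for t
    unfolding dg_eq[symmetric] by (simp add: dg_def)
  then have "(\<lambda>t. t powi (S - K * int (L j))) ` {t. t \<noteq> 0} = (\<lambda>A. (Q ** A ** P) $ j $ j) ` lam ` {t. t \<noteq> 0}"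
    by (simp add: image_image)
  with fin have fin2: "finite ((\<lambda>t. t powi (S - K * int (L j))) ` {t :: 'a. t \<noteq> 0})" by simp
  have "finite {t :: 'a. t \<noteq> 0}"
  proof (rule finite_subset)
    show "{t :: 'a. t \<noteq> 0} \<subseteq> (\<Union>c\<in>(\<lambda>t. t powi (S - K * int (L j))) ` {t. t \<noteq> 0}. {t. t \<noteq> 0 \<and> t powi (S - K * int (L j)) = c})"
      by auto
    show "finite (\<Union>c\<in>(\<lambda>t. t powi (S - K * int (L j))) ` {t. t \<noteq> 0}. {t :: 'a. t \<noteq> 0 \<and> t powi (S - K * int (L j)) = c})"
      using fin2 powi_root_finite[OF j] by blast
  qed
  then have "finite (insert 0 {t :: 'a. t \<noteq> 0})" by simp
  moreover have "insert 0 {t :: 'a. t \<noteq> 0} = UNIV" by auto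
  ultimately show False using infinite_UNIV_alg_closed[where 'a='a] by simp
qed

end

section \<open>The action on points, stabilizers and orbits\<close>

lemma act_pt_pt: "act_pt A (pt x) = pt (act A x)"
proof -
  obtain M w where x: "x = (M, w)" by (cases x)
  have "(\<lambda>M. A ** M ** matrix_inv A) ` range (\<lambda>c. mscale c M) = range (\<lambda>c. mscale c (A ** M ** matrix_inv A))"
    unfolding image_image by (simp add: mscale_matrix_mult)
  moreover have "(*v) A ` range (\<lambda>c. c *s w i) = range (\<lambda>c. c *s (A *v w i))" for i
    unfolding image_image by (simp add: vector_scalar_commute)
  ultimately show ?thesis by (simp add: x pt_def act_pt_def act_def)
qed

lemma act_in_cone: assumes "A \<in> SL" "x \<in> cone" shows "act A x \<in> cone"
proof -
  obtain M w where x: "x = (M, w)" "M \<noteq> 0" "\<And>i. w i \<noteq> 0" using assms(2) by (auto simp: cone_def)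
  have d: "det A \<noteq> 0" using assms(1) by (simp add: SL_def)
  have "A ** M ** matrix_inv A \<noteq> 0"
  proof
    assume "A ** M ** matrix_inv A = 0"
    then have "matrix_inv A ** (A ** M ** matrix_inv A) ** A = 0" by simp
    then have "(matrix_inv A ** A) ** M ** (matrix_inv A ** A) = 0" by (simp only: matrix_mul_assoc)
    then show False using x(2) by (simp add: matrix_inv_det[OF d])
  qed
  moreover have "A *v w i \<noteq> 0" for i
  proof
    assume "A *v w i = 0"
    then have "matrix_inv A *v (A *v w i) = 0" by simp
    then show False using x(3) by (simp add: matrix_vector_mul_assoc matrix_inv_det[OF d])
  qed
  ultimately show ?thesis by (simp add: x act_def cone_def)
qed

lemma act_act:
  assumes "A \<in> SL" "B \<in> SL" shows "act A (act B x) = act (A ** B) x"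
proof -
  have d: "det A \<noteq> 0" "det B \<noteq> 0" using assms by (simp_all add: SL_def)
  have "matrix_inv (A ** B) = matrix_inv B ** matrix_inv A"
  proof (rule matrix_inv_unique)
    have "A ** B ** (matrix_inv B ** matrix_inv A) = A ** (B ** matrix_inv B) ** matrix_inv A"
      by (simp only: matrix_mul_assoc)
    then show "A ** B ** (matrix_inv B ** matrix_inv A) = mat 1" by (simp add: matrix_inv_det[OF d(1)] matrix_inv_det[OF d(2)])
  qed
  then show ?thesis by (cases x) (simp add: act_def matrix_vector_mul_assoc matrix_mul_assoc)
qed

lemma SL_mult: "A \<in> SL \<Longrightarrow> B \<in> SL \<Longrightarrow> A ** B \<in> SL"
  by (simp add: SL_def det_mul)

lemma SL_inv: assumes "A \<in> SL" shows "matrix_inv A \<in> SL" "matrix_inv A ** A = mat 1" "A ** matrix_inv A = mat 1"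
proof -
  have d: "det A \<noteq> 0" using assms by (simp add: SL_def)
  show "matrix_inv A ** A = mat 1" "A ** matrix_inv A = mat 1" by (simp_all add: matrix_inv_det[OF d])
  then have "det A * det (matrix_inv A) = 1" by (metis det_I det_mul)
  then show "matrix_inv A \<in> SL" using assms by (simp add: SL_def)
qed

lemma act_mat_1: "act (mat 1) x = x"
  by (cases x) (simp add: act_def matrix_inv_unique[of "mat 1" "mat 1"])

lemma infinite_stabilizer_orbit:
  assumes "A \<in> SL" "infinite (stabilizer (pt (act A x)))"
  shows "infinite (stabilizer (pt x))"
proof
  let ?I = "matrix_inv A"
  assume fin: "finite (stabilizer (pt x))"
  have "stabilizer (pt (act A x)) \<subseteq> (\<lambda>g. A ** g ** ?I) ` stabilizer (pt x)"
  proof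
    fix g assume g: "g \<in> stabilizer (pt (act A x))"
    then have gS: "g \<in> SL" and fx: "pt (act g (act A x)) = pt (act A x)"
      by (simp_all add: stabilizer_def act_pt_pt)
    let ?h = "?I ** (g ** A)"
    have hS: "?h \<in> SL" using SL_inv(1)[OF assms(1)] gS assms(1) by (intro SL_mult)
    have "act ?h x = act ?I (act g (act A x))"
      using SL_inv(1)[OF assms(1)] gS assms(1) by (simp add: act_act SL_mult)
    then have "pt (act ?h x) = act_pt ?I (pt (act g (act A x)))" by (simp add: act_pt_pt)
    also have "\<dots> = pt (act ?I (act A x))" by (simp add: fx act_pt_pt)
    also have "\<dots> = pt x" using SL_inv[OF assms(1)] assms(1) by (simp add: act_act act_mat_1)
    finally have "?h \<in> stabilizer (pt x)" using hS by (simp add: stabilizer_def act_pt_pt)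
    moreover have "g = A ** ?h ** ?I"
    proof -
      have "A ** ?h ** ?I = (A ** ?I) ** g ** (A ** ?I)" by (simp only: matrix_mul_assoc)
      then show ?thesis by (simp add: SL_inv[OF assms(1)])
    qed
    ultimately show "g \<in> (\<lambda>g. A ** g ** ?I) ` stabilizer (pt x)" by blast
  qed
  then show False using fin assms(2) finite_subset by blast
qed

lemma orbit_pt: "orbit (pt x) = {pt (act A x) | A. A \<in> SL}"
  by (auto simp: orbit_def act_pt_pt)

theorem flag_obstruction:
  fixes M :: "'a::alg_closed_field^'n::finite^'n" and w :: "'m::finite \<Rightarrow> 'a^'n"
  assumes flag: "is_flag \<gamma> H"
    and up: "\<And>t v. t \<le> \<gamma> + 1 \<Longrightarrow> v \<in> H t \<Longrightarrow> M *v v \<in> H (min (\<gamma> + 1) (nat (int t + \<delta>)))"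
    and down: "\<exists>t v. t \<le> \<gamma> + 1 \<and> 1 \<le> int t + \<delta> \<and> int t + \<delta> \<le> int (\<gamma> + 1) \<and> v \<in> H t \<and> M *v v \<notin> H (nat (int t + \<delta> - 1))"
    and x: "(M, w) \<in> cone" and m: "m \<ge> 1"
    and s: "s \<in> invariant_sections (m * q) (\<lambda>_. m)" and nz: "s (M, w) \<noteq> 0"
  shows "int CARD('n) * (\<Sum>t=1..\<gamma>. int (card {i. w i \<in> H t}))
      \<le> int CARD('m) * (\<Sum>t=1..\<gamma>. int (vec.dim (H t))) + int CARD('n) * \<delta> * int q" (is "?l \<le> ?r")
    and "int CARD('n) * (\<Sum>t=1..\<gamma>. int (card {i. w i \<in> H t}))
      = int CARD('m) * (\<Sum>t=1..\<gamma>. int (vec.dim (H t))) + int CARD('n) * \<delta> * int q \<Longrightarrow> closedin (subtopology zariski_X (nonvanishing s)) (orbit (pt (M, w))) \<Longrightarrow>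
      infinite (stabilizer (pt (M, w)))"
proof -
  obtain b L where b: "tdet b \<noteq> 0" "\<And>j. 1 \<le> L j \<and> L j \<le> \<gamma> + 1"
    "\<And>t. t \<le> \<gamma> + 1 \<Longrightarrow> H t = vec.span (b ` {j. L j \<le> t})"
    by (rule flag_adapted_basis[OF flag], rule that, assumption+)
  interpret flag_degeneration \<gamma> H \<delta> M w b L "\<lambda>i. LEAST t. w i \<in> H t" "int CARD('n)"
    by unfold_locales (use flag up down x b in \<open>auto simp: cone_def\<close>)
  have wt: "wt m q = int m * (?l - ?r)"
    unfolding wt_eq by (rule arg_cong[of _ _ "(*) (int m)"]) linarith
  have mp: "int m > 0" using m by simp
  have "int m * (?l - ?r) \<le> 0" using section_nonzero(1)[OF s nz] unfolding wt .
  then show "?l \<le> ?r" using mp by (simp add: mult_le_0_iff)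
  show "infinite (stabilizer (pt (M, w)))" if eq: "?l = ?r"
    and cl: "closedin (subtopology zariski_X (nonvanishing s)) (orbit (pt (M, w)))"
  proof -
    have sec: "s \<in> sections (m * q) (\<lambda>_. m) XX" using s by (simp add: invariant_sections_def)
    have "wt m q = 0" unfolding wt eq by simp
    then have "s (X 0) \<noteq> 0" by (rule section_nonzero(2)[OF s nz])
    then have X0: "pt (X 0) \<in> nonvanishing s" using pt_in_nonvanishing_section_iff[OF sec X_cone] by simp
    obtain C where C: "closedin zariski_X C" "orbit (pt (M, w)) = C \<inter> nonvanishing s"
      using cl unfolding closedin_subtopology by blast
    \<comment> \<open>The points \<open>X t\<close> with \<open>t \<noteq> 0\<close> lie in the
      orbit, and a neighbourhood of the limit contains almost all of them.\<close>
    have "pt (X 0) \<in> C"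
    proof (rule ccontr)
      assume "pt (X 0) \<notin> C"
      then have "pt (X 0) \<in> XX - C" using X_cone[of 0] by (simp add: XX_eq)
      moreover have "openin zariski_X (XX - C)" using C(1) by (simp add: closedin_def topspace_zariski_X)
      ultimately have "finite {t. pt (X t) \<notin> XX - C}" using poly_curve_open[OF X_poly_curve X_cone] by blast
      then have "finite (insert 0 {t. pt (X t) \<notin> XX - C})" by simp
      then obtain t where t: "t \<notin> insert 0 {t. pt (X t) \<notin> XX - C}"
        using infinite_UNIV_alg_closed[where 'a='a] ex_new_if_finite by blast
      then have "pt (X t) \<notin> C" "t \<noteq> 0" by auto
      moreover have "pt (X t) \<in> orbit (pt (M, w))" using pt_X[OF \<open>t \<noteq> 0\<close>] lam_SL[OF \<open>t \<noteq> 0\<close>] unfolding orbit_pt by blast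
      ultimately show False using C(2) by blast
    qed
    then have "pt (X 0) \<in> orbit (pt (M, w))" using X0 C(2) by blast
    then obtain A where A: "A \<in> SL" "pt (X 0) = pt (act A (M, w))" unfolding orbit_pt by blast
    have "lam ` {t. t \<noteq> 0} \<subseteq> stabilizer (pt (X 0))"
      using lam_SL lam_stabilizes by (auto simp: stabilizer_def act_pt_pt)
    then have "infinite (stabilizer (pt (X 0)))" using infinite_lam finite_subset by blast
    then show ?thesis unfolding A(2) by (rule infinite_stabilizer_orbit[OF A(1)])
  qed
qed

section \<open>Farkas' lemma\<close>

lemma sum_mult_diff:
  "(\<Sum>i\<in>I. y i * (x i - p * z i)) = (\<Sum>i\<in>I. y i * x i) - p * (\<Sum>i\<in>I. y i * z i)" for p :: "'a::comm_ring"
  by (simp add: right_diff_distrib sum_subtractf sum_distrib_left mult.left_commute)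

text \<open>Stated over the rationals so that denominators can be cleared: cone coefficients become
  exponents of forms, separating functionals become integral weights. The induction removes one
  vector at a time by projecting along it.\<close>

lemma farkas_rat:
  fixes u :: "'k \<Rightarrow> 'i::finite \<Rightarrow> rat" and \<tau> :: "'i \<Rightarrow> rat"
  assumes "finite A"
  shows "(\<exists>c. (\<forall>k\<in>A. c k \<ge> 0) \<and> (\<forall>i. \<tau> i = (\<Sum>k\<in>A. c k * u k i))) \<or>
    (\<exists>y. (\<forall>k\<in>A. (\<Sum>i\<in>UNIV. y i * u k i) \<ge> 0) \<and> (\<Sum>i\<in>UNIV. y i * \<tau> i) < 0)"
  using assms
proof (induction A arbitrary: u \<tau> rule: finite_induct)
  case empty
  show ?case
  proof (cases "\<forall>i. \<tau> i = 0")
    case False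
    then obtain i where "\<tau> i \<noteq> 0" by blast
    then have "0 < (\<Sum>i\<in>UNIV. \<tau> i * \<tau> i)" by (intro sum_pos2[of _ i]) (auto simp: zero_less_mult_iff linorder_neq_iff)
    then have "(\<Sum>i\<in>UNIV. - \<tau> i * \<tau> i) < 0" by (simp add: sum_negf)
    then show ?thesis by (intro disjI2 exI[of _ "\<lambda>i. - \<tau> i"]) simp
  qed simp
next
  case (insert a A)
  from insert.IH[of \<tau> u] show ?case
  proof (elim disjE exE conjE)
    fix c assume "\<forall>k\<in>A. c k \<ge> 0" "\<forall>i. \<tau> i = (\<Sum>k\<in>A. c k * u k i)"
    moreover have "(\<Sum>k\<in>A. (c(a := 0)) k * u k i) = (\<Sum>k\<in>A. c k * u k i)" for i
      using insert.hyps by (intro sum.cong) auto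
    ultimately show ?case using insert.hyps by (intro disjI1 exI[of _ "c(a := 0)"]) auto
  next
    fix y assume y: "\<forall>k\<in>A. (\<Sum>i\<in>UNIV. y i * u k i) \<ge> 0" "(\<Sum>i\<in>UNIV. y i * \<tau> i) < 0"
    define dy where "dy x = (\<Sum>i\<in>UNIV. y i * x i)" for x
    show ?case
    proof (cases "dy (u a) \<ge> 0")
      case True
      then show ?thesis using y by (intro disjI2 exI[of _ y]) (auto simp: dy_def)
    next
      case False
      \<comment> \<open>The projection along \<open>u a\<close> onto the kernel of \<open>y\<close>;
        the induction hypothesis is applied a second time to the projected vectors.\<close>
      define pr where "pr x = (\<lambda>i. x i - (dy x / dy (u a)) * u a i)" for x
      from insert.IH[of "pr \<tau>" "\<lambda>k. pr (u k)"] show ?thesis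
      proof (elim disjE exE conjE)
        fix c assume c: "\<forall>k\<in>A. c k \<ge> 0" "\<forall>i. pr \<tau> i = (\<Sum>k\<in>A. c k * pr (u k) i)"
        \<comment> \<open>The coefficient of \<open>u a\<close>. It is nonnegative because
          \<open>y\<close> is negative on \<open>u a\<close> and on \<tau> but nonnegative on the
          remaining vectors.\<close>
        define e where "e = dy \<tau> / dy (u a) - (\<Sum>k\<in>A. c k * (dy (u k) / dy (u a)))"
        have "dy \<tau> / dy (u a) \<ge> 0" using y(2) False by (simp add: dy_def divide_nonpos_nonpos)
        moreover have "(\<Sum>k\<in>A. c k * (dy (u k) / dy (u a))) \<le> 0"
          using y(1) c(1) False by (intro sum_nonpos mult_nonneg_nonpos divide_nonneg_nonpos) (auto simp: dy_def)
        ultimately have e: "e \<ge> 0" by (simp add: e_def)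
        have "\<tau> i = (\<Sum>k\<in>A. c k * u k i) + e * u a i" for i
        proof -
          have "\<tau> i = pr \<tau> i + dy \<tau> / dy (u a) * u a i" by (simp add: pr_def)
          also have "pr \<tau> i = (\<Sum>k\<in>A. c k * pr (u k) i)" using c(2) by blast
          also have "\<dots> = (\<Sum>k\<in>A. c k * u k i) - (\<Sum>k\<in>A. c k * (dy (u k) / dy (u a))) * u a i"
            unfolding pr_def by (simp add: right_diff_distrib sum_subtractf sum_distrib_right mult.assoc)
          finally show ?thesis by (simp add: e_def left_diff_distrib)
        qed
        moreover have "(\<Sum>k\<in>A. (c(a := e)) k * u k i) = (\<Sum>k\<in>A. c k * u k i)" for i
          using insert.hyps by (intro sum.cong) auto
        ultimately show ?thesis using insert.hyps c(1) e
          by (intro disjI1 exI[of _ "c(a := e)"]) (auto simp: add.commute)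
      next
        fix y' assume y': "\<forall>k\<in>A. (\<Sum>i\<in>UNIV. y' i * pr (u k) i) \<ge> 0" "(\<Sum>i\<in>UNIV. y' i * pr \<tau> i) < 0"
        define d where "d = (\<Sum>i\<in>UNIV. y' i * u a i)"
        \<comment> \<open>The functional \<open>y'\<close> composed with the projection, hence zero
          on \<open>u a\<close>.\<close>
        define Y where "Y i = y' i - d / dy (u a) * y i" for i
        have eq: "(\<Sum>i\<in>UNIV. Y i * x i) = (\<Sum>i\<in>UNIV. y' i * pr x i)" for x
        proof -
          have "(\<Sum>i\<in>UNIV. Y i * x i) = (\<Sum>i\<in>UNIV. x i * (y' i - d / dy (u a) * y i))"
            by (simp add: mult.commute Y_def)
          also have "\<dots> = (\<Sum>i\<in>UNIV. x i * y' i) - d / dy (u a) * (\<Sum>i\<in>UNIV. x i * y i)" by (rule sum_mult_diff)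
          also have "\<dots> = (\<Sum>i\<in>UNIV. y' i * x i) - dy x / dy (u a) * d"
            by (simp add: dy_def mult.commute)
          also have "\<dots> = (\<Sum>i\<in>UNIV. y' i * pr x i)" unfolding pr_def d_def by (rule sum_mult_diff[symmetric])
          finally show ?thesis .
        qed
        have "pr (u a) = (\<lambda>_. 0)" using False by (auto simp: pr_def)
        then have "(\<Sum>i\<in>UNIV. Y i * u a i) = 0" unfolding eq by simp
        then show ?thesis using y' by (intro disjI2 exI[of _ Y]) (auto simp: eq)
      qed
    qed
  qed
qed

lemma common_denominator:
  fixes f :: "'s \<Rightarrow> rat"
  assumes "finite A" shows "\<exists>N>0. \<forall>s\<in>A. \<exists>z. f s * of_int N = of_int z"
  using assms
proof (induction A rule: finite_induct)
  case empty show ?case by (intro exI[of _ 1]) simp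
next
  case (insert a A)
  then obtain N where N: "N > 0" "\<forall>s\<in>A. \<exists>z. f s * of_int N = of_int z" by blast
  obtain p d where pd: "quotient_of (f a) = (p, d)" by (cases "quotient_of (f a)")
  have d: "d > 0" "f a = of_int p / of_int d" using quotient_of_denom_pos[OF pd] quotient_of_div[OF pd] by auto
  have "\<exists>z. f s * of_int (N * d) = of_int z" if "s \<in> insert a A" for s
  proof (cases "s = a")
    case True then show ?thesis using d by (intro exI[of _ "p * N"]) simp
  next
    case False
    then obtain z where "f s * of_int N = of_int z" using N(2) \<open>s \<in> insert a A\<close> by blast
    then show ?thesis by (intro exI[of _ "z * d"]) (simp add: mult.assoc[symmetric])
  qed
  then show ?case using N(1) d(1) by (intro exI[of _ "N * d"]) simp
qed

lemma farkas_int: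
  fixes u :: "'k \<Rightarrow> 'i::finite \<Rightarrow> int" and \<tau> :: "'i \<Rightarrow> int"
  assumes "finite A"
  obtains (comb) m c where "m > 0" "\<And>i. int m * \<tau> i = (\<Sum>k\<in>A. int (c k) * u k i)"
  | (sep) y where "\<And>k. k \<in> A \<Longrightarrow> (\<Sum>i\<in>UNIV. y i * u k i) \<ge> 0" "(\<Sum>i\<in>UNIV. y i * \<tau> i) < 0"
proof -
  from farkas_rat[OF assms, of "\<lambda>i. of_int (\<tau> i)" "\<lambda>k i. of_int (u k i)"] show thesis
  proof (elim disjE exE conjE)
    fix c :: "'k \<Rightarrow> rat"
    assume c: "\<forall>k\<in>A. 0 \<le> c k" "\<forall>i. of_int (\<tau> i) = (\<Sum>k\<in>A. c k * of_int (u k i))"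
    obtain N where N: "N > 0" "\<forall>k\<in>A. \<exists>z. c k * of_int N = of_int z"
      using common_denominator[OF assms] by blast
    then obtain z where z: "\<And>k. k \<in> A \<Longrightarrow> c k * of_int N = of_int (z k)" by metis
    have zn: "z k \<ge> 0" if "k \<in> A" for k
    proof -
      have "(0 :: rat) \<le> c k * of_int N" using c(1) that N(1) by simp
      then show ?thesis using z[OF that] by simp
    qed
    have "int (nat N) * \<tau> i = (\<Sum>k\<in>A. int (nat (z k)) * u k i)" for i
    proof -
      have "(of_int (N * \<tau> i) :: rat) = of_int N * (\<Sum>k\<in>A. c k * of_int (u k i))" using c(2) by simp
      also have "\<dots> = (\<Sum>k\<in>A. (c k * of_int N) * of_int (u k i))" by (simp add: sum_distrib_left mult_ac)
      also have "\<dots> = (\<Sum>k\<in>A. of_int (z k) * of_int (u k i))" by (intro sum.cong) (simp_all add: z)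
      also have "\<dots> = of_int (\<Sum>k\<in>A. z k * u k i)" by simp
      finally have "N * \<tau> i = (\<Sum>k\<in>A. z k * u k i)" by (simp only: of_int_eq_iff)
      also have "\<dots> = (\<Sum>k\<in>A. int (nat (z k)) * u k i)" using zn by (intro sum.cong) auto
      finally show ?thesis using N(1) by simp
    qed
    then show thesis using N(1) by (intro comb[of "nat N" "\<lambda>k. nat (z k)"]) simp_all
  next
    fix y :: "'i \<Rightarrow> rat"
    assume y: "\<forall>k\<in>A. 0 \<le> (\<Sum>i\<in>UNIV. y i * of_int (u k i))" "(\<Sum>i\<in>UNIV. y i * of_int (\<tau> i)) < 0"
    obtain N where N: "N > 0" "\<forall>i\<in>UNIV. \<exists>z. y i * of_int N = of_int z"
      using common_denominator[OF finite] by blast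
    then have "\<forall>i. \<exists>z. y i * of_int N = of_int z" by simp
    from choice[OF this] obtain z where z: "\<And>i. y i * of_int N = of_int (z i)" by blast
    have eq: "(of_int (\<Sum>i\<in>UNIV. z i * x i) :: rat) = of_int N * (\<Sum>i\<in>UNIV. y i * of_int (x i))" for x
      by (simp add: z[symmetric] sum_distrib_left mult_ac)
    show thesis
    proof (rule sep[of z])
      fix k assume "k \<in> A"
      then have "(0 :: rat) \<le> of_int (\<Sum>i\<in>UNIV. z i * u k i)" unfolding eq using y(1) N(1) by simp
      then show "0 \<le> (\<Sum>i\<in>UNIV. z i * u k i)" by (simp only: of_int_0_le_iff)
    next
      have "(of_int (\<Sum>i\<in>UNIV. z i * \<tau> i) :: rat) < 0" unfolding eq using y(2) N(1) by (simp add: mult_pos_neg)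
      then show "(\<Sum>i\<in>UNIV. z i * \<tau> i) < 0" by (simp only: of_int_less_0_iff)
    qed
  qed
qed

section \<open>Coefficients of the characteristic polynomial\<close>

text \<open>The polynomial \<open>det (1 + t M)\<close>, a reversed characteristic polynomial. In
  this normalisation the coefficient of \<open>t^d\<close> has degree \<open>d\<close> in
  \<open>M\<close>.\<close>

definition detpoly :: "'a::comm_ring_1^'n::finite^'n \<Rightarrow> 'a poly" where
  "detpoly M = det (\<chi> i j. [:if i = j then 1 else 0, M $ i $ j:])"

lemma poly_detpoly: "poly (detpoly M) t = det (mat 1 + mscale t M)"
  for M :: "'a::field^'n::finite^'n"
proof -
  have "poly [:if i = j then 1 else 0, M $ i $ j:] t = (mat 1 + mscale t M) $ i $ j" for i j
    by (simp add: mat_def mscale_def)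
  then show ?thesis
    unfolding detpoly_def det_def by (simp add: poly_sum poly_prod)
qed

definition cpform :: "nat \<Rightarrow> ('a::field, 'n::finite, 'm) coords \<Rightarrow> 'a" where
  "cpform d = (\<lambda>(M, w). coeff (detpoly M) d)"

lemma poly_fun_coeff_sum:
  assumes "finite I" "\<And>i d. i \<in> I \<Longrightarrow> (\<lambda>x. coeff (P i x) d) \<in> poly_fun C"
  shows "(\<lambda>x. coeff (\<Sum>i\<in>I. P i x) d) \<in> poly_fun C"
  using assms by (simp add: coeff_sum poly_fun_sum)

lemma poly_fun_coeff_prod:
  assumes "finite I" "\<And>i d. i \<in> I \<Longrightarrow> (\<lambda>x. coeff (P i x) d) \<in> poly_fun C"
  shows "(\<lambda>x. coeff (\<Prod>i\<in>I. P i x) d) \<in> poly_fun C"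
  using assms
proof (induction I arbitrary: d rule: finite_induct)
  case empty show ?case by (cases "d = 0") (simp_all add: poly_fun.const)
next
  case (insert i I)
  then have "(\<lambda>x. \<Sum>e\<le>d. coeff (P i x) e * coeff (\<Prod>i\<in>I. P i x) (d - e)) \<in> poly_fun C"
    by (intro poly_fun_sum poly_fun.mult) auto
  then show ?case using insert.hyps by (simp add: coeff_mult)
qed

lemma of_int_mult_poly: "of_int k * q = smult (of_int k) q" for q :: "'a::comm_ring_1 poly"
  by (simp add: of_int_poly)

lemma cpform_poly_fun:
  "(cpform d :: ('a::field, 'n::finite, 'm) coords \<Rightarrow> 'a) \<in> poly_fun coord_funs"
proof -
  have entry: "(\<lambda>x :: ('a, 'n, 'm) coords. coeff [:if i = j then 1 else 0, fst x $ i $ j:] d) \<in> poly_fun coord_funs" for i j d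
  proof -
    have "(\<lambda>x :: ('a, 'n, 'm) coords. fst x $ i $ j) = (\<lambda>(M, w). M $ i $ j)" by (auto simp: fun_eq_iff)
    then have "(\<lambda>x :: ('a, 'n, 'm) coords. fst x $ i $ j) \<in> poly_fun coord_funs"
      by (intro poly_fun.coord) (auto simp: coord_funs_def)
    then show ?thesis by (cases d; cases "d - 1") (auto intro: poly_fun.const)
  qed
  have sgn: "(\<lambda>x :: ('a, 'n, 'm) coords. coeff (of_int (sign p) * (\<Prod>i\<in>UNIV. [:if i = p i then 1 else 0, fst x $ i $ p i:])) d) \<in> poly_fun coord_funs"
    for p :: "'n \<Rightarrow> 'n" and d
    unfolding of_int_mult_poly coeff_smult
    by (intro poly_fun.mult poly_fun.const poly_fun_coeff_prod finite entry)
  have "cpform d = (\<lambda>x :: ('a, 'n, 'm) coords. coeff (\<Sum>p | p permutes UNIV.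
      of_int (sign p) * (\<Prod>i\<in>UNIV. [:if i = p i then 1 else 0, fst x $ i $ p i:])) d)"
    by (auto simp: cpform_def detpoly_def det_def fun_eq_iff)
  also have "\<dots> \<in> poly_fun coord_funs" by (intro poly_fun_coeff_sum sgn) simp
  finally show ?thesis .
qed

lemma cpform_mhom:
  "(cpform d :: ('a::alg_closed_field, 'n::finite, 'm::finite) coords \<Rightarrow> 'a) \<in> mhom (case_option d (\<lambda>_. 0))"
proof -
  have "cpform d (hscale b x) = (\<Prod>\<beta>\<in>UNIV. b \<beta> ^ case_option d (\<lambda>_. 0) \<beta>) * cpform d x"
    for b and x :: "('a, 'n, 'm) coords"
  proof -
    obtain M w where x: "x = (M, w)" by (cases x)
    \<comment> \<open>Scaling \<open>M\<close> substitutes a multiple of \<open>t\<close> for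
      \<open>t\<close>, which gives the degree of each coefficient.\<close>
    have "detpoly (mscale (b None) M) = pcompose (detpoly M) [:0, b None:]"
      by (rule poly_eq_cofinite) (simp add: poly_detpoly poly_pcompose mscale_mscale mult.commute)
    then show ?thesis
      by (simp add: x cpform_def hscale_def prod_option coeff_pcompose_linear)
  qed
  then show ?thesis using cpform_poly_fun unfolding mhom_iff by blast
qed

lemma matrix_add_right: "(A + B) ** C = A ** C + B ** C" for A B C :: "'a::field^'n::finite^'n"
  by (simp add: vec_eq_iff matrix_matrix_mult_def distrib_right sum.distrib)

lemma mscale_add_conj:
  assumes "A \<in> SL"
  shows "det (mat 1 + mscale t (A ** M ** matrix_inv A)) = det (mat 1 + mscale t M)"
proof -
  have "mat 1 + mscale t (A ** M ** matrix_inv A) = A ** (mat 1 + mscale t M) ** matrix_inv A"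
    by (simp add: matrix_add_ldistrib matrix_add_right mscale_matrix_mult SL_inv[OF assms])
  then show ?thesis using assms SL_inv(1)[OF assms] by (simp add: det_mul SL_def)
qed

lemma cpform_act:
  fixes x :: "('a::alg_closed_field, 'n::finite, 'm) coords"
  assumes "A \<in> SL" shows "cpform d (act A x) = cpform d x"
proof -
  obtain M w where x: "x = (M, w)" by (cases x)
  have "detpoly (A ** M ** matrix_inv A) = detpoly M"
    by (rule poly_eq_cofinite) (simp add: poly_detpoly mscale_add_conj[OF assms])
  then show ?thesis by (simp add: x act_def cpform_def)
qed

section \<open>Polynomials in \<open>M\<close> applied to a vector, and nilpotency\<close>

text \<open>The vector \<open>p(M) v\<close>, evaluated by Horner's scheme.\<close>

definition pkry :: "'a::field^'n::finite^'n \<Rightarrow> 'a^'n \<Rightarrow> 'a poly \<Rightarrow> 'a^'n" where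
  "pkry M v p = fold_coeffs (\<lambda>a u. a *s v + M *v u) p 0"

lemma pkry_0 [simp]: "pkry M v 0 = 0"
  by (simp add: pkry_def)

lemma pkry_pCons [simp]: "pkry M v (pCons a p) = a *s v + M *v pkry M v p"
  by (cases "p = 0 \<and> a = 0") (auto simp: pkry_def)

lemma pkry_add: "pkry M v (p + q) = pkry M v p + pkry M v q"
  by (induction p q rule: poly_induct2) (simp_all add: vec.scale_left_distrib matrix_vector_right_distrib)

lemma pkry_smult: "pkry M v (smult c p) = c *s pkry M v p"
  by (induction p) (simp_all add: vec.scale_right_distrib vector_scalar_commute)

lemma pkry_linear_factor: "pkry M v ([:- a, 1:] * p) = M *v pkry M v p - a *s pkry M v p"
proof -
  have "[:- a, 1:] * p = smult (- a) p + pCons 0 p" by simp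
  then show ?thesis by (simp only: pkry_add pkry_smult) simp
qed

lemma pkry_eq_sum: "pkry M v (\<Sum>a\<in>A. monom (c a) a) = (\<Sum>a\<in>A. c a *s kry M v a)" if "finite A"
proof -
  have "pkry M v (monom c a) = c *s kry M v a" for c a
    by (induction a) (simp_all add: monom_0 monom_Suc vector_scalar_commute)
  with that show ?thesis by (induction A rule: finite_induct) (simp_all add: pkry_add)
qed

text \<open>Linear factors are stripped off \<open>p\<close> until the remaining vector would become
  nonzero; that vector is an eigenvector. The nonzero constant term keeps all roots away from
  0.\<close>

lemma nonzero_eigenvalue:
  fixes M :: "'a::alg_closed_field^'n::finite^'n"
  assumes "p \<noteq> 0" "coeff p 0 \<noteq> 0" "pkry M v p = 0" "v \<noteq> 0"
  shows "\<exists>a u. a \<noteq> 0 \<and> u \<noteq> 0 \<and> M *v u = a *s u"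
  using assms(1-3)
proof (induction "degree p" arbitrary: p rule: less_induct)
  case less
  show ?case
  proof (cases "degree p = 0")
    case True
    then obtain c where "p = [:c:]" by (rule degree_eq_zeroE)
    then have "c *s v = 0" "c \<noteq> 0" using less.prems by auto
    then show ?thesis using assms(4) by simp
  next
    case False
    then obtain a where "poly p a = 0" using alg_closed_imp_poly_has_root[of p] by auto
    then obtain r where r: "p = [:- a, 1:] * r" using poly_eq_0_iff_dvd[of p a] by (auto elim: dvdE)
    have "poly p 0 = - a * poly r 0" by (simp add: r)
    then have nz: "a \<noteq> 0" "coeff r 0 \<noteq> 0" using less.prems(2) by (auto simp: poly_0_coeff_0)
    then have r0: "r \<noteq> 0" by auto
    show ?thesis
    proof (cases "pkry M v r = 0")
      case True
      have "degree p = Suc (degree r)" unfolding r using r0 by (subst degree_mult_eq) auto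
      then show ?thesis using less.hyps[of r] r0 nz True by simp
    next
      case False
      have "M *v pkry M v r = a *s pkry M v r"
        using less.prems(3) unfolding r pkry_linear_factor by simp
      then show ?thesis using nz(1) False by blast
    qed
  qed
qed

text \<open>The first linear dependence among \<open>v, M v, M\<^sup>2 v, \<dots>\<close> occurs within the first \<open>CARD('n) + 1\<close> of them.\<close>

lemma kry_in_span:
  fixes M :: "'a::field^'n::finite^'n"
  shows "\<exists>d\<le>CARD('n). kry M v d \<in> vec.span (kry M v ` {..<d})"
proof (rule ccontr)
  assume no: "\<not> ?thesis"
  have "vec.dim (kry M v ` {..<d}) = d" if "d \<le> CARD('n) + 1" for d
    using that
  proof (induction d)
    case (Suc d)
    have "kry M v d \<notin> vec.span (kry M v ` {..<d})" using no Suc.prems by auto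
    then show ?case using Suc by (simp add: lessThan_Suc vec.dim_insert)
  qed simp
  from this[of "CARD('n) + 1"] show False
    using dim_subset_UNIV_cart_gen[of "kry M v ` {..<CARD('n) + 1}"] by simp
qed

lemma kry_span_all:
  fixes M :: "'a::field^'n::finite^'n"
  shows "kry M v a \<in> vec.span (kry M v ` {..<CARD('n)})"
proof -
  obtain d where d: "d \<le> CARD('n)" "kry M v d \<in> vec.span (kry M v ` {..<d})"
    using kry_in_span by blast
  let ?S = "vec.span (kry M v ` {..<d})"
  have base: "kry M v c \<in> ?S" if "c \<le> d" for c
    using that d(2) by (cases "c = d") (auto intro: vec.span_base)
  have "M *v u \<in> ?S" if "u \<in> ?S" for u
    using that
  proof (induction rule: vec.span_induct_alt)
    case base then show ?case by (simp add: vec.span_zero)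
  next
    case (step c x y)
    then obtain k where k: "k < d" "x = kry M v k" by auto
    have "M *v x \<in> ?S" using base[of "Suc k"] k by simp
    then show ?case using step by (simp add: matrix_vector_right_distrib vector_scalar_commute vec.span_add vec.span_scale)
  qed
  then have "kry M v a \<in> ?S"
  proof (induction a)
    case 0 show ?case using base[of 0] by simp
  qed simp
  moreover have "?S \<subseteq> vec.span (kry M v ` {..<CARD('n)})" using d(1) by (intro vec.span_mono) auto
  ultimately show ?thesis by blast
qed

text \<open>If \<open>M\<close> is not nilpotent on \<open>v\<close>, it has a nonzero eigenvalue
  \<open>a\<close>. Then \<open>det (1 + t M)\<close> is 1 at 0 and vanishes at \<open>-1/a\<close>,
  so it is not constant.\<close>

lemma cpform_nonzero:
  fixes M :: "'a::alg_closed_field^'n::finite^'n" and w :: "'m::finite \<Rightarrow> 'a^'n"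
  assumes "kry M v CARD('n) \<noteq> 0"
  shows "\<exists>d\<ge>1. cpform d (M, w) \<noteq> 0"
proof -
  let ?v = "kry M v CARD('n)"
  have "\<exists>p. p \<noteq> 0 \<and> pkry M v p = 0 \<and> degree p \<le> CARD('n)"
  proof -
    obtain d where d: "d \<le> CARD('n)" "kry M v d \<in> vec.span (kry M v ` {..<d})"
      using kry_in_span by blast
    have "vec.span (kry M v ` {..<d}) \<subseteq> {u. \<exists>c. u = (\<Sum>a<d. c a *s kry M v a)}"
    proof (rule vec.span_minimal)
      show "kry M v ` {..<d} \<subseteq> {u. \<exists>c. u = (\<Sum>a<d. c a *s kry M v a)}"
      proof (rule image_subsetI, rule CollectI)
        fix a assume a: "a \<in> {..<d}"
        have "(if b = a then 1 else 0) *s kry M v b = (if b = a then kry M v a else 0)" for b by simp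
        then have "kry M v a = (\<Sum>b<d. (if b = a then 1 else 0) *s kry M v b)"
          using a by simp
        then show "\<exists>c. kry M v a = (\<Sum>a<d. c a *s kry M v a)"
          by (intro exI[of _ "\<lambda>b. if b = a then 1 else 0"])
      qed
      show "vec.subspace {u. \<exists>c. u = (\<Sum>a<d. c a *s kry M v a)}"
      proof (rule vec.subspaceI)
        show "0 \<in> {u. \<exists>c. u = (\<Sum>a<d. c a *s kry M v a)}" by (auto intro!: exI[of _ "\<lambda>_. 0"])
        fix x y assume "x \<in> {u. \<exists>c. u = (\<Sum>a<d. c a *s kry M v a)}" "y \<in> {u. \<exists>c. u = (\<Sum>a<d. c a *s kry M v a)}"
        then obtain c c' where "x = (\<Sum>a<d. c a *s kry M v a)" "y = (\<Sum>a<d. c' a *s kry M v a)" by blast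
        then have "x + y = (\<Sum>a<d. (c a + c' a) *s kry M v a)" by (simp add: sum.distrib vec.scale_left_distrib)
        then show "x + y \<in> {u. \<exists>c. u = (\<Sum>a<d. c a *s kry M v a)}" by (intro CollectI exI[of _ "\<lambda>a. c a + c' a"])
      next
        fix e x assume "x \<in> {u. \<exists>c. u = (\<Sum>a<d. c a *s kry M v a)}"
        then obtain c where "x = (\<Sum>a<d. c a *s kry M v a)" by blast
        then have "e *s x = (\<Sum>a<d. (e * c a) *s kry M v a)" by (simp add: vec.scale_sum_right)
        then show "e *s x \<in> {u. \<exists>c. u = (\<Sum>a<d. c a *s kry M v a)}" by (intro CollectI exI[of _ "\<lambda>a. e * c a"])
      qed
    qed
    then obtain c where c: "kry M v d = (\<Sum>a<d. c a *s kry M v a)" using d(2) by blast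
    define c' where "c' a = (if a = d then 1 else - c a)" for a
    define p where "p = (\<Sum>a\<in>{..<Suc d}. monom (c' a) a)"
    have "(\<Sum>a<d. c' a *s kry M v a) = (\<Sum>a<d. - (c a *s kry M v a))" by (intro sum.cong) (auto simp: c'_def)
    then have "(\<Sum>a\<in>{..<Suc d}. c' a *s kry M v a) = 0" by (simp add: c sum_negf c'_def)
    then have "pkry M v p = 0" unfolding p_def by (simp only: pkry_eq_sum finite_lessThan)
    moreover have "coeff p d = 1"
      by (simp add: p_def coeff_sum c'_def)
    moreover have "degree p \<le> CARD('n)"
      unfolding p_def using d(1) by (intro degree_sum_le) (auto intro: order_trans[OF degree_monom_le])
    ultimately show ?thesis by (metis coeff_0 zero_neq_one)
  qed
  then obtain p where p: "p \<noteq> 0" "pkry M v p = 0" "degree p \<le> CARD('n)" by blast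
  \<comment> \<open>Splitting off this power replaces \<open>v\<close> by \<open>M^r v\<close>,
    which is still nonzero because \<open>r \<le> CARD('n)\<close>, and leaves a polynomial with
    nonzero constant term.\<close>
  define r where "r = order 0 p"
  obtain p1 where p1: "p = [:0, 1:] ^ r * p1" "\<not> [:0, 1:] dvd p1"
    using order_decomp[OF p(1), of 0] unfolding r_def by auto
  have p1nz: "p1 \<noteq> 0" "coeff p1 0 \<noteq> 0" using p1(2) p(1) p1(1) by (auto simp: poly_0_coeff_0[symmetric] poly_eq_0_iff_dvd)
  have r: "r \<le> CARD('n)" using order_degree[OF p(1), of 0] p(3) by (simp add: r_def)
  have shift: "pkry M v ([:0, 1:] ^ k * s) = pkry M (kry M v k) s" for k s
  proof (induction k arbitrary: s)
    case (Suc k)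
    have "[:0, 1:] ^ Suc k * s = [:0, 1:] ^ k * pCons 0 s" by (simp add: mult.assoc[symmetric] mult.commute)
    then have "pkry M v ([:0, 1:] ^ Suc k * s) = M *v pkry M (kry M v k) s" using Suc by simp
    also have "\<dots> = pkry M (kry M v (Suc k)) s"
      by (induction s) (simp_all add: matrix_vector_right_distrib vector_scalar_commute)
    finally show ?case .
  qed simp
  have "kry M v r \<noteq> 0"
  proof
    assume z: "kry M v r = 0"
    have "kry M v (r + k) = 0" for k by (induction k) (simp_all add: z)
    from this[of "CARD('n) - r"] show False using assms r by simp
  qed
  then obtain a u where a: "a \<noteq> 0" "u \<noteq> 0" "M *v u = a *s u"
    using nonzero_eigenvalue[OF p1nz(1,2), of M "kry M v r"] p(2) unfolding p1(1) shift by auto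
  have "det (mat 1 + mscale (- 1 / a) M) = 0"
  proof (rule ccontr)
    assume d: "det (mat 1 + mscale (- 1 / a) M) \<noteq> 0"
    have "(mat 1 + mscale (- 1 / a) M) *v u = 0"
      using a by (simp add: matrix_vector_mult_add_rdistrib mscale_mult_vec)
    then have "matrix_inv (mat 1 + mscale (- 1 / a) M) *v ((mat 1 + mscale (- 1 / a) M) *v u) = 0" by simp
    then show False using a(2) unfolding matrix_vector_mul_assoc matrix_inv_det(2)[OF d] by simp
  qed
  then have "poly (detpoly M) (- 1 / a) = 0" by (simp add: poly_detpoly)
  moreover have "poly (detpoly M) 0 = 1"
  proof -
    have "mscale 0 M = 0" by (simp add: mscale_eq_0)
    then show ?thesis by (simp add: poly_detpoly)
  qed
  ultimately have "degree (detpoly M) \<noteq> 0" by (metis degree_eq_zeroE poly_pCons poly_0 mult_zero_right add_0_right zero_neq_one)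
  then have "coeff (detpoly M) (degree (detpoly M)) \<noteq> 0 \<and> degree (detpoly M) \<ge> 1"
    by (metis degree_0 leading_coeff_0_iff less_one not_le)
  then show ?thesis by (auto simp: cpform_def)
qed

section \<open>Chains of subspaces\<close>

text \<open>One relation for both cases, so that semistability and stability share the arguments
  below.\<close>

definition lt :: "bool \<Rightarrow> real \<Rightarrow> real \<Rightarrow> bool" where
  "lt strict a b = (if strict then a < b else a \<le> b)"

lemma lt_le: "lt strict a b \<Longrightarrow> a \<le> b"
  by (auto simp: lt_def split: if_splits)

lemma lt_mono: "lt strict a b \<Longrightarrow> a' \<le> a \<Longrightarrow> b \<le> b' \<Longrightarrow> lt strict a' b'"
  by (auto simp: lt_def split: if_splits)

lemma less_lt: "a < b \<Longrightarrow> lt strict a b"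
  by (auto simp: lt_def)

lemma lt_sum:
  assumes "finite I" "I \<noteq> {}" "\<And>i. i \<in> I \<Longrightarrow> lt strict (f i) c"
  shows "lt strict (\<Sum>i\<in>I. f i) (real (card I) * c)"
proof (cases strict)
  case True
  then have "(\<Sum>i\<in>I. f i) < (\<Sum>i\<in>I. c)" using assms by (intro sum_strict_mono) (auto simp: lt_def)
  then show ?thesis using True by (simp add: lt_def)
next
  case False
  then have "(\<Sum>i\<in>I. f i) \<le> (\<Sum>i\<in>I. c)" using assms by (intro sum_mono) (auto simp: lt_def)
  then show ?thesis using False by (simp add: lt_def)
qed

text \<open>What a single step contributes to the left side minus the right side of the flag
  inequality, apart from the correction term.\<close>

definition excess :: "('m::finite \<Rightarrow> 'a::field^'n::finite) \<Rightarrow> ('a^'n) set \<Rightarrow> real" where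
  "excess w H = real (card {i. w i \<in> H}) - real CARD('m) / real CARD('n) * real (vec.dim H)"

text \<open>Types I, II and III correspond to \<open>\<delta> = 0, 1, -1\<close>.\<close>

definition ftype :: "'a::field^'n::finite^'n \<Rightarrow> nat \<Rightarrow> (nat \<Rightarrow> ('a^'n) set) \<Rightarrow> int \<Rightarrow> bool" where
  "ftype M \<gamma> H \<delta> \<longleftrightarrow>
    \<delta> = 0 \<and> \<gamma> = 1 \<and> (*v) M ` H 1 \<subseteq> H 1 \<and> ((*v) M ` H 1 \<noteq> {0} \<or> \<not> range ((*v) M) \<subseteq> H 1) \<or>
    \<delta> = 1 \<and> (\<forall>t\<in>{1..\<gamma>}. (*v) M ` H t \<subseteq> H (t + 1) \<and> \<not> (*v) M ` H t \<subseteq> H t) \<or>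
    \<delta> = - 1 \<and> (\<forall>t\<in>{1..\<gamma> + 1}. (*v) M ` H t \<subseteq> H (t - 1) \<and> (t \<ge> 2 \<longrightarrow> \<not> (*v) M ` H t \<subseteq> H (t - 2)))"

lemma ftype_upI:
  assumes "\<And>t. t \<in> {1..\<gamma>} \<Longrightarrow> (*v) M ` H t \<subseteq> H (t + 1) \<and> \<not> (*v) M ` H t \<subseteq> H t"
  shows "ftype M \<gamma> H 1"
  unfolding ftype_def by (rule disjI2, rule disjI1, rule conjI[OF refl], rule ballI, rule assms)

lemma ftype_downI:
  assumes "\<And>t. t \<in> {1..\<gamma> + 1} \<Longrightarrow>
    (*v) M ` H t \<subseteq> H (t - 1) \<and> (t \<ge> 2 \<longrightarrow> \<not> (*v) M ` H t \<subseteq> H (t - 2))"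
  shows "ftype M \<gamma> H (- 1)"
  unfolding ftype_def by (rule disjI2, rule disjI2, rule conjI[OF refl], rule ballI, rule assms)

lemma sum_skip:
  fixes f :: "nat \<Rightarrow> 'b::comm_monoid_add"
  assumes "1 \<le> j" "j < k"
  shows "(\<Sum>i=1..<k. f i) = f j + (\<Sum>i=1..<k - 1. f (if i < j then i else i + 1))"
proof -
  have "(\<Sum>i=1..<k. f i) = f j + (\<Sum>i\<in>{1..<k} - {j}. f i)"
    using assms by (intro sum.remove) auto
  also have "(\<Sum>i\<in>{1..<k} - {j}. f i) = (\<Sum>i=1..<k - 1. f (if i < j then i else i + 1))"
    by (rule sum.reindex_bij_witness[of _ "\<lambda>i. if i < j then i else i + 1" "\<lambda>i. if i < j then i else i - 1"])
      (use assms in \<open>auto split: if_splits\<close>)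
  finally show ?thesis .
qed

locale flag_inequalities =
  fixes M :: "'a::field^'n::finite^'n" and w :: "'m::finite \<Rightarrow> 'a^'n" and q :: nat and strict :: bool
  assumes M0: "M \<noteq> 0" and w0: "\<And>i. w i \<noteq> 0" and q: "q > 0"
    and ineq: "\<And>\<gamma> H \<delta>. is_flag \<gamma> H \<Longrightarrow> ftype M \<gamma> H \<delta> \<Longrightarrow>
      lt strict (\<Sum>t=1..\<gamma>. excess w (H t)) (real_of_int \<delta> * real q)"
begin

lemma M_nonzero: "\<exists>v. M *v v \<noteq> 0"
proof (rule ccontr)
  assume "\<not> ?thesis"
  then have "M = 0" by (simp add: matrix_eq)
  then show False using M0 by simp
qed

text \<open>The flag with the single step \<open>H\<close> is of type I, unless \<open>M\<close>
  maps the whole space into \<open>H\<close> and \<open>H\<close> to zero. In that case it is of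
  type III, with the stronger bound \<open>- q\<close>.\<close>

lemma excess_proper:
  assumes H: "vec.subspace H" "H \<noteq> {0}" "H \<noteq> UNIV" and MH: "(*v) M ` H \<subseteq> H"
  shows "lt strict (excess w H) 0"
proof -
  define F where "F j = (if j = 0 then {0} else if j = 1 then H else UNIV)" for j :: nat
  have F: "F 0 = {0}" "F 1 = H" "F 2 = UNIV" by (simp_all add: F_def)
  have "0 \<in> H" using H(1) by (rule vec.subspace_0)
  then have "{0} \<subset> H" "H \<subset> UNIV" using H by auto
  then have flag: "is_flag 1 F"
    unfolding is_flag_def using F H(1) by (auto simp: F_def vec.subspace_single_0 vec.subspace_UNIV less_Suc_eq_le le_Suc_eq)
  show ?thesis
  proof (cases "(*v) M ` H \<noteq> {0} \<or> \<not> range ((*v) M) \<subseteq> H")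
    case True
    then have "ftype M 1 F 0" using MH by (simp add: ftype_def F_def)
    from ineq[OF flag this] show ?thesis by (simp add: F_def)
  next
    case False
    have "(*v) M ` F t \<subseteq> F (t - 1) \<and> (t \<ge> 2 \<longrightarrow> \<not> (*v) M ` F t \<subseteq> F (t - 2))" if "t \<in> {1..1 + 1}" for t
    proof -
      from that consider "t = 1" | "t = 2" by force
      then show ?thesis
      proof cases
        case 1 then show ?thesis using False by (simp add: F_def)
      next
        case 2
        have "\<not> range ((*v) M) \<subseteq> {0}" using M_nonzero by blast
        then show ?thesis using 2 False by (simp add: F_def)
      qed
    qed
    then have "ftype M 1 F (- 1)" by (rule ftype_downI)
    from ineq[OF flag this] show ?thesis using q by (auto simp: F_def intro: lt_mono)
  qed
qed

lemma excess_trivial: "excess w {0} = 0" "excess w UNIV = 0"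
proof -
  show "excess w {0} = 0" using w0 by (simp add: excess_def)
  show "excess w UNIV = 0" unfolding excess_def vec_dim_card by simp
qed

lemma excess_invariant:
  assumes "vec.subspace H" "(*v) M ` H \<subseteq> H" shows "excess w H \<le> 0"
  using excess_proper[OF assms(1) _ _ assms(2)] excess_trivial by (metis lt_le order_refl)

text \<open>A step invariant under \<open>M\<close> has nonpositive excess, so it can be deleted and
  the bound for the shorter chain suffices. Repeated steps are invariant as well. A nontrivial chain
  without invariant inner steps is a flag of type II.\<close>

lemma up_chain:
  fixes k :: nat
  assumes "k \<ge> 1" "C 0 = {0}" "C k = UNIV" "\<And>j. j \<le> k \<Longrightarrow> vec.subspace (C j)"
    "\<And>j. j < k \<Longrightarrow> C j \<subseteq> C (j + 1)" "\<And>j. j < k \<Longrightarrow> (*v) M ` C j \<subseteq> C (j + 1)"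
  shows "lt strict (\<Sum>j=1..<k. excess w (C j)) (real q)"
  using assms
proof (induction k arbitrary: C rule: less_induct)
  case (less k)
  note C = less.prems
  show ?case
  proof (cases "\<exists>j. 1 \<le> j \<and> j < k \<and> (*v) M ` C j \<subseteq> C j")
    case True
    then obtain j where j: "1 \<le> j" "j < k" "(*v) M ` C j \<subseteq> C j" by blast
    define C' where "C' i = C (if i < j then i else i + 1)" for i
    have mono2: "C i \<subseteq> C (i + 2)" "(*v) M ` C i \<subseteq> C (i + 2)" if "i + 1 < k" for i
      using C(5)[of i] C(5)[of "i + 1"] C(6)[of i] that by auto
    have "lt strict (\<Sum>j=1..<k - 1. excess w (C' j)) (real q)"
    proof (rule less.IH)
      show "k - 1 < k" "1 \<le> k - 1" using j by auto
      show "C' 0 = {0}" using j C(2) by (simp add: C'_def)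
      show "C' (k - 1) = UNIV" using j C(3) by (auto simp: C'_def)
      show "vec.subspace (C' i)" if "i \<le> k - 1" for i using C(4) that j by (auto simp: C'_def)
      fix i assume i: "i < k - 1"
      consider "i + 1 < j" | "i + 1 = j" | "i \<ge> j" by linarith
      then have "C' i \<subseteq> C' (i + 1) \<and> (*v) M ` C' i \<subseteq> C' (i + 1)"
      proof cases
        case 1 then show ?thesis using C(5)[of i] C(6)[of i] i by (simp add: C'_def)
      next
        case 2 then show ?thesis using mono2[of i] i by (simp add: C'_def)
      next
        case 3 then show ?thesis using C(5)[of "i + 1"] C(6)[of "i + 1"] i by (simp add: C'_def)
      qed
      then show "C' i \<subseteq> C' (i + 1)" "(*v) M ` C' i \<subseteq> C' (i + 1)" by auto
    qed
    moreover have "excess w (C j) \<le> 0" using j C(4)[of j] by (intro excess_invariant) auto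
    moreover have "(\<Sum>i=1..<k. excess w (C i)) = excess w (C j) + (\<Sum>i=1..<k - 1. excess w (C' i))"
      unfolding C'_def by (rule sum_skip[OF j(1,2)])
    ultimately show ?thesis by (auto intro: lt_mono)
  next
    case False
    show ?thesis
    proof (cases "k = 1")
      \<comment> \<open>Without inner steps the sum is 0, which is less than
        \<open>q\<close>.\<close>
      case True then show ?thesis using q by (simp add: less_lt)
    next
      case False': False
      then have k: "k \<ge> 2" using C(1) by simp
      have st: "C j \<subset> C (j + 1)" if "j < k" for j
      proof -
        have "C j \<noteq> C (j + 1)"
        proof
          assume eq: "C j = C (j + 1)"
          show False
          proof (cases "j = 0")
            case True
            then have "C 1 = {0}" using eq C(2) by simp
            then have "(*v) M ` C 1 \<subseteq> C 1" by simp
            then show False using False k by auto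
          next
            case False2: False
            then have "(*v) M ` C j \<subseteq> C j" using C(6)[OF that] eq by simp
            then show False using False that False2 by auto
          qed
        qed
        then show ?thesis using C(5)[OF that] by blast
      qed
      have k1: "k - 1 + 1 = k" using k by simp
      have flag: "is_flag (k - 1) C"
        unfolding is_flag_def k1 using C(2,3,4) k st by auto
      have "(*v) M ` C t \<subseteq> C (t + 1) \<and> \<not> (*v) M ` C t \<subseteq> C t" if "t \<in> {1..k - 1}" for t
      proof -
        have t: "1 \<le> t" "t < k" using that k by auto
        then show ?thesis using False C(6)[OF t(2)] by blast
      qed
      then have "ftype M (k - 1) C 1" by (rule ftype_upI)
      from ineq[OF flag this] have "lt strict (\<Sum>t=1..k - 1. excess w (C t)) (real q)" by simp
      moreover have "{1..k - 1} = {1..<k}" using k by auto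
      ultimately show ?thesis by simp
    qed
  qed
qed

text \<open>Every step is invariant and so has nonpositive excess; step \<open>j\<close> may be
  deleted when \<open>M\<close> maps its successor into its predecessor, as the chain then still
  descends. If no step can be deleted, the chain is a flag of type III. It has inner steps because
  \<open>M \<noteq> 0\<close>.\<close>

lemma down_chain:
  fixes k :: nat
  assumes "k \<ge> 1" "C 0 = {0}" "C k = UNIV" "\<And>j. j \<le> k \<Longrightarrow> vec.subspace (C j)"
    "\<And>j. j < k \<Longrightarrow> C j \<subseteq> C (j + 1)" "\<And>j. j < k \<Longrightarrow> (*v) M ` C (j + 1) \<subseteq> C j"
  shows "lt strict (\<Sum>j=1..<k. excess w (C j)) (- real q)"
  using assms
proof (induction k arbitrary: C rule: less_induct)
  case (less k)
  note C = less.prems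
  show ?case
  proof (cases "\<exists>j. 1 \<le> j \<and> j < k \<and> (*v) M ` C (j + 1) \<subseteq> C (j - 1)")
    case True
    then obtain j where j: "1 \<le> j" "j < k" "(*v) M ` C (j + 1) \<subseteq> C (j - 1)" by blast
    define C' where "C' i = C (if i < j then i else i + 1)" for i
    have "lt strict (\<Sum>j=1..<k - 1. excess w (C' j)) (- real q)"
    proof (rule less.IH)
      show "k - 1 < k" "1 \<le> k - 1" using j by auto
      show "C' 0 = {0}" using j C(2) by (simp add: C'_def)
      show "C' (k - 1) = UNIV" using j C(3) by (auto simp: C'_def)
      show "vec.subspace (C' i)" if "i \<le> k - 1" for i using C(4) that j by (auto simp: C'_def)
      fix i assume i: "i < k - 1"
      consider "i + 1 < j" | "i + 1 = j" | "i \<ge> j" by linarith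
      then have "C' i \<subseteq> C' (i + 1) \<and> (*v) M ` C' (i + 1) \<subseteq> C' i"
      proof cases
        case 1 then show ?thesis using C(5)[of i] C(6)[of i] i by (simp add: C'_def)
      next
        case 2
        have ik: "i < k" "i + 1 < k" using i by auto
        have "C i \<subseteq> C (i + 2)" using C(5)[OF ik(1)] C(5)[OF ik(2)] by simp
        moreover have "j - 1 = i" "j + 1 = i + 2" using 2 by auto
        ultimately show ?thesis using 2 j(3) by (simp add: C'_def)
      next
        case 3 then show ?thesis using C(5)[of "i + 1"] C(6)[of "i + 1"] i by (simp add: C'_def)
      qed
      then show "C' i \<subseteq> C' (i + 1)" "(*v) M ` C' (i + 1) \<subseteq> C' i" by auto
    qed
    moreover have "excess w (C j) \<le> 0"
    proof (rule excess_invariant)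
      show "vec.subspace (C j)" using C(4)[of j] j by simp
      have "C (j - 1) \<subseteq> C j" using C(5)[of "j - 1"] j by simp
      moreover have "(*v) M ` C j \<subseteq> C (j - 1)" using C(6)[of "j - 1"] j by simp
      ultimately show "(*v) M ` C j \<subseteq> C j" by blast
    qed
    moreover have "(\<Sum>i=1..<k. excess w (C i)) = excess w (C j) + (\<Sum>i=1..<k - 1. excess w (C' i))"
      unfolding C'_def by (rule sum_skip[OF j(1,2)])
    ultimately show ?thesis by (auto intro: lt_mono)
  next
    case False
    have "k \<noteq> 1"
    proof
      assume "k = 1"
      then have "range ((*v) M) \<subseteq> {0}" using C(6)[of 0] C(2,3) by simp
      then show False using M_nonzero by auto
    qed
    then have k: "k \<ge> 2" using C(1) by simp
    have st: "C j \<subset> C (j + 1)" if "j < k" for j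
    proof -
      have "C j \<noteq> C (j + 1)"
      proof
        assume eq: "C j = C (j + 1)"
        show False
        proof (cases "j = 0")
          case True
          have "(*v) M ` C (1 + 1) \<subseteq> C 1" using C(6)[of 1] k by simp
          then have "(*v) M ` C (1 + 1) \<subseteq> C (1 - 1)" using eq True by simp
          moreover have "1 < k" using k by simp
          ultimately show False using False by blast
        next
          case False2: False
          have "(*v) M ` C j \<subseteq> C (j - 1)" using C(6)[of "j - 1"] False2 that by simp
          then have "(*v) M ` C (j + 1) \<subseteq> C (j - 1)" using eq by simp
          then show False using False that False2 by auto
        qed
      qed
      then show ?thesis using C(5)[OF that] by blast
    qed
    have k1: "k - 1 + 1 = k" using k by simp
    have flag: "is_flag (k - 1) C"
      unfolding is_flag_def k1 using C(2,3,4) k st by auto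
    have "(*v) M ` C t \<subseteq> C (t - 1) \<and> (t \<ge> 2 \<longrightarrow> \<not> (*v) M ` C t \<subseteq> C (t - 2))" if t: "t \<in> {1..k - 1 + 1}" for t
    proof -
      have t': "t - 1 < k" "t - 1 + 1 = t" using t k1 by auto
      have "(*v) M ` C t \<subseteq> C (t - 1)" using C(6)[OF t'(1)] unfolding t'(2) .
      moreover have "\<not> (*v) M ` C t \<subseteq> C (t - 2)" if t2: "t \<ge> 2"
      proof -
        have "1 \<le> t - 1" "t - 1 < k" "t - 1 + 1 = t" "t - 1 - 1 = t - 2" using t t2 k1 by auto
        then have "\<not> (*v) M ` C (t - 1 + 1) \<subseteq> C (t - 1 - 1)" using False by blast
        then show ?thesis unfolding \<open>t - 1 + 1 = t\<close> \<open>t - 1 - 1 = t - 2\<close> .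
      qed
      ultimately show ?thesis by blast
    qed
    then have "ftype M (k - 1) C (- 1)" by (rule ftype_downI)
    from ineq[OF flag this] have "lt strict (\<Sum>t=1..k - 1. excess w (C t)) (- real q)" by simp
    moreover have "{1..k - 1} = {1..<k}" using k by auto
    ultimately show ?thesis by simp
  qed
qed

end

section \<open>Weight filtrations\<close>

text \<open>Sorts the levels by residue modulo \<open>a\<close>. If \<open>M\<close> shifts weights
  by \<open>z\<close> and \<open>a\<close> is |z|, each residue class is a chain that
  \<open>M\<close> moves by one step.\<close>

lemma sum_residues:
  fixes f :: "int \<Rightarrow> real" and R :: nat
  assumes "a > 0"
  shows "(\<Sum>t\<in>{- (a * int R)..<a * int R}. f t) =
    (\<Sum>r\<in>{0..<a}. \<Sum>j\<in>{1..<2 * R + 1}. f (- (a * int R) + r + a * (int j - 1)))"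
proof -
  have "(\<Sum>t\<in>{- (a * int R)..<a * int R}. f t) =
      (\<Sum>(r, j)\<in>{0..<a} \<times> {1..<2 * R + 1}. f (- (a * int R) + r + a * (int j - 1)))"
  proof (rule sum.reindex_bij_witness[of _ "\<lambda>(r, j). - (a * int R) + r + a * (int j - 1)"
        "\<lambda>t. ((t + a * int R) mod a, nat ((t + a * int R) div a) + 1)"])
    fix t assume t: "t \<in> {- (a * int R)..<a * int R}"
    have d0: "(t + a * int R) div a \<ge> 0" using t assms by (intro pos_imp_zdiv_nonneg_iff[THEN iffD2]) auto
    have "a * ((t + a * int R) div a) \<le> t + a * int R"
      using mod_mult_div_eq[of "t + a * int R" a] pos_mod_sign[OF assms, of "t + a * int R"] by linarith
    also have "\<dots> < a * (2 * int R)" using t by auto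
    finally have d1: "(t + a * int R) div a < 2 * int R"
      unfolding mult_less_cancel_left_pos[OF assms] .
    show "((t + a * int R) mod a, nat ((t + a * int R) div a) + 1) \<in> {0..<a} \<times> {1..<2 * R + 1}"
      using d0 d1 assms by auto
    have "- (a * int R) + (t + a * int R) mod a + a * ((t + a * int R) div a) = t"
      using mod_mult_div_eq[of "t + a * int R" a] by linarith
    then show eq: "(case ((t + a * int R) mod a, nat ((t + a * int R) div a) + 1) of (r, j) \<Rightarrow> - (a * int R) + r + a * (int j - 1)) = t"
      using d0 by simp
    then show "(case ((t + a * int R) mod a, nat ((t + a * int R) div a) + 1) of (r, j) \<Rightarrow> f (- (a * int R) + r + a * (int j - 1))) = f t"
      by (simp only: prod.case)
  next
    fix b assume "b \<in> {0..<a} \<times> {1..<2 * R + 1}"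
    then obtain r j where b: "b = (r, j)" "0 \<le> r" "r < a" "1 \<le> j" "j < 2 * R + 1" by auto
    let ?t = "- (a * int R) + r + a * (int j - 1)"
    have "?t + a * int R = r + a * (int j - 1)" by simp
    then have "(?t + a * int R) mod a = r" "(?t + a * int R) div a = int j - 1" using b assms by auto
    then show "(((case b of (r, j) \<Rightarrow> - (a * int R) + r + a * (int j - 1)) + a * int R) mod a,
       nat (((case b of (r, j) \<Rightarrow> - (a * int R) + r + a * (int j - 1)) + a * int R) div a) + 1) = b"
      unfolding b(1) prod.case using b(4) by (simp only: nat_minus_as_int) simp
    have "a * (int j - 1) \<ge> 0" using b assms by simp
    moreover have "a * (int j - 1) \<le> a * (2 * int R - 1)" using b assms by (intro mult_left_mono) auto
    moreover have "a * (2 * int R - 1) = 2 * (a * int R) - a" by (simp add: algebra_simps)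
    ultimately have "?t \<ge> - (a * int R)" "?t < a * int R" using b(2,3) by linarith+
    then show "(case b of (r, j) \<Rightarrow> - (a * int R) + r + a * (int j - 1)) \<in> {- (a * int R)..<a * int R}"
      using b by simp
  qed
  then show ?thesis unfolding sum.cartesian_product .
qed

text \<open>The count of pairs as in \<open>sum_card_levels\<close>, now for integral weights in a
  symmetric range.\<close>

lemma sum_card_levels_int:
  fixes f :: "'i::finite \<Rightarrow> int"
  assumes "\<And>i. - T \<le> f i \<and> f i \<le> T"
  shows "(\<Sum>i\<in>UNIV. f i) = int CARD('i) * T - (\<Sum>t\<in>{- T..<T}. int (card {i. f i \<le> t}))"
proof -
  have "(\<Sum>t\<in>{- T..<T}. int (card {i. f i \<le> t})) = (\<Sum>t\<in>{- T..<T}. \<Sum>i\<in>UNIV. if f i \<le> t then 1 else 0)"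
    by (intro sum.cong) (simp_all add: sum.If_cases)
  also have "\<dots> = (\<Sum>i\<in>UNIV. \<Sum>t\<in>{- T..<T}. if f i \<le> t then 1 else 0)" by (rule sum.swap)
  also have "\<dots> = (\<Sum>i\<in>UNIV. T - f i)"
  proof (intro sum.cong refl)
    fix i
    have "(\<Sum>t\<in>{- T..<T}. if f i \<le> t then 1 else 0) = int (card ({- T..<T} \<inter> {t. f i \<le> t}))"
      by (simp add: sum.If_cases)
    also have "{- T..<T} \<inter> {t. f i \<le> t} = {f i..<T}" using assms[of i] by auto
    finally show "(\<Sum>t\<in>{- T..<T}. if f i \<le> t then 1 else 0) = T - f i" using assms[of i] by simp
  qed
  also have "\<dots> = int CARD('i) * T - (\<Sum>i\<in>UNIV. f i)" by (simp add: sum_subtractf)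
  finally show ?thesis by simp
qed

lemma mult_span:
  assumes "\<And>x. x \<in> A \<Longrightarrow> M *v x \<in> S" "vec.subspace S" "x \<in> vec.span A"
  shows "M *v x \<in> S"
  using assms(3)
proof (induction rule: vec.span_induct_alt)
  case base then show ?case using assms(2) by (simp add: vec.subspace_0)
next
  case (step c x y)
  then show ?case using assms(1,2)
    by (simp add: matrix_vector_right_distrib vector_scalar_commute vec.subspace_add vec.subspace_scale)
qed

context flag_inequalities
begin

text \<open>Otherwise the span is a proper invariant subspace containing all marked vectors, and its
  excess is positive.\<close>

lemma krylov_spans:
  "vec.span ((\<lambda>e. kry M (w (fst e)) (snd e)) ` {e. snd e < CARD('n)}) = UNIV" (is "vec.span (?X ` ?I) = UNIV")
proof (rule ccontr)
  let ?S = "vec.span (?X ` ?I)"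
  assume nU: "?S \<noteq> UNIV"
  have kr: "kry M (w i) a \<in> ?S" for i a
  proof -
    have "kry M (w i) ` {..<CARD('n)} \<subseteq> ?X ` ?I" by (auto intro!: rev_image_eqI[of "(i, _)"])
    then show ?thesis using kry_span_all[of M "w i" a] vec.span_mono by blast
  qed
  have "M *v x \<in> ?S" if "x \<in> ?S" for x
  proof (rule mult_span[OF _ vec.subspace_span that])
    fix x assume "x \<in> ?X ` ?I"
    then obtain e where "x = ?X e" by blast
    then have "M *v x = kry M (w (fst e)) (Suc (snd e))" by simp
    then show "M *v x \<in> ?S" by (simp only: kr)
  qed
  then have "excess w ?S \<le> 0" by (intro excess_invariant vec.subspace_span) blast
  moreover have "{i. w i \<in> ?S} = UNIV" using kr[of _ 0] by simp
  moreover have "vec.dim ?S < CARD('n)"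
  proof -
    have "?S \<subset> UNIV" using nU by blast
    then have "vec.span ?S \<subset> vec.span UNIV" by (simp only: vec.span_span vec.span_UNIV)
    then have "vec.dim ?S < vec.dim (UNIV :: ('a^'n) set)" by (rule vec.dim_psubset)
    then show ?thesis unfolding vec_dim_card .
  qed
  ultimately have "real CARD('m) \<le> real CARD('m) / real CARD('n) * real (vec.dim ?S)"
    unfolding excess_def by simp
  also have "\<dots> < real CARD('m) / real CARD('n) * real CARD('n)"
    using \<open>vec.dim ?S < CARD('n)\<close> by (intro mult_strict_left_mono) auto
  finally show False by simp
qed

text \<open>A functional on multidegrees gives \<open>M^a w_i\<close> the weight
  \<open>y i + z * a\<close>, and \<open>M\<close> maps weight at most \<open>t\<close> to weight at
  most \<open>t + z\<close>. For a greedy basis of Krylov vectors, \<open>pos\<close> bounds the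
  dimensions of this filtration from above; the flag inequalities then bound the number of marked
  vectors in its steps, hence the sum of the \<open>y i\<close> from below.\<close>

lemma weight_functional:
  fixes y :: "'m \<Rightarrow> int" and z :: int
  assumes nil: "z \<ge> 0 \<or> (\<forall>i. kry M (w i) CARD('n) = 0)"
    and pos: "\<And>B. (\<And>j. snd (B j) < CARD('n)) \<Longrightarrow> dform B (M, w) \<noteq> 0 \<Longrightarrow>
      0 \<le> (\<Sum>j\<in>(UNIV :: 'n set). y (fst (B j)) + z * int (snd (B j)))"
  shows "0 \<le> (\<Sum>i\<in>UNIV. y i) + z * int q"
    and "strict \<Longrightarrow> z \<noteq> 0 \<or> (\<exists>i. y i \<noteq> 0) \<Longrightarrow> 0 < (\<Sum>i\<in>UNIV. y i) + z * int q"
proof -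
  define I where "I = {e :: 'm \<times> nat. snd e < CARD('n)}"
  define X where "X e = kry M (w (fst e)) (snd e)" for e :: "'m \<times> nat"
  define wt where "wt e = y (fst e) + z * int (snd e)" for e :: "'m \<times> nat"
  define F where "F t = vec.span (X ` {e \<in> I. wt e \<le> t})" for t
  \<comment> \<open>Exceeds the absolute value of every weight, so the filtration is zero below
    \<open>- R\<close> and full from \<open>R\<close> on.\<close>
  define R where "R = Suc (nat ((\<Sum>i\<in>UNIV. \<bar>y i\<bar>) + \<bar>z\<bar> * int CARD('n)))"
  \<comment> \<open>A multiple of |z| when \<open>z \<noteq> 0\<close>, so that the range of levels
    splits evenly into residue classes.\<close>
  define T where "T = (if z = 0 then int R else \<bar>z\<bar> * int R)"
  have wt_bound: "\<bar>wt e\<bar> < int R" if "e \<in> I" for e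
  proof -
    have "\<bar>y (fst e)\<bar> \<le> (\<Sum>i\<in>UNIV. \<bar>y i\<bar>)" by (rule member_le_sum) auto
    moreover have "\<bar>z * int (snd e)\<bar> \<le> \<bar>z\<bar> * int CARD('n)"
      using that by (simp add: abs_mult I_def mult_left_mono)
    moreover have "int R = (\<Sum>i\<in>UNIV. \<bar>y i\<bar>) + \<bar>z\<bar> * int CARD('n) + 1"
      unfolding R_def by (simp add: sum_nonneg)
    ultimately show ?thesis unfolding wt_def by linarith
  qed
  have RT: "int R \<le> T"
  proof (cases "z = 0")
    case False
    then have "1 * int R \<le> \<bar>z\<bar> * int R" by (intro mult_right_mono) auto
    then show ?thesis using False by (simp add: T_def)
  qed (simp add: T_def)
  have F_sub: "vec.subspace (F t)" for t unfolding F_def by (rule vec.subspace_span)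
  have F_mono: "F t \<subseteq> F t'" if "t \<le> t'" for t t'
    unfolding F_def by (intro vec.span_mono image_mono) (use that in auto)
  have X_F: "X e \<in> F t" if "e \<in> I" "wt e \<le> t" for e t
    unfolding F_def by (rule vec.span_base) (use that in blast)
  have spans: "vec.span (X ` I) = UNIV" using krylov_spans unfolding X_def[abs_def] I_def .
  have F_bot: "F t = {0}" if "t < - int R" for t
  proof -
    have "\<not> wt e \<le> t" if "e \<in> I" for e using wt_bound[OF that] \<open>t < - int R\<close> by linarith
    then have e: "{e \<in> I. wt e \<le> t} = {}" by blast
    show ?thesis unfolding F_def e by simp
  qed
  have F_top: "F t = UNIV" if "t \<ge> int R" for t
  proof -
    have "wt e \<le> t" if "e \<in> I" for e using wt_bound[OF that] \<open>t \<ge> int R\<close> by linarith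
    then have e: "{e \<in> I. wt e \<le> t} = I" by blast
    show ?thesis unfolding F_def e by (rule spans)
  qed
  have MF: "(*v) M ` F t \<subseteq> F (t + z)" for t
  proof (rule image_subsetI)
    fix x assume "x \<in> F t"
    then show "M *v x \<in> F (t + z)" unfolding F_def[of t]
    proof (rule mult_span[OF _ F_sub, rotated])
      fix x assume "x \<in> X ` {e \<in> I. wt e \<le> t}"
      then obtain i a where e: "x = X (i, a)" "a < CARD('n)" "wt (i, a) \<le> t" by (auto simp: I_def)
      have Mx: "M *v x = kry M (w i) (Suc a)" by (simp add: e(1) X_def)
      show "M *v x \<in> F (t + z)"
      proof (cases "Suc a < CARD('n)")
        case True
        have "X (i, Suc a) \<in> F (t + z)"
          by (rule X_F) (use True e(3) in \<open>simp_all add: I_def wt_def algebra_simps\<close>)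
        then show ?thesis by (simp add: Mx X_def)
      next
        case False
        then have a: "Suc a = CARD('n)" using e(2) by simp
        \<comment> \<open>The power \<open>M^CARD('n) w_i\<close> is not one of the weighted
          vectors. For \<open>z \<ge> 0\<close> it lies in the span of the lower powers, whose
          weights do not exceed \<open>t + z\<close>; for \<open>z < 0\<close> it is zero by
          \<open>nil\<close>.\<close>
        show ?thesis
        proof (cases "z \<ge> 0")
          case True
          have "kry M (w i) ` {..<CARD('n)} \<subseteq> F (t + z)"
          proof (rule image_subsetI)
            fix a' assume a': "a' \<in> {..<CARD('n)}"
            then have "z * int a' \<le> z * int a" using True a by (intro mult_left_mono) auto
            then have "wt (i, a') \<le> t + z" using e(3) True by (simp add: wt_def)
            then have "X (i, a') \<in> F (t + z)" using a' by (intro X_F) (simp_all add: I_def)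
            then show "kry M (w i) a' \<in> F (t + z)" by (simp add: X_def)
          qed
          then have "vec.span (kry M (w i) ` {..<CARD('n)}) \<subseteq> F (t + z)" by (rule vec.span_minimal[OF _ F_sub])
          then show ?thesis unfolding Mx using kry_span_all by blast
        next
          case False
          then have "kry M (w i) CARD('n) = 0" using nil by blast
          then have "M *v x = 0" using Mx a by simp
          then show ?thesis using F_sub by (simp add: vec.subspace_0)
        qed
      qed
    qed
  qed
  obtain b0 :: "'n \<Rightarrow> 'a^'n" where b0: "\<And>j. b0 j \<in> X ` I" "tdet b0 \<noteq> 0"
    by (rule basis_tuple[OF spans], rule that, assumption+)
  have "\<forall>j. \<exists>e. e \<in> I \<and> X e = b0 j" using b0(1) by (metis imageE)
  from choice[OF this] obtain B0 where B0: "\<And>j. B0 j \<in> I" "\<And>j. X (B0 j) = b0 j" by blast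
  have "tdet (\<lambda>j. X (B0 j)) \<noteq> 0" using b0(2) by (simp add: B0(2))
  \<comment> \<open>Adding \<open>R\<close> makes the weights nonnegative, so that
    \<open>nat\<close> preserves their order.\<close>
  then obtain B where B: "\<And>j. B j \<in> I" "tdet (\<lambda>j. X (B j)) \<noteq> 0"
    "\<And>e. e \<in> I \<Longrightarrow> X e \<in> vec.span ((\<lambda>j. X (B j)) ` {j. nat (wt (B j) + int R) \<le> nat (wt e + int R)})"
    using greedy_basis[where ?B0.0 = B0 and I = I and X = X and w = "\<lambda>e. nat (wt e + int R)", OF B0(1)] by blast
  have F_B: "F t = vec.span ((\<lambda>j. X (B j)) ` {j. wt (B j) \<le> t})" for t
  proof
    show "vec.span ((\<lambda>j. X (B j)) ` {j. wt (B j) \<le> t}) \<subseteq> F t"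
      by (rule vec.span_minimal[OF _ F_sub], rule image_subsetI, rule X_F) (use B(1) in simp_all)
    show "F t \<subseteq> vec.span ((\<lambda>j. X (B j)) ` {j. wt (B j) \<le> t})"
      unfolding F_def
    proof (rule vec.span_minimal[OF _ vec.subspace_span], rule image_subsetI)
      fix e assume e: "e \<in> {e \<in> I. wt e \<le> t}"
      have "{j. nat (wt (B j) + int R) \<le> nat (wt e + int R)} \<subseteq> {j. wt (B j) \<le> t}"
      proof
        fix j assume "j \<in> {j. nat (wt (B j) + int R) \<le> nat (wt e + int R)}"
        then show "j \<in> {j. wt (B j) \<le> t}" using wt_bound[OF B(1)[of j]] wt_bound[of e] e by auto
      qed
      then show "X e \<in> vec.span ((\<lambda>j. X (B j)) ` {j. wt (B j) \<le> t})"
        using B(3)[of e] e vec.span_mono[OF image_mono] by blast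
    qed
  qed
  have dimF: "vec.dim (F t) = card {j. wt (B j) \<le> t}" for t
    unfolding F_B by (rule dim_span_tuple[OF B(2)])
  have posB: "0 \<le> (\<Sum>j\<in>UNIV. wt (B j))"
  proof -
    have "0 \<le> (\<Sum>j\<in>(UNIV :: 'n set). y (fst (B j)) + z * int (snd (B j)))"
    proof (rule pos)
      show "snd (B j) < CARD('n)" for j using B(1)[of j] by (simp add: I_def)
      show "dform B (M, w) \<noteq> 0" using B(2) by (simp add: dform_def X_def)
    qed
    then show ?thesis by (simp add: wt_def)
  qed
  have yI: "(i, 0) \<in> I" "wt (i, 0) = y i" for i by (simp_all add: I_def wt_def)
  have wF: "w i \<in> F t" if "y i \<le> t" for i t
    using X_F[OF yI(1)[of i], of t] that by (simp add: yI(2) X_def)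
  have bounds: "- T \<le> wt e \<and> wt e \<le> T" if "e \<in> I" for e
    using wt_bound[OF that] RT by linarith
  define A where "A = (\<Sum>t\<in>{- T..<T}. int (card {i. w i \<in> F t}))"
  define D where "D = (\<Sum>t\<in>{- T..<T}. int (vec.dim (F t)))"
  define G where "G = (\<Sum>t\<in>{- T..<T}. excess w (F t))"
  have sumB: "(\<Sum>j\<in>UNIV. wt (B j)) = int CARD('n) * T - D"
    unfolding D_def dimF by (rule sum_card_levels_int) (rule bounds[OF B(1)])
  \<comment> \<open>Only an inequality, since \<open>w i\<close> may lie in steps of the filtration
    below its own weight.\<close>
  have sumy: "(\<Sum>i\<in>UNIV. y i) \<ge> int CARD('m) * T - A"
  proof -
    have "(\<Sum>i\<in>UNIV. y i) = int CARD('m) * T - (\<Sum>t\<in>{- T..<T}. int (card {i. y i \<le> t}))"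
      by (rule sum_card_levels_int) (use bounds[OF yI(1)] in \<open>simp add: yI(2)\<close>)
    moreover have "(\<Sum>t\<in>{- T..<T}. int (card {i. y i \<le> t})) \<le> A"
      unfolding A_def by (intro sum_mono) (use wF in \<open>auto intro!: card_mono\<close>)
    ultimately show ?thesis by linarith
  qed
  have G_eq: "G = real_of_int A - real CARD('m) / real CARD('n) * real_of_int D"
    unfolding G_def A_def D_def excess_def by (simp add: sum_subtractf sum_distrib_left)
  \<comment> \<open>The value at the degree of \<open>L\<close> exceeds or equals a positive
    multiple of the total weight of the basis plus the slack in the flag inequalities.\<close>
  have total: "real_of_int ((\<Sum>i\<in>UNIV. y i) + z * int q)
     \<ge> real CARD('m) / real CARD('n) * real_of_int (\<Sum>j\<in>UNIV. wt (B j)) + (real_of_int z * real q - G)"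
  proof -
    have "real CARD('m) / real CARD('n) * real_of_int (\<Sum>j\<in>UNIV. wt (B j))
       = real CARD('m) * real_of_int T - real CARD('m) / real CARD('n) * real_of_int D"
      unfolding sumB by (simp add: right_diff_distrib)
    moreover have "real_of_int (\<Sum>i\<in>UNIV. y i) \<ge> real CARD('m) * real_of_int T - real_of_int A"
    proof -
      have "real_of_int (int CARD('m) * T - A) \<le> real_of_int (\<Sum>i\<in>UNIV. y i)" using sumy by (simp only: of_int_le_iff)
      then show ?thesis by simp
    qed
    ultimately show ?thesis unfolding G_eq by simp
  qed
  have chains: "lt strict G (real_of_int z * real q)" if z: "z \<noteq> 0"
  proof -
    define a where "a = \<bar>z\<bar>"
    have a: "a > 0" "T = a * int R" using z by (simp_all add: a_def T_def)
    have aR: "a * int R \<ge> int R" using RT a(2) by simp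
    \<comment> \<open>The offset \<open>int j - 1\<close> places index 0 just below the range of
      levels, where the filtration is still zero.\<close>
    define C where "C r j = F (- (a * int R) + r + a * (int j - 1))" for r and j :: nat
    have "lt strict (\<Sum>j\<in>{1..<2 * R + 1}. excess w (C r j)) (sgn (real_of_int z) * real q)" if r: "r \<in> {0..<a}" for r
    proof -
      have c0: "C r 0 = {0}" unfolding C_def using r aR by (intro F_bot) auto
      have ck: "C r (2 * R + 1) = UNIV" unfolding C_def
      proof (rule F_top)
        have "- (a * int R) + r + a * (int (2 * R + 1) - 1) = a * int R + r" by (simp add: algebra_simps)
        then show "int R \<le> - (a * int R) + r + a * (int (2 * R + 1) - 1)" using aR r by simp
      qed
      have cs: "vec.subspace (C r j)" for j unfolding C_def by (rule F_sub)
      have cm: "C r j \<subseteq> C r (j + 1)" for j unfolding C_def using a(1) by (intro F_mono) (simp add: algebra_simps)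
      show ?thesis
      proof (cases "z > 0")
        case True
        have "(*v) M ` C r j \<subseteq> C r (j + 1)" for j
        proof -
          have e: "- (a * int R) + r + a * (int j - 1) + z = - (a * int R) + r + a * (int (j + 1) - 1)"
            using True by (simp add: a_def algebra_simps)
          show ?thesis using MF[of "- (a * int R) + r + a * (int j - 1)"] unfolding C_def e .
        qed
        then show ?thesis using up_chain[of "2 * R + 1" "C r"] c0 ck cs cm True by simp
      next
        case False
        have "(*v) M ` C r (j + 1) \<subseteq> C r j" for j
        proof -
          have e: "- (a * int R) + r + a * (int (j + 1) - 1) + z = - (a * int R) + r + a * (int j - 1)"
            using False by (simp add: a_def algebra_simps)
          show ?thesis using MF[of "- (a * int R) + r + a * (int (j + 1) - 1)"] unfolding C_def e .
        qed
        then show ?thesis using down_chain[of "2 * R + 1" "C r"] c0 ck cs cm False z by simp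
      qed
    qed
    then have "lt strict (\<Sum>r\<in>{0..<a}. \<Sum>j\<in>{1..<2 * R + 1}. excess w (C r j)) (real (card {0..<a}) * (sgn (real_of_int z) * real q))"
      using a(1) by (intro lt_sum) auto
    moreover have "G = (\<Sum>r\<in>{0..<a}. \<Sum>j\<in>{1..<2 * R + 1}. excess w (C r j))"
      unfolding G_def a(2) C_def by (rule sum_residues[OF a(1)])
    moreover have "real (card {0..<a}) * (sgn (real_of_int z) * real q) = real_of_int z * real q"
      using z a(1) by (simp add: a_def mult.assoc[symmetric] abs_mult_sgn)
    ultimately show ?thesis by (simp only:)
  qed
  have inv: "excess w (F t) \<le> 0" if "z = 0" for t
    using MF[of t] that by (intro excess_invariant F_sub) simp
  have G_le: "G \<le> real_of_int z * real q"
  proof (cases "z = 0")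
    case True
    then show ?thesis unfolding G_def using inv by (simp add: sum_nonpos)
  qed (use chains lt_le in blast)
  have posB': "0 \<le> real CARD('m) / real CARD('n) * real_of_int (\<Sum>j\<in>UNIV. wt (B j))"
    using posB by (intro mult_nonneg_nonneg) (simp_all only: of_int_0_le_iff, simp_all)
  show "0 \<le> (\<Sum>i\<in>UNIV. y i) + z * int q"
  proof -
    have "0 \<le> real_of_int ((\<Sum>i\<in>UNIV. y i) + z * int q)" using total G_le posB' by linarith
    then show ?thesis by (simp only: of_int_0_le_iff)
  qed
  show "0 < (\<Sum>i\<in>UNIV. y i) + z * int q" if str: strict and nz: "z \<noteq> 0 \<or> (\<exists>i. y i \<noteq> 0)"
  proof (cases "G < real_of_int z * real q")
    case True
    then have "0 < real_of_int ((\<Sum>i\<in>UNIV. y i) + z * int q)" using total posB' by linarith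
    then show ?thesis by (simp only: of_int_0_less_iff)
  next
    case False
    then have z0: "z = 0" using chains str by (auto simp: lt_def)
    then have G0: "G = 0" using False G_le by simp
    \<comment> \<open>A proper nonzero step would be invariant with negative excess, contradicting
      \<open>G = 0\<close>. So the filtration jumps only once, all basis weights agree, and every
      \<open>y i\<close> is at least this common nonnegative weight.\<close>
    have triv: "F t = {0} \<or> F t = UNIV" for t
    proof (rule ccontr)
      assume no: "\<not> ?thesis"
      then have t: "t \<in> {- T..<T}" using F_bot[of t] F_top[of t] RT by force
      have "(*v) M ` F t \<subseteq> F t" using MF[of t] z0 by simp
      then have "excess w (F t) < 0" using excess_proper[OF F_sub, of t] no str by (simp add: lt_def)
      then have "G < 0" unfolding G_def using t inv[OF z0]
        by (intro order_less_le_trans[OF sum_strict_mono_ex1[of _ _ "\<lambda>_. 0"]]) auto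
      then show False using G0 by simp
    qed
    have Xnz: "X (B j) \<noteq> 0" for j
    proof
      assume "X (B j) = 0"
      then have "0 \<in> (\<lambda>j. X (B j)) ` {j}" by simp
      from vec.dependent_zero[OF this] show False using tuple_independent[OF B(2), of "{j}"] by contradiction
    qed
    have FU: "F t = UNIV" if "x \<in> F t" "x \<noteq> 0" for x t using triv[of t] that by blast
    have all: "wt (B j) \<le> t" if "F t = UNIV" for j t
    proof -
      have "card {j. wt (B j) \<le> t} = CARD('n)" using dimF[of t] that vec_dim_card[where 'a='a and 'n='n] by simp
      then have "{j. wt (B j) \<le> t} = UNIV" by (intro card_eq_UNIV_imp_eq_UNIV) simp_all
      then show ?thesis by blast
    qed
    have eqw: "wt (B j) = wt (B i)" for i j
    proof (rule antisym)
      show "wt (B j) \<le> wt (B i)" by (rule all, rule FU[OF X_F[OF B(1) order_refl] Xnz])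
      show "wt (B i) \<le> wt (B j)" by (rule all, rule FU[OF X_F[OF B(1) order_refl] Xnz])
    qed
    obtain j :: 'n where True by blast
    have "(\<Sum>i\<in>UNIV. wt (B i)) = (\<Sum>i\<in>(UNIV :: 'n set). wt (B j))" by (intro sum.cong refl eqw)
    then have "0 \<le> int CARD('n) * wt (B j)" using posB by simp
    then have w_nn: "0 \<le> wt (B j)" by (simp add: zero_le_mult_iff)
    have "wt (B j) \<le> y i" for i by (rule all, rule FU[OF wF[OF order_refl] w0])
    then have ynn: "0 \<le> y i" for i using w_nn order_trans by blast
    obtain i where "y i \<noteq> 0" using nz z0 by blast
    then have "0 < (\<Sum>i\<in>UNIV. y i)" using ynn by (intro sum_pos2[of _ i]) (auto simp: less_le)
    then show ?thesis by (simp add: z0)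
  qed
qed

end

section \<open>Invariant forms\<close>

definition inv_form :: "('m option \<Rightarrow> nat) \<Rightarrow> (('a::field, 'n::finite, 'm::finite) coords \<Rightarrow> 'a) \<Rightarrow> bool" where
  "inv_form D P \<longleftrightarrow> P \<in> mhom D \<and> (\<forall>A\<in>SL. \<forall>x. P (act A x) = P x)"

lemma inv_form_mhom: "inv_form D P \<Longrightarrow> P \<in> mhom D"
  by (simp add: inv_form_def)

lemma inv_form_act: "inv_form D P \<Longrightarrow> A \<in> SL \<Longrightarrow> P (act A x) = P x"
  unfolding inv_form_def by blast

lemma inv_form_hscale: "inv_form D P \<Longrightarrow> P (hscale b x) = (\<Prod>\<beta>\<in>UNIV. b \<beta> ^ D \<beta>) * P x"
  by (rule mhom_hscale[OF inv_form_mhom])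

lemma inv_form_mult:
  "inv_form D P \<Longrightarrow> inv_form E Q \<Longrightarrow> inv_form (\<lambda>\<beta>. D \<beta> + E \<beta>) (\<lambda>x. P x * Q x)"
  by (simp add: inv_form_def mhom_mult)

lemma inv_form_one: "inv_form (\<lambda>_. 0) (\<lambda>_. 1)"
  by (simp add: inv_form_def mhom_const)

lemma inv_form_power: "inv_form D P \<Longrightarrow> inv_form (\<lambda>\<beta>. k * D \<beta>) (\<lambda>x. P x ^ k)"
  by (simp add: inv_form_def mhom_power)

lemma inv_form_prod:
  assumes "finite I" "\<And>i. i \<in> I \<Longrightarrow> inv_form (D i) (P i)"
  shows "inv_form (\<lambda>\<beta>. \<Sum>i\<in>I. D i \<beta>) (\<lambda>x. \<Prod>i\<in>I. P i x)"
  using assms(2) unfolding inv_form_def by (intro conjI mhom_prod[OF assms(1)]) auto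

lemma inv_form_dform: "inv_form (tdegree B) (dform B)"
  for B :: "'n::finite \<Rightarrow> 'm::finite \<times> nat"
  by (simp add: inv_form_def dform_mhom dform_act)

lemma inv_form_cpform:
  "inv_form (case_option d (\<lambda>_. 0)) (cpform d :: ('a::alg_closed_field, 'n::finite, 'm::finite) coords \<Rightarrow> 'a)"
  by (simp add: inv_form_def cpform_mhom cpform_act)

text \<open>The multidegree of the sheaf \<open>O(q, 1, ..., 1)\<close>.\<close>

abbreviation tau :: "nat \<Rightarrow> 'm option \<Rightarrow> nat" where
  "tau q \<equiv> case_option q (\<lambda>_. 1)"

lemma inv_form_invariant_section:
  assumes "inv_form (\<lambda>\<beta>. m * tau q \<beta>) s" shows "s \<in> invariant_sections (m * q) (\<lambda>_. m)"
  using mhom_imp_section[OF inv_form_mhom[OF assms]] inv_form_act[OF assms]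
  by (simp add: invariant_sections_def)

lemma inv_form_affine:
  fixes s :: "('a::alg_closed_field, 'n::finite, 'm::finite) coords \<Rightarrow> 'a"
  assumes "inv_form (\<lambda>\<beta>. m * tau q \<beta>) s" "m \<ge> 1" "q \<ge> 1"
  shows "affine_open (nonvanishing s)"
proof (rule affine_open_nonvanishing[OF inv_form_mhom[OF assms(1)]])
  show "1 \<le> m * tau q \<beta>" for \<beta> :: "'m option" using assms(2,3) by (cases \<beta>) simp_all
qed

section \<open>Flags of the three types as functionals on multidegrees\<close>

text \<open>The weights of the one-parameter subgroup act on all multidegrees, not only on multiples
  of \<open>tau q\<close>. The last two conclusions make the functional nonzero for each type: the
  matrix weight when \<delta> is nonzero, a vector weight when \<open>\<gamma> = 1\<close>.\<close>

lemma flag_weight: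
  fixes M :: "'a::alg_closed_field^'n::finite^'n" and w :: "'m::finite \<Rightarrow> 'a^'n"
  assumes flag: "is_flag \<gamma> H"
    and up: "\<And>t v. t \<le> \<gamma> + 1 \<Longrightarrow> v \<in> H t \<Longrightarrow> M *v v \<in> H (min (\<gamma> + 1) (nat (int t + \<delta>)))"
    and down: "\<exists>t v. t \<le> \<gamma> + 1 \<and> 1 \<le> int t + \<delta> \<and> int t + \<delta> \<le> int (\<gamma> + 1) \<and> v \<in> H t \<and> M *v v \<notin> H (nat (int t + \<delta> - 1))"
    and x: "(M, w) \<in> cone"
  obtains \<omega> :: "'m option \<Rightarrow> int" where
    "\<And>D P. inv_form D P \<Longrightarrow> P (M, w) \<noteq> 0 \<Longrightarrow> (\<Sum>\<beta>\<in>UNIV. \<omega> \<beta> * int (D \<beta>)) \<le> 0"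
    "(\<Sum>\<beta>\<in>UNIV. \<omega> \<beta> * int (tau q \<beta>)) = int CARD('n) * (\<Sum>t=1..\<gamma>. int (card {i. w i \<in> H t}))
     - int CARD('m) * (\<Sum>t=1..\<gamma>. int (vec.dim (H t))) - int CARD('n) * \<delta> * int q"
    "\<omega> None = - int CARD('n) * \<delta>" "\<gamma> = 1 \<Longrightarrow> \<exists>i. \<omega> (Some i) \<noteq> 0"
proof -
  obtain b L where b: "tdet b \<noteq> 0" "\<And>j. 1 \<le> L j \<and> L j \<le> \<gamma> + 1"
    "\<And>t. t \<le> \<gamma> + 1 \<Longrightarrow> H t = vec.span (b ` {j. L j \<le> t})"
    by (rule flag_adapted_basis[OF flag], rule that, assumption+)
  interpret flag_degeneration \<gamma> H \<delta> M w b L "\<lambda>i. LEAST t. w i \<in> H t" "int CARD('n)"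
    by unfold_locales (use flag up down x b in \<open>auto simp: cone_def\<close>)
  let ?l = "\<lambda>i. LEAST t. w i \<in> H t"
  define \<omega> where "\<omega> = case_option (- int CARD('n) * \<delta>) (\<lambda>i. S - int CARD('n) * int (?l i))"
  have bt: "bt t \<beta> = t powi \<omega> \<beta>" for t \<beta> by (cases \<beta>) (simp_all add: bt_def \<omega>_def)
  show thesis
  proof (rule that[of \<omega>])
    fix D :: "'m option \<Rightarrow> nat" and P :: "('a, 'n, 'm) coords \<Rightarrow> 'a"
    assume P: "inv_form D P" "P (M, w) \<noteq> 0"
    let ?E = "\<Sum>\<beta>\<in>UNIV. \<omega> \<beta> * int (D \<beta>)"
    have "P (M, w) = t powi ?E * P (X t)" if t: "t \<noteq> 0" for t
    proof -
      have "P (M, w) = P (act (lam t) (X 1))" using inv_form_act[OF P(1) lam_SL[OF t]] by (simp add: X_1)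
      also have "\<dots> = (\<Prod>\<beta>\<in>UNIV. bt t \<beta> ^ D \<beta>) * P (X t)"
        unfolding act_lam[OF t] by (simp add: inv_form_hscale[OF P(1)])
      also have "(\<Prod>\<beta>\<in>UNIV. bt t \<beta> ^ D \<beta>) = (\<Prod>\<beta>\<in>UNIV. t powi (\<omega> \<beta> * int (D \<beta>)))"
        by (intro prod.cong refl) (simp add: bt powi_nat_power[OF t])
      also have "\<dots> = t powi ?E" by (rule prod_powi[OF finite t])
      finally show ?thesis .
    qed
    then show "?E \<le> 0"
      by (rule section_weight_along_curve(1)[OF mhom_imp_section[OF inv_form_mhom[OF P(1)]] X_poly_curve X_cone _ P(2)])
  next
    have "(\<Sum>\<beta>\<in>UNIV. \<omega> \<beta> * int (tau q \<beta>)) = wt 1 q" by (simp add: sum_option \<omega>_def wt_def)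
    then show "(\<Sum>\<beta>\<in>UNIV. \<omega> \<beta> * int (tau q \<beta>)) = int CARD('n) * (\<Sum>t=1..\<gamma>. int (card {i. w i \<in> H t}))
     - int CARD('m) * (\<Sum>t=1..\<gamma>. int (vec.dim (H t))) - int CARD('n) * \<delta> * int q"
      unfolding wt_eq by simp
    show "\<omega> None = - int CARD('n) * \<delta>" by (simp add: \<omega>_def)
    show "\<exists>i. \<omega> (Some i) \<noteq> 0" if g: "\<gamma> = 1"
    proof -
      fix i :: 'm
      have st: "H 0 = {0}" "\<And>j. j \<le> \<gamma> \<Longrightarrow> H j \<subset> H (j + 1)" "\<And>j. j \<le> \<gamma> + 1 \<Longrightarrow> vec.subspace (H j)"
        using flag by (simp_all add: is_flag_def)
      have sp: "vec.span (H j) = H j" if "j \<le> \<gamma> + 1" for j using st(3)[OF that] vec.span_eq_iff by auto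
      have lt: "vec.dim (H j) < vec.dim (H (j + 1))" if "j \<le> \<gamma>" for j
        using st(2)[OF that] that by (intro vec.dim_psubset) (simp add: sp)
      have "H 2 = UNIV" using top g by (simp add: numeral_2_eq_2)
      then have dims: "0 < vec.dim (H 1)" "vec.dim (H 1) < CARD('n)"
        using lt[of 0] lt[of 1] g vec_dim_card[where 'a='a and 'n='n] by (simp_all add: numeral_2_eq_2 del: vec.dim_eq_0)
      have cd: "card {j. L j \<le> 1} = vec.dim (H 1)" using H_span[of 1] dim_span_tuple[OF b(1), of "{j. L j \<le> 1}"] by simp
      have "(\<Sum>t=1..\<gamma>. card {j. L j \<le> t}) + (\<Sum>j\<in>UNIV. L j) = CARD('n) * (\<gamma> + 1)"
        by (rule sum_card_levels) (rule L)
      then have "vec.dim (H 1) + (\<Sum>j\<in>UNIV. L j) = CARD('n) * 2" using cd g by simp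
      \<comment> \<open>Hence \<open>S\<close> lies strictly between \<open>CARD('n)\<close> and
        twice \<open>CARD('n)\<close>, whereas a level 1 or 2 contributes one of these two
        values.\<close>
      then have S_eq: "S = 2 * int CARD('n) - int (vec.dim (H 1))" unfolding S_def of_nat_sum[symmetric] by linarith
      have "?l i = 1 \<or> ?l i = 2" using l_bounds[of i] g by linarith
      then have "int CARD('n) * int (?l i) = int CARD('n) \<or> int CARD('n) * int (?l i) = 2 * int CARD('n)"
        by (elim disjE) simp_all
      then have "S \<noteq> int CARD('n) * int (?l i)" using S_eq dims by linarith
      then have "\<omega> (Some i) \<noteq> 0" by (simp add: \<omega>_def)
      then show ?thesis by blast
    qed
  qed
qed

lemma ftype_up:
  assumes flag: "is_flag \<gamma> H" and ft: "ftype M \<gamma> H \<delta>" and t: "t \<le> \<gamma> + 1" and v: "v \<in> H t"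
  shows "M *v v \<in> H (min (\<gamma> + 1) (nat (int t + \<delta>)))"
proof -
  have st: "H 0 = {0}" "H (\<gamma> + 1) = UNIV" "\<And>j. j \<le> \<gamma> + 1 \<Longrightarrow> vec.subspace (H j)"
    using flag by (simp_all add: is_flag_def)
  have z: "0 \<in> H j" if "j \<le> \<gamma> + 1" for j using st(3)[OF that] by (rule vec.subspace_0)
  show ?thesis
  proof (cases "t = 0 \<or> min (\<gamma> + 1) (nat (int t + \<delta>)) = \<gamma> + 1")
    case True
    then show ?thesis using v st z by auto
  next
    case False
    then have t0: "1 \<le> t" "nat (int t + \<delta>) < \<gamma> + 1" "min (\<gamma> + 1) (nat (int t + \<delta>)) = nat (int t + \<delta>)" by auto
    from ft consider (I) "\<delta> = 0" "\<gamma> = 1" "(*v) M ` H 1 \<subseteq> H 1"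
      | (II) "\<delta> = 1" "\<forall>t\<in>{1..\<gamma>}. (*v) M ` H t \<subseteq> H (t + 1)"
      | (III) "\<delta> = - 1" "\<forall>t\<in>{1..\<gamma> + 1}. (*v) M ` H t \<subseteq> H (t - 1)"
      unfolding ftype_def by blast
    then show ?thesis
    proof cases
      case I
      then have "t = 1" using t0 by simp
      then show ?thesis using I v by auto
    next
      case II
      then have tt: "t \<in> {1..\<gamma>}" "nat (int t + \<delta>) = t + 1" using t0 by auto
      have "M *v v \<in> H (t + 1)" using bspec[OF II(2) tt(1)] v by blast
      then show ?thesis unfolding t0(3) unfolding tt(2) .
    next
      case III
      then have tt: "t \<in> {1..\<gamma> + 1}" "nat (int t + \<delta>) = t - 1" using t0(1) t by auto
      have "M *v v \<in> H (t - 1)" using bspec[OF III(2) tt(1)] v by blast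
      then show ?thesis unfolding t0(3) unfolding tt(2) .
    qed
  qed
qed

text \<open>The exact shift is visible at the first step for type II and at the whole space for type
  III. The two alternatives of type I show it at \<open>t = 1\<close> and
  \<open>t = 2\<close>.\<close>

lemma ftype_down:
  assumes flag: "is_flag \<gamma> H" and ft: "ftype M \<gamma> H \<delta>"
  shows "\<exists>t v. t \<le> \<gamma> + 1 \<and> 1 \<le> int t + \<delta> \<and> int t + \<delta> \<le> int (\<gamma> + 1) \<and> v \<in> H t \<and> M *v v \<notin> H (nat (int t + \<delta> - 1))"
proof -
  have st: "1 \<le> \<gamma>" "H 0 = {0}" "H (\<gamma> + 1) = UNIV" "vec.subspace (H 1)"
    using flag by (simp_all add: is_flag_def)
  from ft consider (I) "\<delta> = 0" "\<gamma> = 1" "(*v) M ` H 1 \<noteq> {0}" | (I') "\<delta> = 0" "\<gamma> = 1" "\<not> range ((*v) M) \<subseteq> H 1"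
    | (II) "\<delta> = 1" "\<forall>t\<in>{1..\<gamma>}. \<not> (*v) M ` H t \<subseteq> H t"
    | (III) "\<delta> = - 1" "\<forall>t\<in>{1..\<gamma> + 1}. t \<ge> 2 \<longrightarrow> \<not> (*v) M ` H t \<subseteq> H (t - 2)"
    unfolding ftype_def by blast
  then show ?thesis
  proof cases
    case I
    have "0 \<in> (*v) M ` H 1" using vec.subspace_0[OF st(4)] by (intro image_eqI[of _ _ 0]) simp_all
    then obtain v where "v \<in> H 1" "M *v v \<noteq> 0" using I(3) by blast
    then show ?thesis using I st(2) by (intro exI[of _ 1] exI[of _ v]) simp
  next
    case I'
    then obtain v where "M *v v \<notin> H 1" by blast
    moreover have "v \<in> H 2" using st(3) I'(2) by (simp add: numeral_2_eq_2)
    ultimately show ?thesis using I' by (intro exI[of _ 2] exI[of _ v]) simp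
  next
    case II
    then obtain v where "v \<in> H 1" "M *v v \<notin> H 1" using st(1) by force
    then show ?thesis using II(1) st(1) by (intro exI[of _ 1] exI[of _ v]) simp
  next
    case III
    have "\<gamma> + 1 \<in> {1..\<gamma> + 1}" "2 \<le> \<gamma> + 1" using st(1) by simp_all
    then have "\<not> (*v) M ` H (\<gamma> + 1) \<subseteq> H (\<gamma> + 1 - 2)" using III(2) by blast
    then obtain v where "v \<in> H (\<gamma> + 1)" "M *v v \<notin> H (\<gamma> + 1 - 2)" by blast
    moreover have "nat (int (\<gamma> + 1) + \<delta> - 1) = \<gamma> + 1 - 2" using III(1) st(1) by simp
    ultimately show ?thesis using III(1) st(1) by (intro exI[of _ "\<gamma> + 1"] exI[of _ v]) simp
  qed
qed

lemma sum_excess: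
  fixes w :: "'m::finite \<Rightarrow> 'a::field^'n::finite"
  shows "(\<Sum>t=1..\<gamma>. excess w (H t)) = (\<Sum>t=1..\<gamma>. real (card {i. w i \<in> H t}))
    - real CARD('m) / real CARD('n) * (\<Sum>t=1..\<gamma>. real (vec.dim (H t)))"
  by (simp add: excess_def sum_subtractf sum_distrib_left)

lemma excess_int_diff:
  fixes w :: "'m::finite \<Rightarrow> 'a::field^'n::finite"
  shows "real_of_int (int CARD('n) * (\<Sum>t=1..\<gamma>. int (card {i. w i \<in> H t}))
      - int CARD('m) * (\<Sum>t=1..\<gamma>. int (vec.dim (H t))) - int CARD('n) * \<delta> * int q) =
    real CARD('n) * ((\<Sum>t=1..\<gamma>. excess w (H t)) - real_of_int \<delta> * real q)"
  unfolding sum_excess by (simp add: right_diff_distrib)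

section \<open>The monoid of degrees of invariant forms\<close>

text \<open>Collects what \<open>weight_functional\<close> needs: the finitely many determinants
  with exponents below \<open>CARD('n)\<close> and, unless a power of \<open>M\<close> kills all
  marked vectors, one coefficient of positive degree in \<open>M\<close> alone. The latter forces
  the matrix weight of a functional that is nonnegative on the collection to be nonnegative.\<close>

lemma generators:
  fixes M :: "'a::alg_closed_field^'n::finite^'n" and w :: "'m::finite \<Rightarrow> 'a^'n"
  obtains \<G> where "finite \<G>" "\<And>D P. (D, P) \<in> \<G> \<Longrightarrow> inv_form D P \<and> P (M, w) \<noteq> 0"
    "\<forall>B. (\<forall>j. snd (B j) < CARD('n)) \<longrightarrow> dform B (M, w) \<noteq> 0 \<longrightarrow> (tdegree B, dform B) \<in> \<G>"
    "(\<forall>i. kry M (w i) CARD('n) = 0) \<or> (\<exists>d\<ge>1. \<exists>P. (case_option d (\<lambda>_. 0), P) \<in> \<G>)"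
proof -
  define \<B> where "\<B> = {B :: 'n \<Rightarrow> 'm \<times> nat. (\<forall>j. snd (B j) < CARD('n)) \<and> dform B (M, w) \<noteq> 0}"
  have "\<B> \<subseteq> PiE UNIV (\<lambda>_. UNIV \<times> {..<CARD('n)})"
    unfolding \<B>_def by (auto simp: PiE_def mem_Times_iff)
  moreover have "finite (PiE (UNIV :: 'n set) (\<lambda>_. (UNIV :: 'm set) \<times> {..<CARD('n)}))"
    by (intro finite_PiE) auto
  ultimately have finB: "finite \<B>" by (rule finite_subset)
  define \<G>0 where "\<G>0 = (\<lambda>B. (tdegree B, dform B :: ('a, 'n, 'm) coords \<Rightarrow> 'a)) ` \<B>"
  have g0: "finite \<G>0" "\<And>D P. (D, P) \<in> \<G>0 \<Longrightarrow> inv_form D P \<and> P (M, w) \<noteq> 0"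
    "\<forall>B. (\<forall>j. snd (B j) < CARD('n)) \<longrightarrow> dform B (M, w) \<noteq> 0 \<longrightarrow> (tdegree B, dform B) \<in> \<G>0"
    unfolding \<G>0_def using finB by (auto simp: \<B>_def inv_form_dform)
  show thesis
  proof (cases "\<forall>i. kry M (w i) CARD('n) = 0")
    case True
    then show thesis using g0 by (intro that[of \<G>0]) simp_all
  next
    case False
    then obtain i where "kry M (w i) CARD('n) \<noteq> 0" by blast
    then obtain d where d: "d \<ge> 1" "cpform d (M, w) \<noteq> 0" using cpform_nonzero by blast
    show thesis
    proof (rule that[of "insert (case_option d (\<lambda>_. 0), cpform d) \<G>0"])
      show "finite (insert (case_option d (\<lambda>_. 0), cpform d) \<G>0)" using g0(1) by simp
      show "inv_form D P \<and> P (M, w) \<noteq> 0" if "(D, P) \<in> insert (case_option d (\<lambda>_. 0), cpform d) \<G>0" for D P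
        using that g0(2)[of D P] d(2) inv_form_cpform by auto
      show "\<forall>B. (\<forall>j. snd (B j) < CARD('n)) \<longrightarrow> dform B (M, w) \<noteq> 0 \<longrightarrow>
          (tdegree B, dform B) \<in> insert (case_option d (\<lambda>_. 0), cpform d) \<G>0"
        using g0(3) by simp
      show "(\<forall>i. kry M (w i) CARD('n) = 0) \<or>
        (\<exists>d'\<ge>1. \<exists>P. (case_option d' (\<lambda>_. 0), P) \<in> insert (case_option d (\<lambda>_. 0), cpform d) \<G>0)"
        using d(1) by blast
    qed
  qed
qed

lemma sum_tdegree:
  fixes B :: "'n::finite \<Rightarrow> 'm::finite \<times> nat" and \<eta> :: "'m option \<Rightarrow> int"
  shows "(\<Sum>\<beta>\<in>UNIV. \<eta> \<beta> * int (tdegree B \<beta>)) = (\<Sum>j\<in>UNIV. \<eta> (Some (fst (B j))) + \<eta> None * int (snd (B j)))"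
proof -
  have "(\<Sum>j\<in>UNIV. \<eta> (Some (fst (B j)))) = (\<Sum>i\<in>UNIV. \<Sum>j\<in>{j. fst (B j) = i}. \<eta> (Some (fst (B j))))"
    using sum.group[of UNIV UNIV "\<lambda>j. fst (B j)" "\<lambda>j. \<eta> (Some (fst (B j)))"] by simp
  also have "\<dots> = (\<Sum>i\<in>UNIV. \<eta> (Some i) * int (card {j. fst (B j) = i}))"
    by (intro sum.cong refl) (simp add: mult.commute)
  finally show ?thesis by (simp add: sum_option tdegree_def sum.distrib sum_distrib_left)
qed

text \<open>One fixed choice of generators per point, so that forms built from them at
  \<open>(M, w)\<close> can be examined at other points.\<close>

definition gens :: "('a::alg_closed_field, 'n::finite, 'm::finite) coords \<Rightarrow> (('m option \<Rightarrow> nat) \<times> (('a, 'n, 'm) coords \<Rightarrow> 'a)) set" where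
  "gens x = (SOME \<G>. finite \<G> \<and> (\<forall>(D, P)\<in>\<G>. inv_form D P \<and> P x \<noteq> 0) \<and>
    (\<forall>B. (\<forall>j. snd (B j) < CARD('n)) \<longrightarrow> dform B x \<noteq> 0 \<longrightarrow> (tdegree B, dform B) \<in> \<G>) \<and>
    ((\<forall>i. kry (fst x) (snd x i) CARD('n) = 0) \<or> (\<exists>d\<ge>1. \<exists>P. (case_option d (\<lambda>_. 0), P) \<in> \<G>)))"

lemma gens:
  fixes x :: "('a::alg_closed_field, 'n::finite, 'm::finite) coords"
  shows "finite (gens x)" "(D, P) \<in> gens x \<Longrightarrow> inv_form D P \<and> P x \<noteq> 0"
    "(\<And>j. snd (B j) < CARD('n)) \<Longrightarrow> dform B x \<noteq> 0 \<Longrightarrow> (tdegree B, dform B) \<in> gens x"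
    "(\<forall>i. kry (fst x) (snd x i) CARD('n) = 0) \<or> (\<exists>d\<ge>1. \<exists>P. (case_option d (\<lambda>_. 0), P) \<in> gens x)"
proof -
  let ?P = "\<lambda>\<G>. finite \<G> \<and> (\<forall>(D, P)\<in>\<G>. inv_form D P \<and> P x \<noteq> 0) \<and>
    (\<forall>B. (\<forall>j. snd (B j) < CARD('n)) \<longrightarrow> dform B x \<noteq> 0 \<longrightarrow> (tdegree B, dform B) \<in> \<G>) \<and>
    ((\<forall>i. kry (fst x) (snd x i) CARD('n) = 0) \<or> (\<exists>d\<ge>1. \<exists>P. (case_option d (\<lambda>_. 0), P) \<in> \<G>))"
  obtain M w where x: "x = (M, w)" by (cases x)
  obtain \<G> where G: "finite \<G>" "\<And>D P. (D, P) \<in> \<G> \<Longrightarrow> inv_form D P \<and> P (M, w) \<noteq> 0"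
    "\<forall>B. (\<forall>j. snd (B j) < CARD('n)) \<longrightarrow> dform B (M, w) \<noteq> 0 \<longrightarrow> (tdegree B, dform B) \<in> \<G>"
    "(\<forall>i. kry M (w i) CARD('n) = 0) \<or> (\<exists>d\<ge>1. \<exists>P. (case_option d (\<lambda>_. 0), P) \<in> \<G>)"
    by (rule generators[of M w], rule that, assumption+)
  have "?P \<G>"
  proof (intro conjI allI impI)
    show "finite \<G>" by (rule G(1))
    show "\<forall>(D, P)\<in>\<G>. inv_form D P \<and> P x \<noteq> 0" using G(2) x by blast
    show "(tdegree B, dform B) \<in> \<G>" if "\<forall>j. snd (B j) < CARD('n)" "dform B x \<noteq> 0" for B
      using G(3)[rule_format, of B] that unfolding x by blast
    show "(\<forall>i. kry (fst x) (snd x i) CARD('n) = 0) \<or> (\<exists>d\<ge>1. \<exists>P. (case_option d (\<lambda>_. 0), P) \<in> \<G>)"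
      using G(4) unfolding x fst_conv snd_conv .
  qed
  then have P: "?P (gens x)" unfolding gens_def by (rule someI[of ?P])
  show "finite (gens x)" "(D, P) \<in> gens x \<Longrightarrow> inv_form D P \<and> P x \<noteq> 0"
    "(\<And>j. snd (B j) < CARD('n)) \<Longrightarrow> dform B x \<noteq> 0 \<Longrightarrow> (tdegree B, dform B) \<in> gens x"
    "(\<forall>i. kry (fst x) (snd x i) CARD('n) = 0) \<or> (\<exists>d\<ge>1. \<exists>P. (case_option d (\<lambda>_. 0), P) \<in> gens x)"
    using P by blast+
qed

lemma gens_pow:
  fixes x :: "('a::alg_closed_field, 'n::finite, 'm::finite) coords"
  shows "inv_form (\<lambda>\<beta>. \<Sum>k\<in>gens x. c k * fst k \<beta>) (\<lambda>y. \<Prod>k\<in>gens x. snd k y ^ c k)"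
proof (rule inv_form_prod[OF gens(1)])
  fix k assume "k \<in> gens x"
  then have "inv_form (fst k) (snd k)" using gens(2)[of "fst k" "snd k" x] by simp
  then show "inv_form (\<lambda>\<beta>. c k * fst k \<beta>) (\<lambda>y. snd k y ^ c k)" by (rule inv_form_power)
qed

lemma gens_pow_nonzero: "(\<Prod>k\<in>gens x. snd k x ^ c k) \<noteq> 0"
  using gens(1)[of x] gens(2)[of _ _ x] by (auto simp: prod_zero_iff)

locale stable_data = flag_inequalities M w q strict
  for M :: "'a::alg_closed_field^'n::finite^'n" and w :: "'m::finite \<Rightarrow> 'a^'n" and q strict
begin

lemma cone_Mw: "(M, w) \<in> cone"
  using M0 w0 by (simp add: cone_def)

lemma functional:
  fixes \<eta> :: "'m option \<Rightarrow> int"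
  assumes "\<And>k. k \<in> gens (M, w) \<Longrightarrow> 0 \<le> (\<Sum>\<beta>\<in>UNIV. \<eta> \<beta> * int (fst k \<beta>))"
  shows "0 \<le> (\<Sum>\<beta>\<in>UNIV. \<eta> \<beta> * int (tau q \<beta>))"
    and "strict \<Longrightarrow> \<exists>\<beta>. \<eta> \<beta> \<noteq> 0 \<Longrightarrow> 0 < (\<Sum>\<beta>\<in>UNIV. \<eta> \<beta> * int (tau q \<beta>))"
proof -
  have nil: "\<eta> None \<ge> 0 \<or> (\<forall>i. kry M (w i) CARD('n) = 0)"
  proof (cases "\<forall>i. kry M (w i) CARD('n) = 0")
    case False
    then obtain d P where d: "d \<ge> 1" "(case_option d (\<lambda>_. 0), P) \<in> gens (M, w)"
      using gens(4)[of "(M, w)"] by auto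
    have "0 \<le> \<eta> None * int d" using assms[OF d(2)] by (simp add: sum_option)
    then show ?thesis using d(1) by (simp add: zero_le_mult_iff)
  qed simp
  have pos: "0 \<le> (\<Sum>j\<in>UNIV. \<eta> (Some (fst (B j))) + \<eta> None * int (snd (B j)))"
    if "\<And>j. snd (B j) < CARD('n)" "dform B (M, w) \<noteq> 0" for B :: "'n \<Rightarrow> 'm \<times> nat"
    using assms[OF gens(3)[OF that]] by (simp only: sum_tdegree fst_conv)
  have eq: "(\<Sum>\<beta>\<in>UNIV. \<eta> \<beta> * int (tau q \<beta>)) = (\<Sum>i\<in>UNIV. \<eta> (Some i)) + \<eta> None * int q"
    by (simp add: sum_option)
  show "0 \<le> (\<Sum>\<beta>\<in>UNIV. \<eta> \<beta> * int (tau q \<beta>))"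
    unfolding eq by (rule weight_functional(1)[OF nil pos])
  show "0 < (\<Sum>\<beta>\<in>UNIV. \<eta> \<beta> * int (tau q \<beta>))" if "strict" "\<exists>\<beta>. \<eta> \<beta> \<noteq> 0"
  proof -
    have nz: "\<eta> None \<noteq> 0 \<or> (\<exists>i. \<eta> (Some i) \<noteq> 0)" using that(2) by (metis option.exhaust)
    show ?thesis unfolding eq by (rule weight_functional(2)[OF nil _ that(1) nz], rule pos)
  qed
qed

text \<open>By \<open>functional\<close> no functional separates \<open>tau q\<close> from the
  degrees of the generators. Farkas' lemma then provides exponents for which a product of generators
  has a multiple of \<open>tau q\<close> as its degree.\<close>

lemma semistable_form:
  obtains m s where "m \<ge> 1" "inv_form (\<lambda>\<beta>. m * tau q \<beta>) s" "s (M, w) \<noteq> 0"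
proof (rule farkas_int[OF gens(1)[of "(M, w)"], of "\<lambda>\<beta>. int (tau q \<beta>)" "\<lambda>k \<beta>. int (fst k \<beta>)"])
  fix m c assume c: "m > 0" "\<And>\<beta>. int m * int (tau q \<beta>) = (\<Sum>k\<in>gens (M, w). int (c k) * int (fst k \<beta>))"
  have "m * tau q \<beta> = (\<Sum>k\<in>gens (M, w). c k * fst k \<beta>)" for \<beta>
  proof -
    have "int (m * tau q \<beta>) = int (\<Sum>k\<in>gens (M, w). c k * fst k \<beta>)" using c(2)[of \<beta>] by simp
    then show ?thesis by (simp only: of_nat_eq_iff)
  qed
  then have "(\<lambda>\<beta>. m * tau q \<beta>) = (\<lambda>\<beta>. \<Sum>k\<in>gens (M, w). c k * fst k \<beta>)" by (rule ext)
  then have "inv_form (\<lambda>\<beta>. m * tau q \<beta>) (\<lambda>y. \<Prod>k\<in>gens (M, w). snd k y ^ c k)" using gens_pow by simp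
  then show thesis using c(1) by (intro that[of m "\<lambda>y. \<Prod>k\<in>gens (M, w). snd k y ^ c k"] gens_pow_nonzero) simp_all
next
  fix \<eta> :: "'m option \<Rightarrow> int"
  assume h: "\<And>k. k \<in> gens (M, w) \<Longrightarrow> 0 \<le> (\<Sum>\<beta>\<in>UNIV. \<eta> \<beta> * int (fst k \<beta>))" "(\<Sum>\<beta>\<in>UNIV. \<eta> \<beta> * int (tau q \<beta>)) < 0"
  from functional(1)[OF h(1)] h(2) show thesis by linarith
qed

end

section \<open>Characters of tori\<close>

text \<open>The graph of a homomorphism from a subgroup of a lattice to the multiplicative group of
  the field. Single-valuedness is required only at 0, from which it follows everywhere.\<close>

definition hom_graph :: "(('b \<Rightarrow> int) \<times> 'a::field) set \<Rightarrow> bool" where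
  "hom_graph G \<longleftrightarrow> (\<lambda>_. 0, 1) \<in> G \<and>
    (\<forall>v c v' c'. (v, c) \<in> G \<longrightarrow> (v', c') \<in> G \<longrightarrow> (\<lambda>\<beta>. v \<beta> + v' \<beta>, c * c') \<in> G) \<and>
    (\<forall>v c. (v, c) \<in> G \<longrightarrow> (\<lambda>\<beta>. - v \<beta>, inverse c) \<in> G) \<and>
    (\<forall>v c. (v, c) \<in> G \<longrightarrow> c \<noteq> 0) \<and> (\<forall>c. (\<lambda>_. 0, c) \<in> G \<longrightarrow> c = 1)"

lemma hom_graph_zero: "hom_graph G \<Longrightarrow> (\<lambda>_. 0, 1) \<in> G"
  and hom_graph_add: "hom_graph G \<Longrightarrow> (v, c) \<in> G \<Longrightarrow> (v', c') \<in> G \<Longrightarrow> (\<lambda>\<beta>. v \<beta> + v' \<beta>, c * c') \<in> G"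
  and hom_graph_neg: "hom_graph G \<Longrightarrow> (v, c) \<in> G \<Longrightarrow> (\<lambda>\<beta>. - v \<beta>, inverse c) \<in> G"
  and hom_graph_nz: "hom_graph G \<Longrightarrow> (v, c) \<in> G \<Longrightarrow> c \<noteq> 0"
  and hom_graph_one: "hom_graph G \<Longrightarrow> (\<lambda>_. 0, c) \<in> G \<Longrightarrow> c = 1"
  unfolding hom_graph_def by blast+

lemma hom_graph_unique:
  assumes "hom_graph G" "(v, c) \<in> G" "(v, c') \<in> G" shows "c = c'"
proof -
  have "(\<lambda>\<beta>. v \<beta> + - v \<beta>, c * inverse c') \<in> G"
    using hom_graph_add[OF assms(1,2) hom_graph_neg[OF assms(1,3)]] .
  then have "(\<lambda>_. 0, c * inverse c') \<in> G" by simp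
  from hom_graph_one[OF assms(1) this] show ?thesis using hom_graph_nz[OF assms(1,3)] by (simp add: field_simps)
qed

lemma hom_graph_nat_mult:
  assumes "hom_graph G" "(v, c) \<in> G" shows "(\<lambda>\<beta>. int k * v \<beta>, c ^ k) \<in> G"
proof (induction k)
  case 0 show ?case using hom_graph_zero[OF assms(1)] by simp
next
  case (Suc k)
  have "(\<lambda>\<beta>. v \<beta> + int k * v \<beta>, c * c ^ k) \<in> G" by (rule hom_graph_add[OF assms Suc])
  then show ?case by (simp add: algebra_simps)
qed

lemma hom_graph_int_mult:
  assumes "hom_graph G" "(v, c) \<in> G" shows "(\<lambda>\<beta>. k * v \<beta>, c powi k) \<in> G"
proof (cases "k \<ge> 0")
  case True
  then show ?thesis using hom_graph_nat_mult[OF assms, of "nat k"] by (simp add: power_int_def)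
next
  case False
  then show ?thesis
    using hom_graph_nat_mult[OF assms(1) hom_graph_neg[OF assms], of "nat (- k)"] by (simp add: power_int_def)
qed

lemma hom_graph_sum:
  assumes "hom_graph G" "finite I" "\<And>i. i \<in> I \<Longrightarrow> (v i, c i) \<in> G"
  shows "(\<lambda>\<beta>. \<Sum>i\<in>I. v i \<beta>, \<Prod>i\<in>I. c i) \<in> G"
  using assms(2,3)
proof (induction I rule: finite_induct)
  case empty show ?case using hom_graph_zero[OF assms(1)] by simp
next
  case (insert i I)
  then show ?case using hom_graph_add[OF assms(1), of "v i" "c i"] by simp
qed

lemma int_subgroup_generator:
  fixes J :: "int set"
  assumes "\<And>j k. j \<in> J \<Longrightarrow> k \<in> J \<Longrightarrow> j + k \<in> J" "\<And>j. j \<in> J \<Longrightarrow> - j \<in> J" "0 \<in> J"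
  obtains g where "g \<in> J" "g \<ge> 0" "\<And>j. j \<in> J \<Longrightarrow> g dvd j"
proof (cases "J = {0}")
  case True then show ?thesis using that[of 0] by simp
next
  case False
  then obtain j where "j \<in> J" "j \<noteq> 0" using assms(3) by blast
  then have ex: "\<exists>n::nat. n > 0 \<and> int n \<in> J"
    using assms(2)[of j] by (intro exI[of _ "nat \<bar>j\<bar>"]) (auto simp: abs_if)
  define g where "g = (LEAST n::nat. n > 0 \<and> int n \<in> J)"
  have g: "g > 0" "int g \<in> J" using LeastI_ex[OF ex] unfolding g_def by auto
  have mult: "int g * int k \<in> J" for k
    by (induction k) (use assms g in \<open>auto simp: algebra_simps\<close>)
  have multi: "int g * k \<in> J" for k
    using mult[of "nat k"] mult[of "nat (- k)"] assms(2)[of "int g * int (nat (- k))"] by (cases "k \<ge> 0") auto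
  have "int g dvd j" if j: "j \<in> J" for j
  proof (rule ccontr)
    assume "\<not> int g dvd j"
    then have nz: "j mod int g \<noteq> 0" by (simp add: dvd_eq_mod_eq_0)
    have "j + - (int g * (j div int g)) \<in> J" by (intro assms(1) assms(2) j multi)
    then have "j mod int g \<in> J" by (simp add: minus_mult_div_eq_mod)
    moreover have "0 \<le> j mod int g" "j mod int g < int g" using g(1) by simp_all
    ultimately have "nat (j mod int g) > 0 \<and> int (nat (j mod int g)) \<in> J" "nat (j mod int g) < g" using nz by auto
    then show False using not_less_Least[of "nat (j mod int g)" "\<lambda>n. n > 0 \<and> int n \<in> J"] unfolding g_def by blast
  qed
  then show ?thesis using that[of "int g"] g by simp
qed

lemma hom_graph_extend:
  fixes G :: "(('b \<Rightarrow> int) \<times> 'a::alg_closed_field) set"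
  assumes G: "hom_graph G"
  obtains G' r where "hom_graph G'" "G \<subseteq> G'" "(e, r) \<in> G'"
proof -
  define J where "J = {j. \<exists>c. (\<lambda>\<beta>. j * e \<beta>, c) \<in> G}"
  have "j + k \<in> J" if jk: "j \<in> J" "k \<in> J" for j k
  proof -
    obtain c where c: "(\<lambda>\<beta>. j * e \<beta>, c) \<in> G" using jk(1) unfolding J_def by blast
    obtain d where d: "(\<lambda>\<beta>. k * e \<beta>, d) \<in> G" using jk(2) unfolding J_def by blast
    from hom_graph_add[OF G c d] have "(\<lambda>\<beta>. (j + k) * e \<beta>, c * d) \<in> G" unfolding distrib_right .
    then show ?thesis unfolding J_def mem_Collect_eq by (rule exI)
  qed
  moreover have "- j \<in> J" if jJ: "j \<in> J" for j
  proof -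
    obtain c where "(\<lambda>\<beta>. j * e \<beta>, c) \<in> G" using jJ unfolding J_def by blast
    from hom_graph_neg[OF G this] have "(\<lambda>\<beta>. - j * e \<beta>, inverse c) \<in> G" by (simp only: minus_mult_left)
    then show ?thesis unfolding J_def mem_Collect_eq by (rule exI)
  qed
  moreover have "0 \<in> J" using hom_graph_zero[OF G] by (auto simp: J_def)
  ultimately obtain g where g: "g \<in> J" "g \<ge> 0" "\<And>j. j \<in> J \<Longrightarrow> g dvd j"
    using int_subgroup_generator[of J] by blast
  obtain c0 where c0: "(\<lambda>\<beta>. g * e \<beta>, c0) \<in> G" using g(1) by (auto simp: J_def)
  \<comment> \<open>The vector \<open>g * e\<close> generates the multiples of \<open>e\<close> in
    the domain, so the value at \<open>e\<close> only has to be a \<open>g\<close>-th root of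
    \<open>c0\<close>. If \<open>g = 0\<close>, any unit will do.\<close>
  have "\<exists>r. r \<noteq> 0 \<and> r powi g = c0"
  proof (cases "g = 0")
    case True
    then have "c0 = 1" using c0 hom_graph_one[OF G] by simp
    then show ?thesis using True by (intro exI[of _ 1]) simp
  next
    case False
    then obtain r where r: "r ^ nat g = c0" using nth_root_exists[of "nat g" c0] g(2) by auto
    moreover have "c0 \<noteq> 0" using hom_graph_nz[OF G c0] .
    ultimately have "r \<noteq> 0" using False g(2) by auto
    then show ?thesis using r g(2) by (intro exI[of _ r]) (simp add: power_int_def)
  qed
  then obtain r where r: "r \<noteq> 0" "r powi g = c0" by blast
  have rJ: "c = r powi j" if "(\<lambda>\<beta>. j * e \<beta>, c) \<in> G" for j c
  proof -
    have "j \<in> J" using that by (auto simp: J_def)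
    then obtain k where k: "j = k * g" using g(3) by (metis dvdE mult.commute)
    have "(\<lambda>\<beta>. k * (g * e \<beta>), c0 powi k) \<in> G" by (rule hom_graph_int_mult[OF G c0])
    then have "(\<lambda>\<beta>. j * e \<beta>, c0 powi k) \<in> G" by (simp add: k mult.assoc)
    from hom_graph_unique[OF G that this] show ?thesis
      by (simp add: k r(2)[symmetric] power_int_mult mult.commute[of k g])
  qed
  define G' where "G' = {(\<lambda>\<beta>. v \<beta> + j * e \<beta>, c * r powi j) | v c j. (v, c) \<in> G}"
  have G'I: "(v, c) \<in> G \<Longrightarrow> u = (\<lambda>\<beta>. v \<beta> + j * e \<beta>) \<Longrightarrow> d = c * r powi j \<Longrightarrow> (u, d) \<in> G'" for u d v c j
    unfolding G'_def by blast
  have G'E: "\<exists>v c j. (v, c) \<in> G \<and> u = (\<lambda>\<beta>. v \<beta> + j * e \<beta>) \<and> d = c * r powi j" if "(u, d) \<in> G'" for u d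
    using that unfolding G'_def by blast
  have "hom_graph G'"
    unfolding hom_graph_def
  proof (intro conjI allI impI)
    show "(\<lambda>_. 0, 1) \<in> G'" by (rule G'I[OF hom_graph_zero[OF G], of _ 0]) simp_all
    fix u d assume "(u, d) \<in> G'"
    then obtain v c j where v: "(v, c) \<in> G" "u = (\<lambda>\<beta>. v \<beta> + j * e \<beta>)" "d = c * r powi j" using G'E by blast
    show "(\<lambda>\<beta>. - u \<beta>, inverse d) \<in> G'"
      by (rule G'I[OF hom_graph_neg[OF G v(1)], of _ "- j"]) (simp_all add: v power_int_minus)
    show "d \<noteq> 0" using hom_graph_nz[OF G v(1)] r(1) v(3) by simp
    fix u' d' assume "(u', d') \<in> G'"
    then obtain v' c' j' where v': "(v', c') \<in> G" "u' = (\<lambda>\<beta>. v' \<beta> + j' * e \<beta>)" "d' = c' * r powi j'" using G'E by blast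
    show "(\<lambda>\<beta>. u \<beta> + u' \<beta>, d * d') \<in> G'"
      by (rule G'I[OF hom_graph_add[OF G v(1) v'(1)], of _ "j + j'"])
        (simp_all add: v v' algebra_simps power_int_add r(1))
  next
    fix d assume "(\<lambda>_. 0, d) \<in> G'"
    then obtain v c j where v: "(v, c) \<in> G" "(\<lambda>_. 0) = (\<lambda>\<beta>. v \<beta> + j * e \<beta>)" "d = c * r powi j" using G'E by blast
    have "v = (\<lambda>\<beta>. - j * e \<beta>)" using v(2) by (auto simp: fun_eq_iff algebra_simps) (metis add.inverse_unique add.commute)
    then have "c = r powi (- j)" using v(1) rJ by blast
    then show "d = 1" using v(3) r(1) by (simp add: power_int_minus)
  qed
  moreover have "G \<subseteq> G'"
  proof
    fix x assume "x \<in> G"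
    moreover obtain v c where "x = (v, c)" by (cases x)
    ultimately show "x \<in> G'" using G'I[of v c v 0 c] by simp
  qed
  moreover have "(e, r) \<in> G'" by (rule G'I[OF hom_graph_zero[OF G], of _ 1]) simp_all
  ultimately show thesis using that by blast
qed

text \<open>The multiplicative group of an algebraically closed field is divisible, so that every
  homomorphism from a subgroup of a lattice into it extends to the lattice.\<close>

lemma hom_graph_character:
  fixes G :: "(('b::finite \<Rightarrow> int) \<times> 'a::alg_closed_field) set"
  assumes G: "hom_graph G"
  obtains \<theta> where "\<And>\<beta>. \<theta> \<beta> \<noteq> 0" "\<And>v c. (v, c) \<in> G \<Longrightarrow> c = (\<Prod>\<beta>\<in>UNIV. \<theta> \<beta> powi v \<beta>)"
proof -
  define e where "e \<alpha> = (\<lambda>\<beta>. if \<beta> = \<alpha> then 1 else 0 :: int)" for \<alpha> :: 'b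
  have "\<exists>G'. hom_graph G' \<and> G \<subseteq> G' \<and> (\<forall>\<alpha>\<in>S. \<exists>r. (e \<alpha>, r) \<in> G')" for S
    using finite[of S]
  proof (induction S rule: finite_induct)
    case empty then show ?case using G by blast
  next
    case (insert \<alpha> S)
    then obtain G' where G': "hom_graph G'" "G \<subseteq> G'" "\<forall>\<alpha>\<in>S. \<exists>r. (e \<alpha>, r) \<in> G'" by blast
    obtain G'' r where G'': "hom_graph G''" "G' \<subseteq> G''" "(e \<alpha>, r) \<in> G''"
      by (rule hom_graph_extend[OF G'(1), of "e \<alpha>"], rule that, assumption+)
    have "\<forall>\<alpha>'\<in>insert \<alpha> S. \<exists>r. (e \<alpha>', r) \<in> G''" using G'(3) G''(2,3) by blast
    then show ?case using G''(1,2) G'(2) by blast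
  qed
  then obtain G' where G': "hom_graph G'" "G \<subseteq> G'" "\<forall>\<alpha>\<in>UNIV. \<exists>r. (e \<alpha>, r) \<in> G'" by blast
  then have "\<forall>\<alpha>. \<exists>r. (e \<alpha>, r) \<in> G'" by blast
  from choice[OF this] obtain \<theta> where \<theta>: "\<And>\<alpha>. (e \<alpha>, \<theta> \<alpha>) \<in> G'" by blast
  show thesis
  proof (rule that[of \<theta>])
    show "\<theta> \<beta> \<noteq> 0" for \<beta> by (rule hom_graph_nz[OF G'(1) \<theta>])
    fix v c assume "(v, c) \<in> G"
    then have 1: "(v, c) \<in> G'" using G'(2) by blast
    have "(\<lambda>\<beta>. \<Sum>\<alpha>\<in>UNIV. v \<alpha> * e \<alpha> \<beta>, \<Prod>\<alpha>\<in>UNIV. \<theta> \<alpha> powi v \<alpha>) \<in> G'"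
      by (rule hom_graph_sum[OF G'(1) finite]) (rule hom_graph_int_mult[OF G'(1) \<theta>])
    moreover have "(\<Sum>\<alpha>\<in>UNIV. v \<alpha> * e \<alpha> \<beta>) = v \<beta>" for \<beta>
    proof -
      have "v \<alpha> * e \<alpha> \<beta> = (if \<alpha> = \<beta> then v \<beta> else 0)" for \<alpha> by (auto simp: e_def)
      then show ?thesis by (simp add: sum.delta)
    qed
    ultimately have "(v, \<Prod>\<alpha>\<in>UNIV. \<theta> \<alpha> powi v \<alpha>) \<in> G'" by simp
    from hom_graph_unique[OF G'(1) 1 this] show "c = (\<Prod>\<beta>\<in>UNIV. \<theta> \<beta> powi v \<beta>)" .
  qed
qed

section \<open>Separating orbits by determinantal invariants\<close>

text \<open>The matrix \<open>A\<close> carries a Krylov basis of the first point to the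
  corresponding vectors of the second and has determinant 1, as the two determinants agree. By
  Cramer's rule it carries every Krylov vector to its counterpart, so it maps \<open>w\<close> to
  \<open>w'\<close> and intertwines \<open>M\<close> with \<open>M'\<close>.\<close>

lemma same_dforms_same_orbit:
  fixes M M' :: "'a::field^'n::finite^'n" and w w' :: "'m::finite \<Rightarrow> 'a^'n"
  assumes eq: "\<And>B. dform B (M, w) = dform B (M', w')" and B0: "dform B0 (M, w) \<noteq> 0"
  shows "\<exists>A\<in>SL. act A (M, w) = (M', w')"
proof -
  define r where "r e = kry M (w (fst e)) (snd e)" for e :: "'m \<times> nat"
  define r' where "r' e = kry M' (w' (fst e)) (snd e)" for e :: "'m \<times> nat"
  define b where "b j = r (B0 j)" for j
  define b' where "b' j = r' (B0 j)" for j
  have df: "dform B (M, w) = tdet (\<lambda>j. r (B j))" "dform B (M', w') = tdet (\<lambda>j. r' (B j))" for B :: "'n \<Rightarrow> 'm \<times> nat"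
    by (simp_all add: dform_def r_def r'_def)
  have tb: "tdet b \<noteq> 0" using B0 by (simp add: df b_def)
  have tb': "tdet b' = tdet b" using eq[of B0] by (simp add: df b_def b'_def)
  let ?P = "transpose (\<chi> j. b j)" and ?P' = "transpose (\<chi> j. b' j)"
  have dP: "det ?P \<noteq> 0" using tb by (simp add: det_transpose)
  define A where "A = ?P' ** matrix_inv ?P"
  have AP: "A *v (?P *v c) = ?P' *v c" for c
  proof -
    have "A *v (?P *v c) = ?P' *v ((matrix_inv ?P ** ?P) *v c)"
      unfolding A_def by (simp only: matrix_vector_mul_assoc matrix_mul_assoc)
    then show ?thesis by (simp add: matrix_inv_det[OF dP])
  qed
  have A_SL: "A \<in> SL"
  proof -
    have "det ?P * det (matrix_inv ?P) = 1" by (metis det_I det_mul matrix_inv_det(1)[OF dP])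
    moreover have "det ?P' = det ?P" using tb' by (simp add: det_transpose)
    ultimately show ?thesis by (simp add: A_def SL_def det_mul)
  qed
  have Ar: "A *v r e = r' e" for e
  proof -
    define c where "c = (\<chi> j. tdet (b(j := r e)) / tdet b)"
    \<comment> \<open>Replacing one basis vector by \<open>r e\<close> again gives a determinantal
      form, so numerators and denominators in Cramer's rule agree at both points.\<close>
    have upd: "tdet (b(j := r e)) = tdet (b'(j := r' e))" for j
    proof -
      have "(\<lambda>i. r ((B0(j := e)) i)) = b(j := r e)" "(\<lambda>i. r' ((B0(j := e)) i)) = b'(j := r' e)"
        by (auto simp: b_def b'_def)
      then show ?thesis using eq[of "B0(j := e)"] unfolding df by metis
    qed
    have "r e = ?P *v c" unfolding tuple_sum[symmetric] c_def vec_lambda_beta by (rule tuple_expansion[OF tb])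
    moreover have "r' e = (\<Sum>j\<in>UNIV. (tdet (b'(j := r' e)) / tdet b') *s b' j)"
      by (rule tuple_expansion) (use tb tb' in simp)
    then have "r' e = ?P' *v c" unfolding tuple_sum[symmetric] c_def vec_lambda_beta upd[symmetric] tb' .
    ultimately show ?thesis by (simp only: AP)
  qed
  have Aw: "A *v w i = w' i" for i using Ar[of "(i, 0)"] by (simp add: r_def r'_def)
  have "A *v (M *v v) = M' *v (A *v v)" for v
  proof -
    let ?S = "{v. A *v (M *v v) = M' *v (A *v v)}"
    have "vec.subspace ?S"
      by (rule vec.subspaceI) (simp_all add: matrix_vector_right_distrib vector_scalar_commute)
    moreover have "range b \<subseteq> ?S"
    proof (rule image_subsetI, rule CollectI)
      fix j
      obtain i a where e: "B0 j = (i, a)" by (cases "B0 j")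
      have "A *v (M *v b j) = A *v r (i, Suc a)" by (simp add: b_def e r_def)
      also have "\<dots> = M' *v (A *v b j)" using Ar[of "(i, a)"] by (simp add: Ar b_def e) (simp add: r'_def)
      finally show "A *v (M *v b j) = M' *v (A *v b j)" .
    qed
    ultimately have "vec.span (range b) \<subseteq> ?S" by (rule vec.span_minimal[rotated])
    moreover have "v \<in> vec.span (range b)" using tuple_span_iff[OF tb, of v UNIV] by simp
    ultimately show ?thesis by blast
  qed
  then have "A ** M = M' ** A" unfolding matrix_eq by (simp only: matrix_vector_mul_assoc[symmetric]) simp
  then have "A ** M ** matrix_inv A = M' ** (A ** matrix_inv A)" by (simp add: matrix_mul_assoc)
  then have "A ** M ** matrix_inv A = M'" by (simp add: SL_inv[OF A_SL])
  then have "act A (M, w) = (M', w')" by (simp add: act_def Aw)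
  then show ?thesis using A_SL by blast
qed

section \<open>Stability from strict inequalities\<close>

context stable_data
begin

text \<open>Farkas' lemma for \<open>- e\<close> and the cone spanned by the generator degrees and
  \<open>- tau q\<close>. A separating functional would be nonzero, nonnegative on the generators
  and not positive on \<open>tau q\<close>, against strictness.\<close>

lemma fill:
  fixes e :: "'m option \<Rightarrow> nat"
  assumes strict
  obtains m k c where "m \<ge> 1" "\<And>\<beta>. k * tau q \<beta> = m * e \<beta> + (\<Sum>g\<in>gens (M, w). c g * fst g \<beta>)"
proof -
  \<comment> \<open>\<open>None\<close> stands for the additional vector
    \<open>- tau q\<close>.\<close>
  define A where "A = insert None (Some ` gens (M, w))"
  have finA: "finite A" using gens(1)[of "(M, w)"] by (simp add: A_def)
  define u where "u = case_option (\<lambda>\<beta>. - int (tau q \<beta>)) (\<lambda>g \<beta>. int (fst (g :: ('m option \<Rightarrow> nat) \<times> (('a, 'n, 'm) coords \<Rightarrow> 'a)) \<beta>))"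
  have sumA: "(\<Sum>x\<in>A. f x) = f None + (\<Sum>g\<in>gens (M, w). f (Some g))" for f :: "_ \<Rightarrow> int"
    unfolding A_def using gens(1)[of "(M, w)"] by (simp add: sum.reindex)
  show thesis
  proof (rule farkas_int[OF finA, of "\<lambda>\<beta>. - int (e \<beta>)" u])
    fix m c assume c: "m > 0" "\<And>\<beta>. int m * - int (e \<beta>) = (\<Sum>x\<in>A. int (c x) * u x \<beta>)"
    have "c None * tau q \<beta> = m * e \<beta> + (\<Sum>g\<in>gens (M, w). c (Some g) * fst g \<beta>)" for \<beta>
    proof -
      have "int m * - int (e \<beta>) = - (int (c None) * int (tau q \<beta>)) + (\<Sum>g\<in>gens (M, w). int (c (Some g)) * int (fst g \<beta>))"
        unfolding c(2) sumA by (simp add: u_def)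
      then have "int (c None * tau q \<beta>) = int (m * e \<beta> + (\<Sum>g\<in>gens (M, w). c (Some g) * fst g \<beta>))"
        by (simp only: of_nat_mult of_nat_add of_nat_sum; linarith)
      then show ?thesis by (simp only: of_nat_eq_iff)
    qed
    then show thesis using c(1) by (intro that[of m "c None" "\<lambda>g. c (Some g)"]) simp_all
  next
    fix \<eta> :: "'m option \<Rightarrow> int"
    assume h: "\<And>x. x \<in> A \<Longrightarrow> 0 \<le> (\<Sum>\<beta>\<in>UNIV. \<eta> \<beta> * u x \<beta>)" "(\<Sum>\<beta>\<in>UNIV. \<eta> \<beta> * - int (e \<beta>)) < 0"
    have g: "0 \<le> (\<Sum>\<beta>\<in>UNIV. \<eta> \<beta> * int (fst k \<beta>))" if "k \<in> gens (M, w)" for k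
      using h(1)[of "Some k"] that by (simp add: A_def u_def)
    have "\<exists>\<beta>. \<eta> \<beta> \<noteq> 0"
    proof (rule ccontr)
      assume "\<not> ?thesis"
      then show False using h(2) by simp
    qed
    from functional(2)[OF g assms this] have "0 < (\<Sum>\<beta>\<in>UNIV. \<eta> \<beta> * int (tau q \<beta>))" .
    moreover have "0 \<le> - (\<Sum>\<beta>\<in>UNIV. \<eta> \<beta> * int (tau q \<beta>))"
      using h(1)[of None] by (simp add: A_def u_def sum_negf del: option.case_distrib)
    ultimately show thesis by linarith
  qed
qed

text \<open>A completion of each generator is multiplied into the section, so that none of the
  generators at \<open>(M, w)\<close> vanishes anywhere on the locus of \<open>s\<close>. This is
  what carries strictness to all points of the locus.\<close>

lemma stable_form:
  assumes strict
  obtains m s where "m \<ge> 1" "inv_form (\<lambda>\<beta>. m * tau q \<beta>) s" "s (M, w) \<noteq> 0"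
    "\<And>y D P. s y \<noteq> 0 \<Longrightarrow> (D, P) \<in> gens (M, w) \<Longrightarrow> P y \<noteq> 0"
proof -
  obtain m0 s0 where s0: "m0 \<ge> 1" "inv_form (\<lambda>\<beta>. m0 * tau q \<beta>) s0" "s0 (M, w) \<noteq> 0"
    by (rule semistable_form)
  have "\<exists>R. \<forall>g\<in>gens (M, w). inv_form (\<lambda>\<beta>. fst (R g) * tau q \<beta>) (snd (R g)) \<and> snd (R g) (M, w) \<noteq> 0 \<and>
      (\<forall>y. snd (R g) y \<noteq> 0 \<longrightarrow> snd g y \<noteq> 0)"
  proof (rule bchoice, rule ballI)
    fix g assume "g \<in> gens (M, w)"
    then have g: "inv_form (fst g) (snd g)" "snd g (M, w) \<noteq> 0" using gens(2)[of "fst g" "snd g" "(M, w)"] by simp_all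
    \<comment> \<open>Completes the degree of \<open>g\<close> to a multiple of \<open>tau q\<close>
      by forms that do not vanish at the point, with \<open>g\<close> remaining as a factor.\<close>
    obtain m k c where m: "m \<ge> 1" and e: "\<And>\<beta>. k * tau q \<beta> = m * fst g \<beta> + (\<Sum>h\<in>gens (M, w). c h * fst h \<beta>)"
      by (rule fill[OF assms, of "fst g"], rule that, assumption+)
    define P where "P y = snd g y ^ m * (\<Prod>h\<in>gens (M, w). snd h y ^ c h)" for y
    have "inv_form (\<lambda>\<beta>. k * tau q \<beta>) P"
      unfolding e P_def[abs_def] by (rule inv_form_mult[OF inv_form_power[OF g(1)] gens_pow])
    moreover have "P (M, w) \<noteq> 0" unfolding P_def using g(2) gens_pow_nonzero by simp
    moreover have "snd g y \<noteq> 0" if "P y \<noteq> 0" for y using that m by (auto simp: P_def zero_power)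
    ultimately show "\<exists>r. inv_form (\<lambda>\<beta>. fst r * tau q \<beta>) (snd r) \<and> snd r (M, w) \<noteq> 0 \<and>
        (\<forall>y. snd r y \<noteq> 0 \<longrightarrow> snd g y \<noteq> 0)"
      by (intro exI[of _ "(k, P)"] conjI allI impI; simp only: fst_conv snd_conv not_False_eq_True)
  qed
  then obtain R where R: "\<And>g. g \<in> gens (M, w) \<Longrightarrow> inv_form (\<lambda>\<beta>. fst (R g) * tau q \<beta>) (snd (R g))"
    "\<And>g. g \<in> gens (M, w) \<Longrightarrow> snd (R g) (M, w) \<noteq> 0"
    "\<And>g y. g \<in> gens (M, w) \<Longrightarrow> snd (R g) y \<noteq> 0 \<Longrightarrow> snd g y \<noteq> 0"
    by (elim exE) (rule that; blast)
  define s where "s y = s0 y * (\<Prod>g\<in>gens (M, w). snd (R g) y)" for y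
  show thesis
  proof (rule that[of "m0 + (\<Sum>g\<in>gens (M, w). fst (R g))" s])
    show "1 \<le> m0 + (\<Sum>g\<in>gens (M, w). fst (R g))" using s0(1) by simp
    have "inv_form (\<lambda>\<beta>. m0 * tau q \<beta> + (\<Sum>g\<in>gens (M, w). fst (R g) * tau q \<beta>)) s"
      unfolding s_def[abs_def] by (rule inv_form_mult[OF s0(2) inv_form_prod[OF gens(1) R(1)]])
    then show "inv_form (\<lambda>\<beta>. (m0 + (\<Sum>g\<in>gens (M, w). fst (R g))) * tau q \<beta>) s"
      by (simp only: distrib_right sum_distrib_right)
    show "s (M, w) \<noteq> 0" using s0(3) R(2) gens(1)[of "(M, w)"] by (simp add: s_def)
    show "P y \<noteq> 0" if y: "s y \<noteq> 0" "(D, P) \<in> gens (M, w)" for y D P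
    proof -
      have "snd (R (D, P)) y \<noteq> 0" using y gens(1)[of "(M, w)"] by (auto simp: s_def)
      from R(3)[OF y(2) this] show ?thesis by simp
    qed
  qed
qed

text \<open>If one of the inequalities at \<open>(M', w')\<close> were not strict, the weights of a one-parameter
  subgroup would define a nonzero functional that is nonnegative on all the generators at \<open>(M, w)\<close>
  but not positive on \<open>tau\<close>.\<close>

lemma stable_transfer:
  assumes strict and y: "(M', w') \<in> cone" and nz: "\<And>D P. (D, P) \<in> gens (M, w) \<Longrightarrow> P (M', w') \<noteq> 0"
  shows "stable_data M' w' q True"
proof
  show "M' \<noteq> 0" "\<And>i. w' i \<noteq> 0" using y by (auto simp: cone_def)
  show "q > 0" by (rule q)
  fix \<gamma> H \<delta> assume H: "is_flag \<gamma> H" "ftype M' \<gamma> H \<delta>"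
  obtain \<omega> :: "'m option \<Rightarrow> int" where \<omega>:
    "\<And>D P. inv_form D P \<Longrightarrow> P (M', w') \<noteq> 0 \<Longrightarrow> (\<Sum>\<beta>\<in>UNIV. \<omega> \<beta> * int (D \<beta>)) \<le> 0"
    "(\<Sum>\<beta>\<in>UNIV. \<omega> \<beta> * int (tau q \<beta>)) = int CARD('n) * (\<Sum>t=1..\<gamma>. int (card {i. w' i \<in> H t}))
     - int CARD('m) * (\<Sum>t=1..\<gamma>. int (vec.dim (H t))) - int CARD('n) * \<delta> * int q"
    "\<omega> None = - int CARD('n) * \<delta>" "\<gamma> = 1 \<Longrightarrow> \<exists>i. \<omega> (Some i) \<noteq> 0"
    by (rule flag_weight[OF H(1) ftype_up[OF H] ftype_down[OF H] y, where q = q]; (rule that; assumption)?)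
  have pos: "0 \<le> (\<Sum>\<beta>\<in>UNIV. - \<omega> \<beta> * int (fst k \<beta>))" if "k \<in> gens (M, w)" for k
  proof -
    have "inv_form (fst k) (snd k)" using gens(2)[of "fst k" "snd k" "(M, w)"] that by simp
    from \<omega>(1)[OF this] nz[of "fst k" "snd k"] that show ?thesis by (simp add: sum_negf)
  qed
  have "\<exists>\<beta>. - \<omega> \<beta> \<noteq> 0"
  proof (cases "\<delta> = 0")
    case True
    then have "\<gamma> = 1" using H(2) by (simp add: ftype_def)
    then show ?thesis using \<omega>(4) by auto
  next
    case False
    then have "- \<omega> None \<noteq> 0" by (simp add: \<omega>(3))
    then show ?thesis by blast
  qed
  from functional(2)[OF pos assms(1) this]
  have "(\<Sum>\<beta>\<in>UNIV. \<omega> \<beta> * int (tau q \<beta>)) < 0" by (simp add: sum_negf)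
  then have "real_of_int (\<Sum>\<beta>\<in>UNIV. \<omega> \<beta> * int (tau q \<beta>)) < 0" by (simp only: of_int_less_0_iff)
  then have "real CARD('n) * ((\<Sum>t=1..\<gamma>. excess w' (H t)) - real_of_int \<delta> * real q) < 0"
    unfolding \<omega>(2) excess_int_diff .
  then show "lt True (\<Sum>t=1..\<gamma>. excess w' (H t)) (real_of_int \<delta> * real q)"
    by (simp add: lt_def mult_less_0_iff)
qed

lemma dform_nonzero_ex: "\<exists>B. dform B (M, w) \<noteq> 0"
proof -
  obtain b where b: "\<And>j :: 'n. b j \<in> (\<lambda>e. kry M (w (fst e)) (snd e)) ` {e. snd e < CARD('n)}" "tdet b \<noteq> 0"
    by (rule basis_tuple[OF krylov_spans], rule that, assumption+)
  have "\<forall>j. \<exists>e. kry M (w (fst e)) (snd e) = b j"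
  proof
    fix j show "\<exists>e. kry M (w (fst e)) (snd e) = b j" using b(1)[of j] by force
  qed
  from choice[OF this] obtain B where "\<And>j. kry M (w (fst (B j))) (snd (B j)) = b j" by blast
  then have "dform B (M, w) = tdet b" by (simp add: dform_def)
  then show ?thesis using b(2) by (intro exI[of _ B]) simp
qed

text \<open>A stabilizing matrix rescales the coordinates by some \<theta>, on which the degree of
  every nonvanishing invariant form has the value 1. By \<open>fill\<close> each component of
  \<theta> is a root of unity of bounded order, and for given \<theta> the matrix is unique because
  the Krylov vectors span.\<close>

lemma finite_stabilizer:
  assumes strict shows "finite (stabilizer (pt (M, w)))"
proof -
  obtain m s where s: "m \<ge> 1" "inv_form (\<lambda>\<beta>. m * tau q \<beta>) s" "s (M, w) \<noteq> 0"
    by (rule semistable_form)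
  define fixed where "fixed \<theta> = {A \<in> SL. act A (M, w) = hscale \<theta> (M, w)}" for \<theta>
  have char: "(\<Prod>\<beta>\<in>UNIV. \<theta> \<beta> ^ D \<beta>) = 1" if "A \<in> fixed \<theta>" "inv_form D P" "P (M, w) \<noteq> 0" for A \<theta> D P
  proof -
    have "P (M, w) = P (hscale \<theta> (M, w))" using that inv_form_act[OF that(2), of A "(M, w)"] by (simp add: fixed_def)
    then show ?thesis using that(3) by (simp add: inv_form_hscale[OF that(2)])
  qed
  have "\<exists>N\<ge>1. \<forall>A \<theta>. A \<in> fixed \<theta> \<longrightarrow> \<theta> \<alpha> ^ N = 1" for \<alpha> :: "'m option"
  proof -
    obtain m' k c where f: "m' \<ge> 1" "\<And>\<beta>. k * tau q \<beta> = m' * (if \<beta> = \<alpha> then 1 else 0) + (\<Sum>g\<in>gens (M, w). c g * fst g \<beta>)"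
      by (rule fill[OF assms, of "\<lambda>\<beta>. if \<beta> = \<alpha> then 1 else 0"], rule that, assumption+)
    have "\<theta> \<alpha> ^ (m' * m) = 1" if A: "A \<in> fixed \<theta>" for A and \<theta> :: "'m option \<Rightarrow> 'a"
    proof -
      have 1: "(\<Prod>\<beta>\<in>UNIV. \<theta> \<beta> ^ (\<Sum>g\<in>gens (M, w). c g * fst g \<beta>)) = 1"
        by (rule char[OF A gens_pow gens_pow_nonzero])
      have 2: "(\<Prod>\<beta>\<in>UNIV. \<theta> \<beta> ^ (m * tau q \<beta>)) = 1" by (rule char[OF A s(2,3)])
      have "(\<Prod>\<beta>\<in>UNIV. \<theta> \<beta> ^ (k * tau q \<beta>)) = (\<Prod>\<beta>\<in>UNIV. (\<theta> \<beta> ^ (if \<beta> = \<alpha> then 1 else 0)) ^ m') * (\<Prod>\<beta>\<in>UNIV. \<theta> \<beta> ^ (\<Sum>g\<in>gens (M, w). c g * fst g \<beta>))"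
        unfolding f(2) power_add prod.distrib by (simp add: power_mult[symmetric] mult.commute)
      also have "\<dots> = \<theta> \<alpha> ^ m'" unfolding 1 prod_power_distrib[symmetric] prod_delta_power by simp
      finally have 3: "(\<Prod>\<beta>\<in>UNIV. \<theta> \<beta> ^ (k * tau q \<beta>)) = \<theta> \<alpha> ^ m'" .
      \<comment> \<open>The value of \<theta> at \<open>m * tau q\<close> is 1, so the value at
        \<open>k * tau q\<close>, which is \<open>\<theta> \<alpha> ^ m'\<close>, becomes 1 after
        raising to the power \<open>m\<close>.\<close>
      have "\<theta> \<alpha> ^ (m' * m) = (\<Prod>\<beta>\<in>UNIV. \<theta> \<beta> ^ (k * tau q \<beta>)) ^ m" unfolding 3 by (simp add: power_mult)
      also have "\<dots> = (\<Prod>\<beta>\<in>UNIV. \<theta> \<beta> ^ (m * tau q \<beta>)) ^ k"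
        unfolding prod_power_distrib power_mult[symmetric] by (simp add: mult_ac)
      finally show ?thesis by (simp add: 2)
    qed
    then show ?thesis using f(1) s(1) by (intro exI[of _ "m' * m"]) (simp add: Suc_le_eq)
  qed
  then have "\<forall>\<alpha> :: 'm option. \<exists>N. N \<ge> 1 \<and> (\<forall>A \<theta>. A \<in> fixed \<theta> \<longrightarrow> \<theta> \<alpha> ^ N = 1)" by blast
  from choice[OF this] obtain N where N: "\<And>\<alpha>. N \<alpha> \<ge> 1" "\<And>\<alpha> A \<theta>. A \<in> fixed \<theta> \<Longrightarrow> \<theta> \<alpha> ^ N \<alpha> = 1" by blast
  define \<Theta> where "\<Theta> = PiE (UNIV :: 'm option set) (\<lambda>\<alpha>. {t :: 'a. t \<noteq> 0 \<and> t powi int (N \<alpha>) = 1})"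
  have fin\<Theta>: "finite \<Theta>"
    unfolding \<Theta>_def
  proof (intro finite_PiE)
    show "finite {t :: 'a. t \<noteq> 0 \<and> t powi int (N \<alpha>) = 1}" for \<alpha>
      using N(1)[of \<alpha>] by (intro powi_root_finite) simp
  qed simp
  have "stabilizer (pt (M, w)) \<subseteq> (\<Union>\<theta>\<in>\<Theta>. fixed \<theta>)"
  proof
    fix A assume "A \<in> stabilizer (pt (M, w))"
    then have A: "A \<in> SL" "pt (M, w) = pt (act A (M, w))" by (simp_all add: stabilizer_def act_pt_pt)
    obtain \<theta> where \<theta>: "\<And>\<beta>. \<theta> \<beta> \<noteq> 0" "act A (M, w) = hscale \<theta> (M, w)"
      by (rule pt_eqD[OF A(2) cone_Mw act_in_cone[OF A(1) cone_Mw]], rule that, assumption+)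
    then have f: "A \<in> fixed \<theta>" using A(1) by (simp add: fixed_def)
    then have "\<theta> \<in> \<Theta>" using N(2) \<theta>(1) by (auto simp: \<Theta>_def PiE_def)
    then show "A \<in> (\<Union>\<theta>\<in>\<Theta>. fixed \<theta>)" using f by blast
  qed
  moreover have "finite (fixed \<theta>)" for \<theta>
  proof -
    have uniq: "A = A'" if "A \<in> fixed \<theta>" "A' \<in> fixed \<theta>" for A A'
    proof -
      have SL: "det A \<noteq> 0" "det A' \<noteq> 0" using that by (auto simp: fixed_def SL_def)
      have "act A (M, w) = act A' (M, w)" using that by (simp add: fixed_def)
      then have e: "A ** M ** matrix_inv A = A' ** M ** matrix_inv A'" "\<And>i. A *v w i = A' *v w i"
        by (auto simp: act_def fun_eq_iff)
      have k: "A *v kry M (w i) a = A' *v kry M (w i) a" for i a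
        unfolding kry_conj[OF SL(1), symmetric] kry_conj[OF SL(2), symmetric] e ..
      have "vec.subspace {v. A *v v = A' *v v}"
        by (rule vec.subspaceI) (simp_all add: matrix_vector_right_distrib vector_scalar_commute)
      then have "vec.span ((\<lambda>e. kry M (w (fst e)) (snd e)) ` {e. snd e < CARD('n)}) \<subseteq> {v. A *v v = A' *v v}"
        by (rule vec.span_minimal[rotated]) (auto simp: k)
      then have "A *v v = A' *v v" for v unfolding krylov_spans by blast
      then show ?thesis by (simp add: matrix_eq)
    qed
    show ?thesis
    proof (cases "fixed \<theta> = {}")
      case False
      then obtain A where "A \<in> fixed \<theta>" by blast
      then have "fixed \<theta> \<subseteq> {A}" using uniq by blast
      then show ?thesis by (rule finite_subset) simp
    qed simp
  qed
  ultimately show ?thesis using fin\<Theta> by (meson finite_UN_I finite_subset)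
qed

end

section \<open>Orbits of stable points are closed\<close>

text \<open>A point \<open>x\<close> of the locus of \<open>s\<close> at which all the invariant
  functions \<open>P / s^k\<close> take the same values as at \<open>(M, w)\<close>; it is to be
  shown that \<open>x\<close> lies in the orbit.\<close>

locale matched_point = stable_data M w q True
  for M :: "'a::alg_closed_field^'n::finite^'n" and w :: "'m::finite \<Rightarrow> 'a^'n" and q +
  fixes m s x
  assumes s: "m \<ge> 1" "inv_form (\<lambda>\<beta>. m * tau q \<beta>) s" "s (M, w) \<noteq> 0" and x: "x \<in> cone" "s x \<noteq> 0"
    and match: "\<And>k P. inv_form (\<lambda>\<beta>. k * (m * tau q \<beta>)) P \<Longrightarrow> P (M, w) * s x ^ k = P x * s (M, w) ^ k"
begin

lemma complement:
  assumes P: "inv_form e P" "P (M, w) \<noteq> 0"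
  obtains k E R where "inv_form E R" "R (M, w) \<noteq> 0" "\<And>\<beta>. e \<beta> + E \<beta> = k * (m * tau q \<beta>)"
proof -
  obtain j k c where j: "j \<ge> 1" and e: "\<And>\<beta>. k * tau q \<beta> = j * e \<beta> + (\<Sum>g\<in>gens (M, w). c g * fst g \<beta>)"
    by (rule fill[OF TrueI, of e], rule that, assumption+)
  define G where "G z = (\<Prod>g\<in>gens (M, w). snd g z ^ c g)" for z
  define F where "F z = P z ^ j * G z" for z
  have G: "inv_form (\<lambda>\<beta>. \<Sum>g\<in>gens (M, w). c g * fst g \<beta>) G" unfolding G_def[abs_def] by (rule gens_pow)
  have G0: "G (M, w) \<noteq> 0" unfolding G_def by (rule gens_pow_nonzero)
  have F: "inv_form (\<lambda>\<beta>. k * tau q \<beta>) F"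
    unfolding F_def[abs_def] e by (rule inv_form_mult[OF inv_form_power[OF P(1)] G])
  show thesis
  proof (rule that)
    \<comment> \<open>From \<open>P^j * G\<close> of degree \<open>k * tau q\<close> one factor
      \<open>P\<close> is left out; the remaining \<open>m - 1\<close> copies of \<open>F\<close>
      raise the total degree to \<open>k * (m * tau q)\<close>.\<close>
    show "inv_form (\<lambda>\<beta>. ((j - 1) * e \<beta> + (\<Sum>g\<in>gens (M, w). c g * fst g \<beta>)) + (m - 1) * (k * tau q \<beta>))
        (\<lambda>z. (P z ^ (j - 1) * G z) * F z ^ (m - 1))"
      by (rule inv_form_mult[OF inv_form_mult[OF inv_form_power[OF P(1)] G] inv_form_power[OF F]])
    show "(P (M, w) ^ (j - 1) * G (M, w)) * F (M, w) ^ (m - 1) \<noteq> 0"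
      using P(2) G0 by (simp add: F_def)
    fix \<beta>
    have "j * e \<beta> = e \<beta> + (j - 1) * e \<beta>" "m * (k * tau q \<beta>) = k * tau q \<beta> + (m - 1) * (k * tau q \<beta>)"
      by (subst mult_Suc[symmetric], use j s(1) in simp)+
    then show "e \<beta> + ((j - 1) * e \<beta> + (\<Sum>g\<in>gens (M, w). c g * fst g \<beta>) + (m - 1) * (k * tau q \<beta>)) = k * (m * tau q \<beta>)"
      using e[of \<beta>] by (simp only: mult.left_commute[of k m] add.assoc)
  qed
qed

text \<open>From \<open>(M, w)\<close> to \<open>x\<close>, multiplying by a complement reduces to
  \<open>match\<close>. Conversely, \<open>P\<close> is completed by generators alone, and these do
  not vanish at \<open>x\<close> by the first direction.\<close>

lemma nonzero_iff:
  assumes P: "inv_form e P" shows "P x \<noteq> 0 \<longleftrightarrow> P (M, w) \<noteq> 0"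
proof -
  have right: "Q x \<noteq> 0" if Q: "inv_form D Q" "Q (M, w) \<noteq> 0" for D Q
  proof -
    obtain k E R where R: "inv_form E R" "R (M, w) \<noteq> 0" and D: "\<And>\<beta>. D \<beta> + E \<beta> = k * (m * tau q \<beta>)"
      by (rule complement[OF Q], rule that, assumption+)
    have "inv_form (\<lambda>\<beta>. k * (m * tau q \<beta>)) (\<lambda>z. Q z * R z)"
      unfolding D[symmetric] by (rule inv_form_mult[OF Q(1) R(1)])
    from match[OF this] show ?thesis using Q(2) R(2) x(2) by auto
  qed
  have "P (M, w) \<noteq> 0" if nz: "P x \<noteq> 0"
  proof -
    obtain j k c where j: "j \<ge> 1" and e: "\<And>\<beta>. k * tau q \<beta> = j * e \<beta> + (\<Sum>g\<in>gens (M, w). c g * fst g \<beta>)"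
      by (rule fill[OF TrueI, of e], rule that, assumption+)
    define F where "F z = P z ^ j * (\<Prod>g\<in>gens (M, w). snd g z ^ c g)" for z
    have "inv_form (\<lambda>\<beta>. k * tau q \<beta>) F"
      unfolding F_def[abs_def] e by (rule inv_form_mult[OF inv_form_power[OF P(1)] gens_pow])
    then have "inv_form (\<lambda>\<beta>. m * (k * tau q \<beta>)) (\<lambda>z. F z ^ m)" by (rule inv_form_power)
    then have "inv_form (\<lambda>\<beta>. k * (m * tau q \<beta>)) (\<lambda>z. F z ^ m)" by (simp only: mult.left_commute)
    note eq = match[OF this]
    have "snd g x \<noteq> 0" if g: "g \<in> gens (M, w)" for g
    proof -
      have "inv_form (fst g) (snd g)" "snd g (M, w) \<noteq> 0" using gens(2)[of "fst g" "snd g" "(M, w)"] g by simp_all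
      then show ?thesis by (rule right)
    qed
    then have "F x \<noteq> 0" unfolding F_def using nz gens(1)[of "(M, w)"] by simp
    then have "F (M, w) ^ m * s x ^ k \<noteq> 0" unfolding eq using s(3) by simp
    then have "F (M, w) ^ m \<noteq> 0" by (rule contrapos_nn) simp
    then have "F (M, w) \<noteq> 0" using s(1) by (auto simp: zero_power)
    then show ?thesis using j by (auto simp: F_def zero_power)
  qed
  then show ?thesis using right[OF P] by blast
qed

text \<open>Both forms are multiplied by the same complement, whose values are nonzero at both
  points and cancel.\<close>

lemma proportional:
  assumes P: "inv_form e P" "P (M, w) \<noteq> 0" and Q: "inv_form e Q"
  shows "Q (M, w) * P x = Q x * P (M, w)"
proof -
  obtain k E R where R: "inv_form E R" "R (M, w) \<noteq> 0" and e: "\<And>\<beta>. e \<beta> + E \<beta> = k * (m * tau q \<beta>)"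
    by (rule complement[OF P], rule that, assumption+)
  have "inv_form (\<lambda>\<beta>. k * (m * tau q \<beta>)) (\<lambda>z. P z * R z)" "inv_form (\<lambda>\<beta>. k * (m * tau q \<beta>)) (\<lambda>z. Q z * R z)"
    unfolding e[symmetric] by (rule inv_form_mult[OF P(1) R(1)], rule inv_form_mult[OF Q R(1)])
  note eq = match[OF this(1)] match[OF this(2)]
  have nz: "R x \<noteq> 0" "s x ^ k \<noteq> 0" "s (M, w) ^ k \<noteq> 0" using nonzero_iff[OF R(1)] R(2) x(2) s(3) by simp_all
  have "(Q (M, w) * P x) * (R (M, w) * R x * s x ^ k * s (M, w) ^ k)
      = (Q (M, w) * R (M, w) * s x ^ k) * (P x * R x * s (M, w) ^ k)"
    by (simp only: mult_ac)
  also have "\<dots> = (Q x * R x * s (M, w) ^ k) * (P (M, w) * R (M, w) * s x ^ k)"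
    unfolding eq ..
  also have "\<dots> = (Q x * P (M, w)) * (R (M, w) * R x * s x ^ k * s (M, w) ^ k)"
    by (simp only: mult_ac)
  finally show ?thesis using nz(1) R(2) x(2) s(3) by simp
qed

text \<open>By the preceding lemma, \<open>P (M, w) / P x\<close> depends only on the degree of \<open>P\<close>; a character of
  the group of all degrees extending it provides the scalars that adjust \<open>x\<close>.\<close>

lemma torus_adjustment:
  obtains \<theta> where "\<And>\<beta>. \<theta> \<beta> \<noteq> 0" "\<And>D P. inv_form D P \<Longrightarrow> P (M, w) = P (hscale \<theta> x)"
proof -
  \<comment> \<open>Differences of degrees of forms that do not vanish at \<open>(M, w)\<close>, so
    that the domain is a subgroup. The value at 0 is unique by \<open>proportional\<close>.\<close>
  define G where "G = {(v, c). \<exists>D1 P1 D2 P2. inv_form D1 P1 \<and> inv_form D2 P2 \<and> P1 (M, w) \<noteq> 0 \<and> P2 (M, w) \<noteq> 0 \<and>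
    v = (\<lambda>\<beta>. int (D1 \<beta>) - int (D2 \<beta>)) \<and> c = (P1 (M, w) / P1 x) / (P2 (M, w) / P2 x)}"
  have GI: "(\<lambda>\<beta>. int (D1 \<beta>) - int (D2 \<beta>), (P1 (M, w) / P1 x) / (P2 (M, w) / P2 x)) \<in> G"
    if "inv_form D1 P1" "inv_form D2 P2" "P1 (M, w) \<noteq> 0" "P2 (M, w) \<noteq> 0" for D1 P1 D2 P2
    unfolding G_def mem_Collect_eq prod.case
    by (rule exI[of _ D1], rule exI[of _ P1], rule exI[of _ D2], rule exI[of _ P2]) (intro conjI that refl)
  have GE: "\<exists>D1 P1 D2 P2. inv_form D1 P1 \<and> inv_form D2 P2 \<and> P1 (M, w) \<noteq> 0 \<and> P2 (M, w) \<noteq> 0 \<and>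
    v = (\<lambda>\<beta>. int (D1 \<beta>) - int (D2 \<beta>)) \<and> c = (P1 (M, w) / P1 x) / (P2 (M, w) / P2 x)" if "(v, c) \<in> G" for v c
    using that unfolding G_def mem_Collect_eq prod.case .
  have hG: "hom_graph G"
    unfolding hom_graph_def
  proof (intro conjI allI impI)
    show "(\<lambda>_. 0, 1) \<in> G" using GI[OF inv_form_one inv_form_one] by simp
  next
    fix v c v' c' assume vc: "(v, c) \<in> G" "(v', c') \<in> G"
    obtain D1 P1 D2 P2 D3 P3 D4 P4 where
      P: "inv_form D1 P1" "inv_form D2 P2" "P1 (M, w) \<noteq> 0" "P2 (M, w) \<noteq> 0"
        "inv_form D3 P3" "inv_form D4 P4" "P3 (M, w) \<noteq> 0" "P4 (M, w) \<noteq> 0" and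
      v: "v = (\<lambda>\<beta>. int (D1 \<beta>) - int (D2 \<beta>))" "c = (P1 (M, w) / P1 x) / (P2 (M, w) / P2 x)"
        "v' = (\<lambda>\<beta>. int (D3 \<beta>) - int (D4 \<beta>))" "c' = (P3 (M, w) / P3 x) / (P4 (M, w) / P4 x)"
      using GE[OF vc(1)] GE[OF vc(2)] by (elim exE conjE) (rule that; assumption)
    have "(\<lambda>\<beta>. int (D1 \<beta> + D3 \<beta>) - int (D2 \<beta> + D4 \<beta>), (P1 (M, w) * P3 (M, w) / (P1 x * P3 x)) /
        (P2 (M, w) * P4 (M, w) / (P2 x * P4 x))) \<in> G"
      by (rule GI[OF inv_form_mult[OF P(1,5)] inv_form_mult[OF P(2,6)]]) (use P in simp_all)
    moreover have "(\<lambda>\<beta>. int (D1 \<beta> + D3 \<beta>) - int (D2 \<beta> + D4 \<beta>)) = (\<lambda>\<beta>. v \<beta> + v' \<beta>)"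
      by (simp add: v algebra_simps)
    moreover have "(P1 (M, w) * P3 (M, w) / (P1 x * P3 x)) / (P2 (M, w) * P4 (M, w) / (P2 x * P4 x)) = c * c'"
      by (simp add: v mult_ac)
    ultimately show "(\<lambda>\<beta>. v \<beta> + v' \<beta>, c * c') \<in> G" by simp
  next
    fix v c assume vc: "(v, c) \<in> G"
    obtain D1 P1 D2 P2 where
      P: "inv_form D1 P1" "inv_form D2 P2" "P1 (M, w) \<noteq> 0" "P2 (M, w) \<noteq> 0" and
      v: "v = (\<lambda>\<beta>. int (D1 \<beta>) - int (D2 \<beta>))" "c = (P1 (M, w) / P1 x) / (P2 (M, w) / P2 x)"
      using GE[OF vc] by (elim exE conjE) (rule that; assumption)
    from GI[OF P(2,1,4,3)] show "(\<lambda>\<beta>. - v \<beta>, inverse c) \<in> G" by (simp add: v mult.commute)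
    show "c \<noteq> 0" using P nonzero_iff[OF P(1)] nonzero_iff[OF P(2)] by (simp add: v)
  next
    fix c assume vc: "((\<lambda>_. 0), c) \<in> G"
    obtain D1 P1 D2 P2 where
      P: "inv_form D1 P1" "inv_form D2 P2" "P1 (M, w) \<noteq> 0" "P2 (M, w) \<noteq> 0" and
      v: "(\<lambda>_. 0) = (\<lambda>\<beta>. int (D1 \<beta>) - int (D2 \<beta>))" "c = (P1 (M, w) / P1 x) / (P2 (M, w) / P2 x)"
      using GE[OF vc] by (elim exE conjE) (rule that; assumption)
    have "D1 = D2"
    proof
      fix \<beta> show "D1 \<beta> = D2 \<beta>" using fun_cong[OF v(1), of \<beta>] by simp
    qed
    then have "inv_form D2 P1" using P(1) by simp
    note eq = proportional[OF P(2,4) this]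
    have nz: "P1 x \<noteq> 0" "P2 x \<noteq> 0" using P(3,4) nonzero_iff[OF P(1)] nonzero_iff[OF P(2)] by simp_all
    have "c = (P1 (M, w) * P2 x) / (P1 x * P2 (M, w))" unfolding v(2) by simp
    also have "\<dots> = 1" unfolding eq using nz(1) P(4) by simp
    finally show "c = 1" .
  qed
  obtain \<theta> where \<theta>: "\<And>\<beta>. \<theta> \<beta> \<noteq> 0" "\<And>v c. (v, c) \<in> G \<Longrightarrow> c = (\<Prod>\<beta>\<in>UNIV. \<theta> \<beta> powi v \<beta>)"
    by (rule hom_graph_character[OF hG]) (rule that, assumption+)
  show thesis
  proof (rule that[of \<theta>])
    show "\<theta> \<beta> \<noteq> 0" for \<beta> by (rule \<theta>(1))
    \<comment> \<open>The character settles the forms that do not vanish; by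
      \<open>nonzero_iff\<close> the others vanish at both points.\<close>
    show "P (M, w) = P (hscale \<theta> x)" if P: "inv_form D P" for D P
    proof (cases "P (M, w) = 0")
      case True
      then have "P x = 0" using nonzero_iff[OF P] by blast
      then show ?thesis unfolding inv_form_hscale[OF P] True by simp
    next
      case False
      have eq: "P (M, w) / P x = (\<Prod>\<beta>\<in>UNIV. \<theta> \<beta> ^ D \<beta>)" using \<theta>(2)[OF GI[OF P inv_form_one False]] by simp
      have nz: "P x \<noteq> 0" using False nonzero_iff[OF P] by blast
      show ?thesis unfolding inv_form_hscale[OF P] by (rule iffD1[OF nonzero_divide_eq_eq[OF nz] eq])
    qed
  qed
qed

lemma in_orbit: "pt x \<in> orbit (pt (M, w))"
proof -
  obtain \<theta> where \<theta>: "\<And>\<beta>. \<theta> \<beta> \<noteq> 0" "\<And>D P. inv_form D P \<Longrightarrow> P (M, w) = P (hscale \<theta> x)"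
    by (rule torus_adjustment) (rule that; assumption)
  obtain M' w' where h: "hscale \<theta> x = (M', w')" by (cases "hscale \<theta> x")
  obtain B0 where "dform B0 (M, w) \<noteq> 0" using dform_nonzero_ex by blast
  moreover have "dform B (M, w) = dform B (M', w')" for B
    unfolding h[symmetric] by (rule \<theta>(2)[OF inv_form_dform])
  ultimately obtain A where A: "A \<in> SL" "act A (M, w) = (M', w')"
    using same_dforms_same_orbit by blast
  have "pt x = pt (act A (M, w))" unfolding A(2) h[symmetric] by (rule pt_hscale[of \<theta>, OF \<theta>(1), symmetric])
  then show ?thesis unfolding orbit_pt using A(1) by blast
qed

end

context stable_data
begin

text \<open>Within the locus of \<open>s\<close> the orbit is the set of common zeros of the forms
  \<open>f k P\<close>: they vanish on the orbit by invariance, and a common zero is a matched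
  point.\<close>

lemma closed_orbit:
  assumes strict and m: "m \<ge> 1" and s: "inv_form (\<lambda>\<beta>. m * tau q \<beta>) s" "s (M, w) \<noteq> 0"
  shows "closedin (subtopology zariski_X (nonvanishing s)) (orbit (pt (M, w)))"
proof -
  define f where "f k P z = P (M, w) * s z ^ k - P z * s (M, w) ^ k" for k :: nat and P :: "('a, 'n, 'm) coords \<Rightarrow> 'a" and z :: "('a, 'n, 'm) coords"
  define I where "I = {(k, P :: ('a, 'n, 'm) coords \<Rightarrow> 'a). inv_form (\<lambda>\<beta>. k * (m * tau q \<beta>)) P}"
  define U where "U = (\<Union>(k, P)\<in>I. nonvanishing (f k P))"
  have f: "f k P \<in> mhom (\<lambda>\<beta>. k * (m * tau q \<beta>))" if kP: "(k, P) \<in> I" for k P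
  proof -
    have P: "P \<in> mhom (\<lambda>\<beta>. k * (m * tau q \<beta>))" using kP by (simp add: I_def inv_form_mhom)
    show ?thesis unfolding f_def[abs_def]
      using mhom_diff[OF mhom_cmult[OF mhom_power[OF inv_form_mhom[OF s(1)]], of "P (M, w)" k] mhom_cmult[OF P, of "s (M, w) ^ k"]]
      by (simp only: mult.commute[of "s (M, w) ^ k"])
  qed
  have "openin zariski_X U"
    unfolding U_def by (intro openin_Union) (auto intro: openin_nonvanishing f)
  moreover have "nonvanishing s - orbit (pt (M, w)) = U \<inter> nonvanishing s"
  proof (intro equalityI subsetI)
    fix p assume p: "p \<in> nonvanishing s - orbit (pt (M, w))"
    then obtain x where px: "p = pt x" "x \<in> cone" "s x \<noteq> 0" unfolding nonvanishing_def by blast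
    have "p \<in> U"
    proof (rule ccontr)
      assume nU: "p \<notin> U"
      have "P (M, w) * s x ^ k = P x * s (M, w) ^ k" if kP: "inv_form (\<lambda>\<beta>. k * (m * tau q \<beta>)) P" for k P
      proof -
        have kI: "(k, P) \<in> I" using kP by (simp add: I_def)
        then have "pt x \<notin> nonvanishing (f k P)" using nU unfolding U_def px(1) by blast
        then have "f k P x = 0" using pt_in_nonvanishing_iff[OF f[OF kI] px(2)] by blast
        then show ?thesis by (simp add: f_def)
      qed
      then interpret matched_point M w q m s x
        using M0 w0 q ineq assms px(2,3) by unfold_locales auto
      show False using in_orbit p px(1) by blast
    qed
    then show "p \<in> U \<inter> nonvanishing s" using p by blast
  next
    fix p assume p: "p \<in> U \<inter> nonvanishing s"
    then obtain k P where kP: "(k, P) \<in> I" "p \<in> nonvanishing (f k P)" unfolding U_def by blast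
    have "p \<notin> orbit (pt (M, w))"
    proof
      assume "p \<in> orbit (pt (M, w))"
      then obtain A where A: "A \<in> SL" "p = pt (act A (M, w))" unfolding orbit_pt by blast
      have "f k P (act A (M, w)) \<noteq> 0"
        using kP(2) pt_in_nonvanishing_iff[OF f[OF kP(1)] act_in_cone[OF A(1) cone_Mw]] A(2) by blast
      moreover have "P (act A (M, w)) = P (M, w)" using kP(1) inv_form_act[OF _ A(1)] unfolding I_def by blast
      ultimately show False unfolding f_def by (simp add: inv_form_act[OF s(1) A(1)])
    qed
    then show "p \<in> nonvanishing s - orbit (pt (M, w))" using p by blast
  qed
  moreover have "orbit (pt (M, w)) \<subseteq> nonvanishing s"
  proof
    fix p assume "p \<in> orbit (pt (M, w))"
    then obtain A where A: "A \<in> SL" "p = pt (act A (M, w))" unfolding orbit_pt by blast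
    then show "p \<in> nonvanishing s"
      using pt_in_nonvanishing_iff[OF inv_form_mhom[OF s(1)] act_in_cone[OF A(1) cone_Mw]] s(2)
      by (simp add: inv_form_act[OF s(1) A(1)])
  qed
  ultimately show ?thesis
    unfolding closedin_def topspace_subtopology topspace_zariski_X openin_subtopology
    using nonvanishing_subset_XX[of s] by (metis Int_absorb1)
qed

lemma git_semistable_pt: "git_semistable q (\<lambda>_. 1) (pt (M, w))"
proof -
  obtain m s where s: "m \<ge> 1" "inv_form (\<lambda>\<beta>. m * tau q \<beta>) s" "s (M, w) \<noteq> 0"
    by (rule semistable_form) (rule that; assumption)
  have "s \<in> invariant_sections (m * q) (\<lambda>i. m * 1)" using inv_form_invariant_section[OF s(2)] by simp
  moreover have "affine_open (nonvanishing s)" using q by (intro inv_form_affine[OF s(2,1)]) simp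
  moreover have "pt (M, w) \<in> nonvanishing s"
    using pt_in_nonvanishing_iff[OF inv_form_mhom[OF s(2)] cone_Mw] s(3) by blast
  ultimately show ?thesis unfolding git_semistable_def using s(1) by blast
qed

lemma git_stable_pt:
  assumes strict shows "git_stable q (\<lambda>_. 1) (pt (M, w))"
proof -
  obtain m s where s: "m \<ge> 1" "inv_form (\<lambda>\<beta>. m * tau q \<beta>) s" "s (M, w) \<noteq> 0"
    "\<And>y D P. s y \<noteq> 0 \<Longrightarrow> (D, P) \<in> gens (M, w) \<Longrightarrow> P y \<noteq> 0"
    by (rule stable_form[OF assms]) (rule that; assumption)
  have "s \<in> invariant_sections (m * q) (\<lambda>i. m * 1)" using inv_form_invariant_section[OF s(2)] by simp
  moreover have "affine_open (nonvanishing s)" using q by (intro inv_form_affine[OF s(2,1)]) simp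
  moreover have "pt (M, w) \<in> nonvanishing s"
    using pt_in_nonvanishing_iff[OF inv_form_mhom[OF s(2)] cone_Mw] s(3) by blast
  moreover have "closedin (subtopology zariski_X (nonvanishing s)) (orbit p)" if p: "p \<in> nonvanishing s" for p
  proof -
    obtain M' w' where y: "p = pt (M', w')" "(M', w') \<in> cone" "s (M', w') \<noteq> 0"
      using p unfolding nonvanishing_def by auto
    have "P (M', w') \<noteq> 0" if "(D, P) \<in> gens (M, w)" for D P using s(4)[OF y(3) that] .
    \<comment> \<open>Strictness holds at this point too, so \<open>closed_orbit\<close> applies
      there with the same section \<open>s\<close>.\<close>
    then interpret y: stable_data M' w' q True by (rule stable_transfer[OF assms y(2)])
    show ?thesis unfolding y(1) by (rule y.closed_orbit[OF TrueI s(1,2) y(3)])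
  qed
  ultimately show ?thesis unfolding git_stable_def using s(1) finite_stabilizer[OF assms] by blast
qed

end

section \<open>The numerical criteria in homogeneous coordinates\<close>

lemma semistable_criterion:
  fixes M :: "'a::alg_closed_field^'n::finite^'n" and w :: "'m::finite \<Rightarrow> 'a^'n"
  assumes x: "(M, w) \<in> cone" and q: "q > 0"
  shows "git_semistable q (\<lambda>_. 1) (pt (M, w)) \<longleftrightarrow> (\<forall>\<gamma> H \<delta>. is_flag \<gamma> H \<longrightarrow> ftype M \<gamma> H \<delta> \<longrightarrow>
    (\<Sum>t=1..\<gamma>. excess w (H t)) \<le> real_of_int \<delta> * real q)" (is "?l \<longleftrightarrow> ?r")
proof
  assume ?l
  then obtain m s where m: "m \<ge> 1" and s: "s \<in> invariant_sections (m * q) (\<lambda>_. m)" and p: "pt (M, w) \<in> nonvanishing s"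
    unfolding git_semistable_def by auto
  have nz: "s (M, w) \<noteq> 0" using p pt_in_nonvanishing_section_iff[OF _ x] s unfolding invariant_sections_def by blast
  show ?r
  proof (intro allI impI)
    fix \<gamma> H \<delta> assume H: "is_flag \<gamma> H" "ftype M \<gamma> H \<delta>"
    from flag_obstruction(1)[OF H(1) ftype_up[OF H] ftype_down[OF H] x m s nz]
    have "real_of_int (int CARD('n) * (\<Sum>t=1..\<gamma>. int (card {i. w i \<in> H t}))
      - int CARD('m) * (\<Sum>t=1..\<gamma>. int (vec.dim (H t))) - int CARD('n) * \<delta> * int q) \<le> 0"
      unfolding of_int_le_0_iff by linarith
    then show "(\<Sum>t=1..\<gamma>. excess w (H t)) \<le> real_of_int \<delta> * real q"
      unfolding excess_int_diff by (simp add: mult_le_0_iff)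
  qed
next
  assume ?r
  then interpret stable_data M w q False
    using x q by unfold_locales (auto simp: cone_def lt_def)
  show ?l by (rule git_semistable_pt)
qed

lemma stable_criterion:
  fixes M :: "'a::alg_closed_field^'n::finite^'n" and w :: "'m::finite \<Rightarrow> 'a^'n"
  assumes x: "(M, w) \<in> cone" and q: "q > 0"
  shows "git_stable q (\<lambda>_. 1) (pt (M, w)) \<longleftrightarrow> (\<forall>\<gamma> H \<delta>. is_flag \<gamma> H \<longrightarrow> ftype M \<gamma> H \<delta> \<longrightarrow>
    (\<Sum>t=1..\<gamma>. excess w (H t)) < real_of_int \<delta> * real q)" (is "?l \<longleftrightarrow> ?r")
proof
  assume ?l
  then obtain m s where m: "m \<ge> 1" and s: "s \<in> invariant_sections (m * q) (\<lambda>_. m)" and p: "pt (M, w) \<in> nonvanishing s"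
    and fin: "finite (stabilizer (pt (M, w)))"
    and cl: "\<forall>y\<in>nonvanishing s. closedin (subtopology zariski_X (nonvanishing s)) (orbit y)"
    unfolding git_stable_def by auto
  have nz: "s (M, w) \<noteq> 0" using p pt_in_nonvanishing_section_iff[OF _ x] s unfolding invariant_sections_def by blast
  show ?r
  proof (intro allI impI)
    fix \<gamma> H \<delta> assume H: "is_flag \<gamma> H" "ftype M \<gamma> H \<delta>"
    note ob = flag_obstruction[OF H(1) ftype_up[OF H] ftype_down[OF H] x m s nz]
    \<comment> \<open>Equality would give the closed orbit an infinite stabilizer.\<close>
    have "int CARD('n) * (\<Sum>t=1..\<gamma>. int (card {i. w i \<in> H t}))
      \<noteq> int CARD('m) * (\<Sum>t=1..\<gamma>. int (vec.dim (H t))) + int CARD('n) * \<delta> * int q"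
      using ob(2) bspec[OF cl p] fin by blast
    with ob(1) have "real_of_int (int CARD('n) * (\<Sum>t=1..\<gamma>. int (card {i. w i \<in> H t}))
      - int CARD('m) * (\<Sum>t=1..\<gamma>. int (vec.dim (H t))) - int CARD('n) * \<delta> * int q) < 0"
      unfolding of_int_less_0_iff by linarith
    then show "(\<Sum>t=1..\<gamma>. excess w (H t)) < real_of_int \<delta> * real q"
      unfolding excess_int_diff by (simp add: mult_less_0_iff)
  qed
next
  assume ?r
  then interpret stable_data M w q True
    using x q by unfold_locales (auto simp: cone_def lt_def)
  show ?l by (rule git_stable_pt) simp
qed

section \<open>Hessenberg functions and types of flags\<close>

lemma pimage_range_mscale:
  fixes M :: "'a::field^'n::finite^'n"
  assumes M: "M \<noteq> 0" and S: "vec.subspace S"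
  shows "pimage (range (\<lambda>c. mscale c M)) S = (*v) M ` S"
proof -
  define L where "L = (SOME L. L \<in> range (\<lambda>c. mscale c M) \<and> L \<noteq> 0)"
  have "M \<in> range (\<lambda>c. mscale c M) \<and> M \<noteq> 0" using M by (auto intro: image_eqI[of _ _ 1])
  then have "L \<in> range (\<lambda>c. mscale c M) \<and> L \<noteq> 0" unfolding L_def by (rule someI)
  then obtain c where c: "L = mscale c M" "c \<noteq> 0" using mscale_eq_0[of _ M] by auto
  have L: "L *v x = M *v (c *s x)" for x by (simp add: c(1) mscale_mult_vec vector_scalar_commute)
  have "(*v) M ` S \<subseteq> (*v) L ` S"
  proof
    fix y assume "y \<in> (*v) M ` S"
    then obtain x where x: "x \<in> S" "y = M *v x" by blast
    have "y = L *v (inverse c *s x)" unfolding L x(2) using c(2) by simp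
    then show "y \<in> (*v) L ` S" using vec.subspace_scale[OF S x(1)] by blast
  qed
  moreover have "(*v) L ` S \<subseteq> (*v) M ` S" using L vec.subspace_scale[OF S] by auto
  ultimately show ?thesis unfolding pimage_def L_def[symmetric] by blast
qed

text \<open>As the steps of a flag are nested, minimality of \<open>j\<close> need only be tested
  against its predecessor.\<close>

lemma hess_eq_iff:
  fixes M :: "'a::field^'n::finite^'n"
  assumes M: "M \<noteq> 0" and flag: "is_flag \<gamma> H" and ij: "i \<le> \<gamma> + 1" "j \<le> \<gamma> + 1"
  shows "hess (range (\<lambda>c. mscale c M)) \<gamma> H i = j \<longleftrightarrow>
    (*v) M ` H i \<subseteq> H j \<and> (1 \<le> j \<longrightarrow> \<not> (*v) M ` H i \<subseteq> H (j - 1))"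
proof -
  define A where "A = {j \<in> {0..\<gamma> + 1}. (*v) M ` H i \<subseteq> H j}"
  have h: "hess (range (\<lambda>c. mscale c M)) \<gamma> H i = Min A"
    unfolding hess_def A_def pimage_range_mscale[OF M is_flag_subspace[OF flag ij(1)]] ..
  have fin: "finite A" by (simp add: A_def)
  have "H (\<gamma> + 1) = UNIV" using flag by (simp add: is_flag_def)
  then have "\<gamma> + 1 \<in> A" by (simp add: A_def)
  then have ne: "A \<noteq> {}" by blast
  show ?thesis unfolding h
  proof
    assume eq: "Min A = j"
    have "j - 1 \<notin> A" if "1 \<le> j" using Min_le[OF fin, of "j - 1"] that eq by auto
    then show "(*v) M ` H i \<subseteq> H j \<and> (1 \<le> j \<longrightarrow> \<not> (*v) M ` H i \<subseteq> H (j - 1))"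
      using Min_in[OF fin ne] ij(2) unfolding eq by (auto simp: A_def)
  next
    assume r: "(*v) M ` H i \<subseteq> H j \<and> (1 \<le> j \<longrightarrow> \<not> (*v) M ` H i \<subseteq> H (j - 1))"
    show "Min A = j"
    proof (rule Min_eqI[OF fin])
      show "j \<in> A" using r ij(2) by (simp add: A_def)
      fix l assume l: "l \<in> A"
      show "j \<le> l"
      proof (rule ccontr)
        assume "\<not> j \<le> l"
        then have "1 \<le> j" "l \<le> j - 1" by simp_all
        then show False using r l is_flag_mono[OF flag, of l "j - 1"] ij(2) unfolding A_def by fastforce
      qed
    qed
  qed
qed

lemma type_iff_ftype:
  fixes M :: "'a::field^'n::finite^'n"
  assumes M: "M \<noteq> 0" and flag: "is_flag \<gamma> H"
  shows "type_I (range (\<lambda>c. mscale c M)) \<gamma> H \<longleftrightarrow> ftype M \<gamma> H 0"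
    and "type_II (range (\<lambda>c. mscale c M)) \<gamma> H \<longleftrightarrow> ftype M \<gamma> H 1"
    and "type_III (range (\<lambda>c. mscale c M)) \<gamma> H \<longleftrightarrow> ftype M \<gamma> H (- 1)"
proof -
  have "pimage (range (\<lambda>c. mscale c M)) (H 1) = (*v) M ` H 1"
    using is_flag_subspace[OF flag, of 1] by (intro pimage_range_mscale[OF M]) simp
  moreover have "pimage (range (\<lambda>c. mscale c M)) UNIV = range ((*v) M)"
    by (intro pimage_range_mscale[OF M] vec.subspace_UNIV)
  ultimately show "type_I (range (\<lambda>c. mscale c M)) \<gamma> H \<longleftrightarrow> ftype M \<gamma> H 0"
    unfolding type_I_def ftype_def by auto
  have "hess (range (\<lambda>c. mscale c M)) \<gamma> H t = t + 1 \<longleftrightarrow> (*v) M ` H t \<subseteq> H (t + 1) \<and> \<not> (*v) M ` H t \<subseteq> H t"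
    if "t \<in> {1..\<gamma>}" for t
    using hess_eq_iff[OF M flag, of t "t + 1"] that by simp
  then show "type_II (range (\<lambda>c. mscale c M)) \<gamma> H \<longleftrightarrow> ftype M \<gamma> H 1"
    unfolding type_II_def ftype_def by simp
  have "hess (range (\<lambda>c. mscale c M)) \<gamma> H t = t - 1 \<longleftrightarrow>
      (*v) M ` H t \<subseteq> H (t - 1) \<and> (t \<ge> 2 \<longrightarrow> \<not> (*v) M ` H t \<subseteq> H (t - 2))"
    if "t \<in> {1..\<gamma> + 1}" for t
  proof -
    have eqs: "t - 1 - 1 = t - 2" "1 \<le> t - 1 \<longleftrightarrow> 2 \<le> t" by auto
    have t: "t \<le> \<gamma> + 1" using that by simp
    from hess_eq_iff[OF M flag t order_trans[OF diff_le_self[of t 1] t]] show ?thesis unfolding eqs .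
  qed
  then show "type_III (range (\<lambda>c. mscale c M)) \<gamma> H \<longleftrightarrow> ftype M \<gamma> H (- 1)"
    unfolding type_III_def ftype_def by simp
qed

text \<open>The image of \<open>H 1\<close> distinguishes the types: type II moves it out of
  \<open>H 1\<close>, type I keeps it inside, and type III makes it zero. Type III also maps the
  whole space into \<open>H \<gamma>\<close>, which for \<open>\<gamma> = 1\<close> contradicts both
  alternatives of type I.\<close>

lemma ftype_unique:
  assumes flag: "is_flag \<gamma> H" and ft: "ftype M \<gamma> H \<delta>" "ftype M \<gamma> H \<epsilon>"
  shows "\<delta> = \<epsilon>"
proof -
  have st: "1 \<le> \<gamma>" "H 0 = {0}" "H (\<gamma> + 1) = UNIV" "vec.subspace (H 1)"
    using flag by (simp_all add: is_flag_def)
  have 0: "0 \<in> (*v) M ` H 1" "0 \<in> H 1"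
    using vec.subspace_0[OF st(4)] by (auto intro: image_eqI[of _ _ 0])
  have mem: "1 \<in> {1..\<gamma>}" "1 \<in> {1..\<gamma> + 1}" "\<gamma> + 1 \<in> {1..\<gamma> + 1}" using st(1) by simp_all
  define I II III where "I \<longleftrightarrow> \<gamma> = 1 \<and> (*v) M ` H 1 \<subseteq> H 1 \<and> ((*v) M ` H 1 \<noteq> {0} \<or> \<not> range ((*v) M) \<subseteq> H 1)"
    and "II \<longleftrightarrow> (\<forall>t\<in>{1..\<gamma>}. (*v) M ` H t \<subseteq> H (t + 1) \<and> \<not> (*v) M ` H t \<subseteq> H t)"
    and "III \<longleftrightarrow> (\<forall>t\<in>{1..\<gamma> + 1}. (*v) M ` H t \<subseteq> H (t - 1) \<and> (t \<ge> 2 \<longrightarrow> \<not> (*v) M ` H t \<subseteq> H (t - 2)))"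
  have "\<not> (I \<and> II)" using bspec[OF _ mem(1)] unfolding I_def II_def by blast
  moreover have three: "(*v) M ` H 1 = {0}" "range ((*v) M) \<subseteq> H \<gamma>" if III
  proof -
    have "(*v) M ` H 1 \<subseteq> H (1 - 1)" "(*v) M ` H (\<gamma> + 1) \<subseteq> H (\<gamma> + 1 - 1)"
      using that mem(2,3) unfolding III_def by blast+
    then show "(*v) M ` H 1 = {0}" "range ((*v) M) \<subseteq> H \<gamma>" using st(2,3) 0(1) by auto
  qed
  then have "\<not> (I \<and> III)" unfolding I_def by blast
  moreover have "\<not> (II \<and> III)"
  proof
    assume "II \<and> III"
    then have "\<not> (*v) M ` H 1 \<subseteq> H 1" "(*v) M ` H 1 = {0}" using mem(1) three(1) unfolding II_def by blast+
    then show False using 0(2) by simp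
  qed
  moreover have "\<delta> = 0 \<and> I \<or> \<delta> = 1 \<and> II \<or> \<delta> = - 1 \<and> III" "\<epsilon> = 0 \<and> I \<or> \<epsilon> = 1 \<and> II \<or> \<epsilon> = - 1 \<and> III"
    using ft unfolding ftype_def I_def II_def III_def by simp_all
  ultimately show ?thesis by blast
qed

lemma type_term_ftype:
  fixes M :: "'a::field^'n::finite^'n"
  assumes M: "M \<noteq> 0" and flag: "is_flag \<gamma> H" and ft: "ftype M \<gamma> H \<delta>"
  shows "type_term q (range (\<lambda>c. mscale c M)) \<gamma> H = real_of_int \<delta> * real q"
proof -
  have u: "ftype M \<gamma> H e \<longleftrightarrow> \<delta> = e" for e using ft ftype_unique[OF flag ft] by blast
  have "\<delta> = 0 \<or> \<delta> = 1 \<or> \<delta> = - 1" using ft unfolding ftype_def by blast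
  then show ?thesis unfolding type_term_def type_iff_ftype[OF M flag] u by auto
qed

lemma line_subset_iff:
  assumes "vec.subspace S" shows "range (\<lambda>c. c *s x) \<subseteq> S \<longleftrightarrow> x \<in> S"
proof
  assume "range (\<lambda>c. c *s x) \<subseteq> S"
  then have "1 *s x \<in> S" by blast
  then show "x \<in> S" by simp
next
  assume "x \<in> S"
  from vec.subspace_scale[OF assms this] show "range (\<lambda>c. c *s x) \<subseteq> S" by blast
qed

lemma flag_inequality_iff:
  fixes M :: "'a::field^'n::finite^'n" and w :: "'m::finite \<Rightarrow> 'a^'n"
  assumes M: "M \<noteq> 0" and flag: "is_flag \<gamma> H" and ft: "ftype M \<gamma> H \<delta>"
    and pt: "pt (M, w) = (T, v)" and N: "CARD('n) = N + 1"
  shows "(\<Sum>j=1..\<gamma>. real (card {i. v i \<subseteq> H j}))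
      \<le> real CARD('m) / real (N + 1) * (\<Sum>j=1..\<gamma>. real (vec.dim (H j))) + type_term q T \<gamma> H \<longleftrightarrow>
      (\<Sum>t=1..\<gamma>. excess w (H t)) \<le> real_of_int \<delta> * real q"
    and "(\<Sum>j=1..\<gamma>. real (card {i. v i \<subseteq> H j}))
      < real CARD('m) / real (N + 1) * (\<Sum>j=1..\<gamma>. real (vec.dim (H j))) + type_term q T \<gamma> H \<longleftrightarrow>
      (\<Sum>t=1..\<gamma>. excess w (H t)) < real_of_int \<delta> * real q"
proof -
  have T: "T = range (\<lambda>c. mscale c M)" "v = (\<lambda>i. range (\<lambda>c. c *s w i))" using pt by (auto simp: pt_def)
  have "v i \<subseteq> H j \<longleftrightarrow> w i \<in> H j" if "j \<in> {1..\<gamma>}" for i j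
    unfolding T(2) using that by (intro line_subset_iff is_flag_subspace[OF flag]) simp
  then have "(\<Sum>j=1..\<gamma>. real (card {i. v i \<subseteq> H j})) = (\<Sum>j=1..\<gamma>. real (card {i. w i \<in> H j}))"
    by (intro sum.cong refl) simp
  moreover have "type_term q T \<gamma> H = real_of_int \<delta> * real q"
    unfolding T(1) by (rule type_term_ftype[OF M flag ft])
  ultimately show "(\<Sum>j=1..\<gamma>. real (card {i. v i \<subseteq> H j}))
      \<le> real CARD('m) / real (N + 1) * (\<Sum>j=1..\<gamma>. real (vec.dim (H j))) + type_term q T \<gamma> H \<longleftrightarrow>
      (\<Sum>t=1..\<gamma>. excess w (H t)) \<le> real_of_int \<delta> * real q"
    "(\<Sum>j=1..\<gamma>. real (card {i. v i \<subseteq> H j}))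
      < real CARD('m) / real (N + 1) * (\<Sum>j=1..\<gamma>. real (vec.dim (H j))) + type_term q T \<gamma> H \<longleftrightarrow>
      (\<Sum>t=1..\<gamma>. excess w (H t)) < real_of_int \<delta> * real q"
    unfolding sum_excess N[symmetric] by linarith+
qed

theorem theorem1p3:
  fixes N n q :: nat
  assumes "N > 0" and "n > 0" and "q > 0"
    and "CARD('n::finite) = N + 1" and "CARD('m::finite) = n"
  shows
    "(\<forall>T \<in> (PMat :: ('a::alg_closed_field ^ 'n ^ 'n) set set). \<forall>\<gamma> H. is_flag \<gamma> H \<longrightarrow>
        \<not> (type_I T \<gamma> H \<and> type_II T \<gamma> H) \<and>
        \<not> (type_I T \<gamma> H \<and> type_III T \<gamma> H) \<and>
        \<not> (type_II T \<gamma> H \<and> type_III T \<gamma> H))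
     \<and>
     (\<forall>T v. (T, v) \<in> (XX :: ('a, 'n, 'm) point set) \<longrightarrow>
        (git_semistable q (\<lambda>_. 1) (T, v) \<longleftrightarrow>
          (\<forall>\<gamma> H. 1 \<le> \<gamma> \<and> \<gamma> \<le> N \<and> is_flag \<gamma> H \<and>
             (type_I T \<gamma> H \<or> type_II T \<gamma> H \<or> type_III T \<gamma> H) \<longrightarrow>
             (\<Sum>j=1..\<gamma>. real (card {i. v i \<subseteq> H j}))
               \<le> real n / real (N + 1) * (\<Sum>j=1..\<gamma>. real (vec.dim (H j))) + type_term q T \<gamma> H)))
     \<and>
     (\<forall>T v. (T, v) \<in> (XX :: ('a, 'n, 'm) point set) \<longrightarrow>
        (git_stable q (\<lambda>_. 1) (T, v) \<longleftrightarrow>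
          (\<forall>\<gamma> H. is_flag \<gamma> H \<and>
             (type_I T \<gamma> H \<or> type_II T \<gamma> H \<or> type_III T \<gamma> H) \<longrightarrow>
             (\<Sum>j=1..\<gamma>. real (card {i. v i \<subseteq> H j}))
               < real n / real (N + 1) * (\<Sum>j=1..\<gamma>. real (vec.dim (H j))) + type_term q T \<gamma> H)))"
proof (intro conjI ballI allI impI)
  fix T :: "('a^'n^'n) set" and \<gamma> and H :: "nat \<Rightarrow> ('a^'n) set" assume T: "T \<in> PMat" and flag: "is_flag \<gamma> H"
  obtain M where M: "T = range (\<lambda>c. mscale c M)" "M \<noteq> 0" using T by (auto simp: PMat_def)
  note types = type_iff_ftype[OF M(2) flag, folded M(1)]
  show "\<not> (type_I T \<gamma> H \<and> type_II T \<gamma> H)" "\<not> (type_I T \<gamma> H \<and> type_III T \<gamma> H)" "\<not> (type_II T \<gamma> H \<and> type_III T \<gamma> H)"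
    unfolding types using ftype_unique[OF flag, of M 0 1] ftype_unique[OF flag, of M 0 "- 1"] ftype_unique[OF flag, of M 1 "- 1"] by auto
next
  fix T :: "('a^'n^'n) set" and v :: "'m \<Rightarrow> ('a^'n) set" assume "(T, v) \<in> XX"
  then obtain M w where x: "(M, w) \<in> cone" "pt (M, w) = (T, v)" unfolding XX_eq by auto
  have M: "M \<noteq> 0" using x(1) by (simp add: cone_def)
  have T: "T = range (\<lambda>c. mscale c M)" using x(2) by (simp add: pt_def)
  have types: "type_I T \<gamma> H \<or> type_II T \<gamma> H \<or> type_III T \<gamma> H \<longleftrightarrow> (\<exists>\<delta>. ftype M \<gamma> H \<delta>)" if "is_flag \<gamma> H" for \<gamma> H
  proof -
    have "ftype M \<gamma> H \<delta> \<Longrightarrow> \<delta> = 0 \<or> \<delta> = 1 \<or> \<delta> = - 1" for \<delta> unfolding ftype_def by blast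
    then show ?thesis unfolding T type_iff_ftype[OF M that] by metis
  qed
  \<comment> \<open>Dimensions increase strictly along a flag, which bounds its length by
    \<open>N\<close>.\<close>
  have le: "1 \<le> \<gamma> \<and> \<gamma> \<le> N" if "is_flag \<gamma> H" for \<gamma> and H :: "nat \<Rightarrow> ('a^'n) set"
    using is_flag_le[OF that] that assms(4) by (simp add: is_flag_def)
  note ineq = flag_inequality_iff[OF M _ _ x(2) assms(4), unfolded assms(5)]
  show "git_semistable q (\<lambda>_. 1) (T, v) \<longleftrightarrow>
      (\<forall>\<gamma> H. 1 \<le> \<gamma> \<and> \<gamma> \<le> N \<and> is_flag \<gamma> H \<and> (type_I T \<gamma> H \<or> type_II T \<gamma> H \<or> type_III T \<gamma> H) \<longrightarrow>
        (\<Sum>j=1..\<gamma>. real (card {i. v i \<subseteq> H j}))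
          \<le> real n / real (N + 1) * (\<Sum>j=1..\<gamma>. real (vec.dim (H j))) + type_term q T \<gamma> H)" (is "_ \<longleftrightarrow> ?r")
    unfolding semistable_criterion[OF x(1) assms(3), unfolded x(2)]
  proof (intro iffI allI impI; (elim conjE)?)
    fix \<gamma> and H :: "nat \<Rightarrow> ('a^'n) set"
    assume l: "\<forall>\<gamma> H \<delta>. is_flag \<gamma> H \<longrightarrow> ftype M \<gamma> H \<delta> \<longrightarrow> (\<Sum>t=1..\<gamma>. excess w (H t)) \<le> real_of_int \<delta> * real q"
      and flag: "is_flag \<gamma> H" and ty: "type_I T \<gamma> H \<or> type_II T \<gamma> H \<or> type_III T \<gamma> H"
    obtain \<delta> where ft: "ftype M \<gamma> H \<delta>" using types[OF flag] ty by blast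
    show "(\<Sum>j=1..\<gamma>. real (card {i. v i \<subseteq> H j}))
        \<le> real n / real (N + 1) * (\<Sum>j=1..\<gamma>. real (vec.dim (H j))) + type_term q T \<gamma> H"
      using l[rule_format, OF flag ft] ineq(1)[OF flag ft] by blast
  next
    fix \<gamma> \<delta> and H :: "nat \<Rightarrow> ('a^'n) set"
    assume r: ?r and flag: "is_flag \<gamma> H" and ft: "ftype M \<gamma> H \<delta>"
    have "type_I T \<gamma> H \<or> type_II T \<gamma> H \<or> type_III T \<gamma> H" using types[OF flag] ft by blast
    then have "(\<Sum>j=1..\<gamma>. real (card {i. v i \<subseteq> H j}))
        \<le> real n / real (N + 1) * (\<Sum>j=1..\<gamma>. real (vec.dim (H j))) + type_term q T \<gamma> H"
      using r le[OF flag] flag by blast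
    then show "(\<Sum>t=1..\<gamma>. excess w (H t)) \<le> real_of_int \<delta> * real q"
      using ineq(1)[OF flag ft] by blast
  qed
  show "git_stable q (\<lambda>_. 1) (T, v) \<longleftrightarrow>
      (\<forall>\<gamma> H. is_flag \<gamma> H \<and> (type_I T \<gamma> H \<or> type_II T \<gamma> H \<or> type_III T \<gamma> H) \<longrightarrow>
        (\<Sum>j=1..\<gamma>. real (card {i. v i \<subseteq> H j}))
          < real n / real (N + 1) * (\<Sum>j=1..\<gamma>. real (vec.dim (H j))) + type_term q T \<gamma> H)" (is "_ \<longleftrightarrow> ?r")
    unfolding stable_criterion[OF x(1) assms(3), unfolded x(2)]
  proof (intro iffI allI impI; (elim conjE)?)
    fix \<gamma> and H :: "nat \<Rightarrow> ('a^'n) set"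
    assume l: "\<forall>\<gamma> H \<delta>. is_flag \<gamma> H \<longrightarrow> ftype M \<gamma> H \<delta> \<longrightarrow> (\<Sum>t=1..\<gamma>. excess w (H t)) < real_of_int \<delta> * real q"
      and flag: "is_flag \<gamma> H" and ty: "type_I T \<gamma> H \<or> type_II T \<gamma> H \<or> type_III T \<gamma> H"
    obtain \<delta> where ft: "ftype M \<gamma> H \<delta>" using types[OF flag] ty by blast
    show "(\<Sum>j=1..\<gamma>. real (card {i. v i \<subseteq> H j}))
        < real n / real (N + 1) * (\<Sum>j=1..\<gamma>. real (vec.dim (H j))) + type_term q T \<gamma> H"
      using l[rule_format, OF flag ft] ineq(2)[OF flag ft] by blast
  next
    fix \<gamma> \<delta> and H :: "nat \<Rightarrow> ('a^'n) set"
    assume r: ?r and flag: "is_flag \<gamma> H" and ft: "ftype M \<gamma> H \<delta>"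
    have "type_I T \<gamma> H \<or> type_II T \<gamma> H \<or> type_III T \<gamma> H" using types[OF flag] ft by blast
    then have "(\<Sum>j=1..\<gamma>. real (card {i. v i \<subseteq> H j}))
        < real n / real (N + 1) * (\<Sum>j=1..\<gamma>. real (vec.dim (H j))) + type_term q T \<gamma> H"
      using r le[OF flag] flag by blast
    then show "(\<Sum>t=1..\<gamma>. excess w (H t)) < real_of_int \<delta> * real q"
      using ineq(2)[OF flag ft] by blast
  qed
qed

end
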